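(* Let $T_i x = A_i x + d_i$ ($1\le i\le m$) be affine maps of $\mathbb R^2$, where the $A_i$ are invertible $2\times 2$ real matrices with all entries strictly positive and $\|A_i\|_2<1$, and $d_i\in\mathbb R^2$. Let $E$ be the attractor (self-affine set) of the IFS $\{T_1,\dots,T_m\}$ and assume the strong separation condition, i.e. the sets $T_1(E),\dots,T_m(E)$ are pairwise disjoint. Let $\mu$ be the Käenmäki measure and $\mu_F$ the corresponding Furstenberg measure. Suppose that for $\mu_F$-almost all $\theta\in\mathbb{RP}^1$ the projection of $\mu$ in direction $\theta$ is absolutely continuous with respect to Lebesgue measure. Then the measure $\mu$ (viewed as a measure on $E$) is exact dimensional, and $$\dim_H E=\dim_B E=\dim_A E .$$
   Context: The attractor $E$ is the unique non-empty compact set with $E=\bigcup_{i=1}^m T_i(E)$. For words, $A_{a_1\cdots a_n}=A_{a_1}\cdots A_{a_n}$ and $T_{a_1\cdots a_n}=T_{a_1}\cdots T_{a_n}$; $\alpha_1(a_1\cdots a_n)\ge\alpha_2(a_1\cdots a_n)>0$ are the singular values of $A_{a_1\cdots a_n}$. For a matrix $A$ with singular values $\alpha_1\ge\alpha_2>0$ put $\phi^s(A)=\alpha_1^s$ for $0<s\le 1$ and $\phi^s(A)=\alpha_1\alpha_2^{s-1}$ for $s\ge 1$. The affinity dimension is $\dim_A E=\dim_A(A_1,\dots,A_m)=\inf\{s>0:\sum_{n\ge1}\sum_{a_1\cdots a_n\in\{1,\dots,m\}^n}\phi^s(A_{a_1\cdots a_n})<\infty\}$. $\Sigma=\{1,\dots,m\}^{\mathbb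 N}$ with left shift $\sigma$; $[a_1\cdots a_n]\subset\Sigma$ denotes a cylinder; $\pi:\Sigma\to E$, $\pi(a)=\lim_n T_{a_1\cdots a_n}(y)$ (independent of $y$), is a bijection under strong separation. The Käenmäki measure $\mu$ is the unique $\sigma$-invariant probability measure on $\Sigma$ (it is ergodic) for which, with $s=\dim_A(A_1,\dots,A_m)$, there is $C>0$ with $C^{-1}\phi^s(A_{a_1\cdots a_n})\le\mu[a_1\cdots a_n]\le C\phi^s(A_{a_1\cdots a_n})$ for all words. It is identified with the measure $\mu\circ\pi^{-1}$ on $E$. $\mathbb{RP}^1$ is the set of directions (unit vectors up to sign) in $\mathbb R^2$; $\mathcal Q_2\subset\mathbb{RP}^1$ is the set of directions of non-zero vectors $(x,y)$ with $xy\le0$. Let $\phi_i:\mathbb{RP}^1\to\mathbb{RP}^1$, $\phi_i(\theta)=A_i^{-1}\theta/\|A_i^{-1}\theta\|$; $\phi_i$ maps $\mathcal Q_2$ into itself. Let $\overline\mu$ be the unique shift-invariant measure on $\Sigma^{\pm}=\{1,\dots,m\}^{\mathbb Z}$ that agrees with $\mu$ on cylinders depending only on positive coordinates, and let $\rho(\overline a)=\lim_{n\to\infty}\phi_{a_0}\phi_{a_{-1}}\cdots\phi_{a_{-n}}(\theta)$, which exists and is independent of $\theta\in\mathcal Q_2$. The Furstenberg measure is $\mu_F=\overline\mu\circ\rho^{-1}$ (the stationary measure on $\mathbb{RP}^1$ for the maps $\phi_i$ chosen according to $\mu$). The projection of $\mu$ in direction $\theta$ is its image under orthogonal projection onto the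 line $\theta^\perp$. A measure $\mu$ is exact dimensional if the local dimension $\lim_{\delta\to0}\log\mu(B(x,\delta))/\log\delta$ exists and equals the same constant for $\mu$-almost every $x$. $\dim_H,\dim_B$ denote Hausdorff and box-counting dimension (the statement includes existence of $\dim_B E$). *)

theory Defs
  imports "HOL-Probability.Probability"
begin

definition delta_cover :: "real \<Rightarrow> 'a::euclidean_space set \<Rightarrow> 'a set set \<Rightarrow> bool" where
  "delta_cover \<delta> E \<C> \<longleftrightarrow> E \<subseteq> \<Union>\<C> \<and> (\<forall>U\<in>\<C>. bounded U \<and> diameter U \<le> \<delta>)"

definition hausdorff_premeasure :: "real \<Rightarrow> real \<Rightarrow> 'a::euclidean_space set \<Rightarrow> ennreal" where
  "hausdorff_premeasure s \<delta> E =
     (INF U \<in> {U :: nat \<Rightarrow> 'a set. delta_cover \<delta> E (range U)}.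
        \<Sum>i. ennreal (diameter (U i) powr s))"

definition hausdorff_measure :: "real \<Rightarrow> 'a::euclidean_space set \<Rightarrow> ennreal" where
  "hausdorff_measure s E = (SUP \<delta> \<in> {0<..}. hausdorff_premeasure s \<delta> E)"

text \<open>
  Only exponents \<open>s > 0\<close> are used: this does not change the infimum, and it avoids
  \<open>0 powr 0 = 0\<close> (so that \<open>hausdorff_measure 0\<close> is not the counting measure).
  The infimum is over a non-empty set, as all \<open>s > DIM('a)\<close> qualify.
\<close>
definition hausdorff_dim :: "'a::euclidean_space set \<Rightarrow> real" where
  "hausdorff_dim E = Inf {s. s > 0 \<and> hausdorff_measure s E = 0}"

definition covering_number :: "real \<Rightarrow> 'a::euclidean_space set \<Rightarrow> nat" where
  "covering_number \<delta> E = (LEAST n. \<exists>\<C>. finite \<C> \<and> card \<C> = n \<and> delta_cover \<delta> E \<C>)"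

definition has_box_dim :: "'a::euclidean_space set \<Rightarrow> real \<Rightarrow> bool" where
  "has_box_dim E D \<longleftrightarrow>
     ((\<lambda>\<delta>. ln (real (covering_number \<delta> E)) / - ln \<delta>) \<longlongrightarrow> D) (at_right 0)"

text \<open>
  The convention \<open>ln 0 = 0\<close> is harmless here: almost every point lies in the support,
  where all balls have positive measure.
\<close>
definition exact_dimensional :: "'a::euclidean_space measure \<Rightarrow> bool" where
  "exact_dimensional M \<longleftrightarrow>
     (\<exists>D. AE x in M. ((\<lambda>\<delta>. ln (measure M (cball x \<delta>)) / ln \<delta>) \<longlongrightarrow> D) (at_right 0))"

text \<open>
  A \<open>2 \<times> 2\<close> matrix has two singular values counted with multiplicity, so they are
  the maximum and the minimum of this set (which is a singleton when they coincide).
\<close>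
definition singular_values :: "real^2^2 \<Rightarrow> real set" where
  "singular_values A =
     {\<sigma>. \<sigma> \<ge> 0 \<and> (\<exists>v. v \<noteq> 0 \<and> (transpose A ** A) *v v = \<sigma>\<^sup>2 *\<^sub>R v)}"

definition alpha1 :: "real^2^2 \<Rightarrow> real" where
  "alpha1 A = Max (singular_values A)"

definition alpha2 :: "real^2^2 \<Rightarrow> real" where
  "alpha2 A = Min (singular_values A)"

definition sv_function :: "real \<Rightarrow> real^2^2 \<Rightarrow> real" where
  "sv_function s A =
     (if s \<le> 1 then alpha1 A powr s else alpha1 A * alpha2 A powr (s - 1))"

text \<open>The alphabet \<open>{1,\<dots>,m}\<close> is an arbitrary finite type \<open>'m\<close>.\<close>

primrec word_matrix :: "('m \<Rightarrow> real^2^2) \<Rightarrow> 'm list \<Rightarrow> real^2^2" where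
  "word_matrix A [] = mat 1"
| "word_matrix A (i # w) = A i ** word_matrix A w"

definition affinity_dim :: "('m::finite \<Rightarrow> real^2^2) \<Rightarrow> real" where
  "affinity_dim A =
     Inf {s. s > 0 \<and> summable (\<lambda>n. \<Sum>w | length w = Suc n. sv_function s (word_matrix A w))}"

definition ifs_map :: "('m \<Rightarrow> real^2^2) \<Rightarrow> ('m \<Rightarrow> real^2) \<Rightarrow> 'm \<Rightarrow> real^2 \<Rightarrow> real^2" where
  "ifs_map A d i x = A i *v x + d i"

definition is_attractor :: "('m \<Rightarrow> real^2^2) \<Rightarrow> ('m \<Rightarrow> real^2) \<Rightarrow> (real^2) set \<Rightarrow> bool" where
  "is_attractor A d E \<longleftrightarrow> E \<noteq> {} \<and> compact E \<and> E = (\<Union>i. ifs_map A d i ` E)"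

primrec word_map :: "('m \<Rightarrow> real^2^2) \<Rightarrow> ('m \<Rightarrow> real^2) \<Rightarrow> 'm list \<Rightarrow> real^2 \<Rightarrow> real^2" where
  "word_map A d [] x = x"
| "word_map A d (i # w) x = ifs_map A d i (word_map A d w x)"

text \<open>
  One-sided sequences are indexed from \<open>0\<close>, so the \<open>n\<close>-th letter of a sequence
  \<open>a\<close> is \<open>a (n - 1)\<close>.
\<close>
definition coding :: "('m \<Rightarrow> real^2^2) \<Rightarrow> ('m \<Rightarrow> real^2) \<Rightarrow> (nat \<Rightarrow> 'm) \<Rightarrow> real^2" where
  "coding A d a = (THE x. \<forall>y. (\<lambda>n. word_map A d (map a [0..<n]) y) \<longlonglongrightarrow> x)"

text \<open>The product sigma-algebra, which is the Borel one for the product of discrete topologies.\<close>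
definition seq_space :: "('i \<Rightarrow> 'm) measure" where
  "seq_space = (\<Pi>\<^sub>M _\<in>UNIV. count_space UNIV)"

definition cylinder :: "'m list \<Rightarrow> (nat \<Rightarrow> 'm) set" where
  "cylinder w = {a. \<forall>k<length w. a k = w ! k}"

definition is_kaenmaki_measure :: "('m::finite \<Rightarrow> real^2^2) \<Rightarrow> (nat \<Rightarrow> 'm) measure \<Rightarrow> bool" where
  "is_kaenmaki_measure A \<mu> \<longleftrightarrow>
     prob_space \<mu> \<and> sets \<mu> = sets seq_space \<and>
     distr \<mu> seq_space (\<lambda>a n. a (n + 1)) = \<mu> \<and>
     (\<exists>C>0. \<forall>w.
        inverse C * sv_function (affinity_dim A) (word_matrix A w) \<le> measure \<mu> (cylinder w) \<and>
        measure \<mu> (cylinder w) \<le> C * sv_function (affinity_dim A) (word_matrix A w))"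

definition is_two_sided_extension :: "(nat \<Rightarrow> 'm) measure \<Rightarrow> (int \<Rightarrow> 'm) measure \<Rightarrow> bool" where
  "is_two_sided_extension \<mu> \<nu> \<longleftrightarrow>
     prob_space \<nu> \<and> sets \<nu> = sets seq_space \<and>
     distr \<nu> seq_space (\<lambda>a k. a (k + 1)) = \<nu> \<and>
     (\<forall>w. measure \<nu> {a. \<forall>k<length w. a (int k + 1) = w ! k} = measure \<mu> (cylinder w))"

quotient_type direction =
  "real^2" / partial: "\<lambda>u v. norm u = 1 \<and> (v = u \<or> v = - u)"
proof (rule part_equivpI)
  show "\<exists>u :: real^2. norm u = 1 \<and> (u = u \<or> u = - u)"
    by (rule exI[of _ "axis 1 1"]) simp
qed (auto intro!: sympI transpI)

text \<open>
  The distance between two directions is the distance between the corresponding pairs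
  of antipodal points, which gives the quotient topology.
\<close>
instantiation direction :: metric_space
begin

lift_definition dist_direction :: "direction \<Rightarrow> direction \<Rightarrow> real"
  is "\<lambda>u v. min (norm (u - v)) (norm (u + v))"
proof -
  fix u u' v v' :: "real^2"
  assume "norm u = 1 \<and> (u' = u \<or> u' = - u)" and "norm v = 1 \<and> (v' = v \<or> v' = - v)"
  moreover have "norm (- u - v) = norm (u + v)" "norm (- u + v) = norm (u - v)"
    by (metis add_uminus_conv_diff minus_add_distrib norm_minus_cancel,
        metis minus_diff_eq norm_minus_cancel uminus_add_conv_diff)
  ultimately show "min (norm (u - v)) (norm (u + v)) = min (norm (u' - v')) (norm (u' + v'))"
    by (auto simp: min.commute norm_minus_commute)
qed

definition uniformity_direction :: "(direction \<times> direction) filter" where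
  "uniformity_direction = (INF e\<in>{0<..}. principal {(x, y). dist x y < e})"

definition open_direction :: "direction set \<Rightarrow> bool" where
  "open_direction U \<longleftrightarrow> (\<forall>x\<in>U. eventually (\<lambda>(x', y). x' = x \<longrightarrow> y \<in> U) uniformity)"

instance
proof
  fix x y z :: direction
  show "dist x y = 0 \<longleftrightarrow> x = y"
    by transfer (auto simp: min_def add_eq_0_iff split: if_splits)
  show "dist x y \<le> dist x z + dist y z"
  proof transfer
    fix x y z :: "real^2"
    have "norm (x - y) \<le> norm (x - z) + norm (y - z)"
      using norm_triangle_ineq4[of "x - z" "y - z"] by simp
    moreover have "norm (x - y) \<le> norm (x + z) + norm (y + z)"
      using norm_triangle_ineq4[of "x + z" "y + z"] by simp
    moreover have "norm (x + y) \<le> norm (x - z) + norm (y + z)"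
      using norm_triangle_ineq[of "x - z" "y + z"] by simp
    moreover have "norm (x + y) \<le> norm (x + z) + norm (y - z)"
      using norm_triangle_ineq[of "x + z" "y - z"] by simp
    ultimately show "min (norm (x - y)) (norm (x + y)) \<le>
      min (norm (x - z)) (norm (x + z)) + min (norm (y - z)) (norm (y + z))"
      by linarith
  qed
qed (simp_all add: uniformity_direction_def open_direction_def)

end

definition direction_of :: "real^2 \<Rightarrow> direction" where
  "direction_of v = abs_direction (v /\<^sub>R norm v)"

text \<open>
  The function \<open>rep_direction\<close> selects one of the two unit vectors \<open>u\<close>, \<open>- u\<close> of a
  direction. Everything below is independent of this choice.
\<close>

lemma norm_rep_direction [simp]: "norm (rep_direction \<theta>) = 1"
  using Quotient_rep_reflp[OF Quotient_direction] by blast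

lemma direction_of_minus [simp]: "direction_of (- v) = direction_of v"
proof (cases "v = 0")
  case False
  then show ?thesis
    unfolding direction_of_def by (intro Quotient_rel_abs[OF Quotient_direction]) simp
qed simp

definition proj_map :: "real^2^2 \<Rightarrow> direction \<Rightarrow> direction" where
  "proj_map B \<theta> = direction_of (matrix_inv B *v rep_direction \<theta>)"

definition Q2 :: "direction set" where
  "Q2 = {direction_of v | v. v \<noteq> 0 \<and> v $ 1 * v $ 2 \<le> 0}"

text \<open>
  Note the order of composition: \<open>foldr f [0..<Suc n] \<theta> = f 0 (f 1 (\<dots> (f n \<theta>)))\<close>.
\<close>
definition rho :: "('m \<Rightarrow> real^2^2) \<Rightarrow> (int \<Rightarrow> 'm) \<Rightarrow> direction" where
  "rho A a = (THE r. \<forall>\<theta>\<in>Q2.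
     (\<lambda>n. foldr (\<lambda>k. proj_map (A (a (- int k)))) [0..<Suc n] \<theta>) \<longlonglongrightarrow> r)"

definition furstenberg_measure ::
    "('m \<Rightarrow> real^2^2) \<Rightarrow> (int \<Rightarrow> 'm) measure \<Rightarrow> direction measure" where
  "furstenberg_measure A \<nu> = distr \<nu> borel (rho A)"

definition orth_proj :: "direction \<Rightarrow> real^2 \<Rightarrow> real^2" where
  "orth_proj \<theta> x = x - (x \<bullet> rep_direction \<theta>) *\<^sub>R rep_direction \<theta>"

text \<open>
  Lebesgue (length) measure on the line orthogonal to \<open>\<theta>\<close>, as a Borel measure on the
  plane: the image of Lebesgue measure on the reals under \<open>t \<mapsto> t w\<close> with
  \<open>w\<close> a unit vector orthogonal to \<open>\<theta>\<close>.
\<close>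
definition perp_line_measure :: "direction \<Rightarrow> (real^2) measure" where
  "perp_line_measure \<theta> =
     (let u = rep_direction \<theta>
      in distr lborel borel (\<lambda>t. t *\<^sub>R (vector [- (u $ 2), u $ 1] :: real^2)))"

definition projection_abs_cont :: "(real^2) measure \<Rightarrow> direction \<Rightarrow> bool" where
  "projection_abs_cont M \<theta> \<longleftrightarrow>
     absolutely_continuous (perp_line_measure \<theta>) (distr M borel (orth_proj \<theta>))"

end

(*
  Write s for the affinity dimension. If s < 1, then E has coverings too economical for its
  projections to have positive length, against absolute continuity; so s \<ge> 1. Covering the
  ellipses T_w(E), with w stopped when the second singular value drops below \<delta>, by squares of
  side \<delta> bounds the upper box dimension, and with it the upper local dimension of \<mu>, by s.

  For the lower local dimension, let w = a_1 ... a_n. By strong separation a ball around \<pi>(a)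
  of radius r comparable to alpha2(A_w) meets only T_w(E), and it pulls back under T_w to a strip
  of width about r / alpha1(A_w) around \<pi>(\<sigma>^n a), orthogonal to the image of a fixed normal
  under the transpose of A_w. Extending a to a two-sided sequence, that normal becomes the one of
  the Furstenberg direction of the shifted sequence, in which the projection of \<mu> is absolutely
  continuous. By the quasi-Bernoulli property past and future are independent up to a constant
  factor, so almost surely the projected measure has finite upper density at the projected point
  (Vitali), i.e. the strip has measure at most a multiple k of its width. The maximal ergodic
  inequality makes k uniform along a set of times n with only small relative gaps, whence
  \<mu>(B(\<pi>(a), r)) \<le> const. alpha1 alpha2^(s-1) alpha2 / alpha1 = const. alpha2^s at such times.
*)
theory Submission
  imports Defs
begin

section \<open>Positive matrices\<close>

text \<open>Constant factors do not affect dimensions, so the singular values are replaced by the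
  entry sum and by the determinant divided by it; on products of positive matrices both are
  multiplicative up to a constant. The obstacle is that the normal of the strip changes with the
  time \<open>n\<close>, whereas absolute continuity controls single directions, and only almost all
  of them. The starting normal is therefore taken to be the one that belongs to the past of the
  two-sided sequence itself. It is then carried exactly to the normal of the shifted sequence, so
  that "the strip is too heavy" is one event observed along a stationary orbit, and no rate of
  convergence of directions enters the mass estimate. The maximal inequality gives good times with a
  constant \<open>k\<close> that depends on the orbit. A radius \<open>r\<close> is reached between
  good times; since the gap is a small proportion of the elapsed time, the smaller singular value
  changes over it by at most a small power of \<open>r\<close>, which is absorbed by proving the
  bound for each exponent \<open>t < s\<close>.\<close>

definition esum :: "real^2^2 \<Rightarrow> real" where
  "esum M = M$1$1 + M$1$2 + M$2$1 + M$2$2"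

definition nonneg_mat :: "real^2^2 \<Rightarrow> bool" where
  "nonneg_mat M \<longleftrightarrow> (\<forall>i j. M$i$j \<ge> 0)"

lemma nonneg_matD: "nonneg_mat M \<Longrightarrow> M$i$j \<ge> 0"
  by (simp add: nonneg_mat_def)

lemma mult2_nth: "((M::real^2^2) ** N)$i$j = M$i$1 * N$1$j + M$i$2 * N$2$j"
  by (simp add: matrix_matrix_mult_def sum_2)

lemma mulv2_nth: "((M::real^2^2) *v x)$i = M$i$1 * x$1 + M$i$2 * x$2"
  by (simp add: matrix_vector_mult_def sum_2)

lemma inner2: "(x::real^2) \<bullet> y = x$1 * y$1 + x$2 * y$2"
  by (simp add: inner_vec_def sum_2)

lemma norm2_sq: "(norm (x::real^2))\<^sup>2 = (x$1)\<^sup>2 + (x$2)\<^sup>2"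
  using power2_norm_eq_inner[of x] by (simp add: inner2 power2_eq_square)

lemma vec2_eq_iff: "(x::real^2) = y \<longleftrightarrow> x$1 = y$1 \<and> x$2 = y$2"
  by (simp add: vec_eq_iff forall_2)

text \<open>The squares of the singular values are the roots of the characteristic polynomial of
  \<open>transpose M ** M\<close>, whose trace is the sum of the squared entries and whose
  determinant is the square of \<open>det M\<close>.\<close>

lemma singular_values_iff:
  fixes M :: "real^2^2"
  defines "t \<equiv> (M$1$1)\<^sup>2 + (M$1$2)\<^sup>2 + (M$2$1)\<^sup>2 + (M$2$2)\<^sup>2"
  shows "\<sigma> \<in> singular_values M \<longleftrightarrow> \<sigma> \<ge> 0 \<and> (\<sigma>\<^sup>2)\<^sup>2 - t * \<sigma>\<^sup>2 + (det M)\<^sup>2 = 0"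
proof -
  let ?B = "transpose M ** M"
  let ?C = "?B - \<sigma>\<^sup>2 *\<^sub>R mat 1"
  have "(\<exists>v. v \<noteq> 0 \<and> ?B *v v = \<sigma>\<^sup>2 *\<^sub>R v) \<longleftrightarrow> (\<exists>v. v \<noteq> 0 \<and> ?C *v v = 0)"
    by (simp add: matrix_vector_mult_diff_rdistrib flip: scalar_mult_eq_scaleR)
       (simp add: scalar_mult_eq_scaleR scaleR_matrix_vector_assoc[symmetric])
  also have "\<dots> \<longleftrightarrow> \<not> invertible ?C"
    using matrix_left_invertible_ker[of ?C] invertible_left_inverse[of ?C] by blast
  also have "\<dots> \<longleftrightarrow> det ?C = 0"
    by (simp add: invertible_det_nz)
  also have "det ?C = (\<sigma>\<^sup>2)\<^sup>2 - t * \<sigma>\<^sup>2 + (det M)\<^sup>2"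
    unfolding t_def
    by (simp add: det_2 mult2_nth transpose_def mat_def power2_eq_square algebra_simps)
  finally show ?thesis
    by (simp add: singular_values_def)
qed

text \<open>Vieta's formulas for the roots \<open>r1\<close>, \<open>r2\<close> of that polynomial.
  They are real because the discriminant factors as \<open>(t + 2 * D) * (t - 2 * D)\<close>, and
  both \<open>t + 2 * det M\<close> and \<open>t - 2 * det M\<close> are sums of two
  squares.\<close>

lemma singular_values_sum_prod:
  fixes M :: "real^2^2"
  shows "alpha1 M \<ge> alpha2 M" "alpha2 M \<ge> 0" "alpha1 M * alpha2 M = \<bar>det M\<bar>"
    "(alpha1 M)\<^sup>2 + (alpha2 M)\<^sup>2 = (M$1$1)\<^sup>2 + (M$1$2)\<^sup>2 + (M$2$1)\<^sup>2 + (M$2$2)\<^sup>2"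
proof -
  define t where "t = (M$1$1)\<^sup>2 + (M$1$2)\<^sup>2 + (M$2$1)\<^sup>2 + (M$2$2)\<^sup>2"
  define D where "D = \<bar>det M\<bar>"
  define e where "e = sqrt (t\<^sup>2 - 4 * D\<^sup>2)"
  have tp: "t + 2 * D \<ge> 0" "t \<ge> 0" "D \<ge> 0" by (auto simp: t_def D_def)
  have "t - 2 * det M = (M$1$1 - M$2$2)\<^sup>2 + (M$1$2 + M$2$1)\<^sup>2"
    "t + 2 * det M = (M$1$1 + M$2$2)\<^sup>2 + (M$1$2 - M$2$1)\<^sup>2"
    by (simp_all add: t_def det_2 power2_eq_square algebra_simps)
  then have "t - 2 * det M \<ge> 0" "t + 2 * det M \<ge> 0" by simp_all
  then have tm: "t - 2 * D \<ge> 0" by (simp add: D_def abs_if)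
  have "t\<^sup>2 - 4 * D\<^sup>2 = (t + 2 * D) * (t - 2 * D)"
    by (simp add: power2_eq_square algebra_simps)
  then have "t\<^sup>2 - 4 * D\<^sup>2 \<ge> 0" using tp tm by simp
  then have e: "e\<^sup>2 = t\<^sup>2 - 4 * D\<^sup>2" "e \<ge> 0" by (auto simp: e_def)
  have et: "e \<le> t"
    using e tp by (metis add.commute diff_le_eq le_add_same_cancel1 mult_nonneg_nonneg
        power2_le_imp_le zero_le_numeral zero_le_power2)
  define r1 where "r1 = (t + e) / 2"
  define r2 where "r2 = (t - e) / 2"
  have r: "0 \<le> r2" "r2 \<le> r1" "r1 + r2 = t"
    using et e(2) by (auto simp: r1_def r2_def field_simps)
  have r12: "r1 * r2 = D\<^sup>2"
    using e(1) by (simp add: r1_def r2_def field_simps power2_eq_square)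
  have fac: "x\<^sup>2 - t * x + D\<^sup>2 = (x - r1) * (x - r2)" for x
    using r12 by (simp add: r(3)[symmetric] power2_eq_square algebra_simps)
  have *: "\<sigma> \<in> singular_values M \<longleftrightarrow> \<sigma> \<ge> 0 \<and> (\<sigma>\<^sup>2 = r1 \<or> \<sigma>\<^sup>2 = r2)" for \<sigma>
    using singular_values_iff[of \<sigma> M] fac[of "\<sigma>\<^sup>2"] by (simp add: t_def D_def)
  have sv: "singular_values M = {sqrt r1, sqrt r2}"
    unfolding set_eq_iff * using r by (auto simp: real_sqrt_unique)
  have "alpha1 M = sqrt r1" "alpha2 M = sqrt r2"
    using r by (auto simp: alpha1_def alpha2_def sv max_def min_def)
  then show "alpha1 M \<ge> alpha2 M" "alpha2 M \<ge> 0" "alpha1 M * alpha2 M = \<bar>det M\<bar>"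
    "(alpha1 M)\<^sup>2 + (alpha2 M)\<^sup>2 = (M$1$1)\<^sup>2 + (M$1$2)\<^sup>2 + (M$2$1)\<^sup>2 + (M$2$2)\<^sup>2"
    using r r12 by (auto simp: D_def t_def simp flip: real_sqrt_mult)
qed

text \<open>Both sides are compared with the sum \<open>T\<close> of the squared entries, which lies
  between the square of \<open>alpha1 M\<close> and twice that square. Non-negative entries bound
  \<open>T\<close> by the square of \<open>esum M\<close>, which in turn is at most
  \<open>4 * T\<close>; the factor 3 is the square root of 8, rounded up.\<close>

lemma alpha1_esum:
  assumes "nonneg_mat M"
  shows "alpha1 M \<le> esum M" "esum M \<le> 3 * alpha1 M"
proof -
  define T where "T = (M$1$1)\<^sup>2 + (M$1$2)\<^sup>2 + (M$2$1)\<^sup>2 + (M$2$2)\<^sup>2"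
  note s = singular_values_sum_prod[of M, folded T_def]
  note n = nonneg_matD[OF assms]
  have "T \<le> (esum M)\<^sup>2"
    using n[of 1 1] n[of 1 2] n[of 2 1] n[of 2 2]
    by (simp add: T_def esum_def power2_eq_square algebra_simps)
  then have "(alpha1 M)\<^sup>2 \<le> (esum M)\<^sup>2" using s(4) zero_le_power2[of "alpha2 M"] by linarith
  then show "alpha1 M \<le> esum M"
    by (rule power2_le_imp_le) (use n in \<open>simp add: esum_def\<close>)
  have "(alpha2 M)\<^sup>2 \<le> (alpha1 M)\<^sup>2"
    using s by (simp add: power_mono)
  moreover have "(esum M)\<^sup>2 \<le> 4 * T"
  proof -
    have "4 * T - (esum M)\<^sup>2 = (M$1$1 - M$1$2)\<^sup>2 + (M$1$1 - M$2$1)\<^sup>2 + (M$1$1 - M$2$2)\<^sup>2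
       + (M$1$2 - M$2$1)\<^sup>2 + (M$1$2 - M$2$2)\<^sup>2 + (M$2$1 - M$2$2)\<^sup>2"
      by (simp add: T_def esum_def power2_eq_square algebra_simps)
    also have "\<dots> \<ge> 0" by (intro add_nonneg_nonneg) auto
    finally show ?thesis by simp
  qed
  ultimately have "(esum M)\<^sup>2 \<le> 8 * (alpha1 M)\<^sup>2" using s(4) by linarith
  then have "(esum M)\<^sup>2 \<le> (3 * alpha1 M)\<^sup>2"
    using zero_le_power2[of "alpha1 M"] by (simp only: power_mult_distrib power2_eq_square[of 3])
  then show "esum M \<le> 3 * alpha1 M"
    by (rule power2_le_imp_le) (use s in simp)
qed

lemma alpha2_esum:
  assumes "nonneg_mat M" "det M \<noteq> 0"
  shows "\<bar>det M\<bar> / esum M \<le> alpha2 M" "alpha2 M \<le> 3 * (\<bar>det M\<bar> / esum M)" "alpha1 M > 0"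
    "alpha2 M > 0" "esum M > 0"
proof -
  note s = singular_values_sum_prod[of M]
  show a: "alpha1 M > 0" "alpha2 M > 0"
    using s assms(2) by (metis abs_eq_0 mult_zero_left order_antisym_conv order_trans not_less mult_zero_right)+
  then show e: "esum M > 0" using alpha1_esum(1)[OF assms(1)] by linarith
  have "\<bar>det M\<bar> \<le> alpha2 M * esum M"
    using alpha1_esum(1)[OF assms(1)] s(3)[symmetric] a by (simp add: mult.commute)
  then show "\<bar>det M\<bar> / esum M \<le> alpha2 M" using e by (simp add: field_simps)
  have "alpha2 M * esum M \<le> 3 * \<bar>det M\<bar>"
    using mult_left_mono[OF alpha1_esum(2)[OF assms(1)], of "alpha2 M"] a(2) s(3)[symmetric]
    by (simp only: mult_ac)
  then show "alpha2 M \<le> 3 * (\<bar>det M\<bar> / esum M)" using e by (simp add: field_simps)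
qed

lemma norm_mulv_lower:
  fixes M :: "real^2^2"
  assumes "nonneg_mat M" "esum M > 0"
  shows "\<bar>det M\<bar> / esum M * norm x \<le> norm (M *v x)"
proof -
  define y where "y = M *v x"
  \<comment> \<open>The adjugate of \<open>M\<close>: it takes \<open>M *v x\<close> back to
    \<open>det M\<close> times \<open>x\<close>, and its entries are up to sign those of
    \<open>M\<close>, so it stretches norms by at most \<open>esum M\<close>.\<close>
  define N :: "real^2^2" where "N = vector [vector [M$2$2, - M$1$2], vector [- M$2$1, M$1$1]]"
  have 1: "N *v y = det M *\<^sub>R x"
    by (simp add: vec2_eq_iff N_def y_def mulv2_nth det_2 algebra_simps)
  note n = nonneg_matD[OF assms(1)]
  have c: "\<bar>y$i\<bar> \<le> norm y" for i by (rule component_le_norm_cart)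
  have "norm (N *v y) \<le> \<bar>(N *v y)$1\<bar> + \<bar>(N *v y)$2\<bar>"
    using norm_le_l1_cart[of "N *v y"] by (simp add: sum_2)
  also have "\<bar>(N *v y)$1\<bar> \<le> (M$2$2 + M$1$2) * norm y"
  proof -
    have "\<bar>(N *v y)$1\<bar> \<le> M$2$2 * \<bar>y$1\<bar> + M$1$2 * \<bar>y$2\<bar>"
      using n[of 2 2] n[of 1 2] abs_triangle_ineq4[of "M$2$2 * y$1" "M$1$2 * y$2"]
      by (simp add: mulv2_nth N_def abs_mult)
    also have "\<dots> \<le> M$2$2 * norm y + M$1$2 * norm y"
      by (intro add_mono mult_left_mono c n)
    finally show ?thesis by (simp add: algebra_simps)
  qed
  also have "\<bar>(N *v y)$2\<bar> \<le> (M$2$1 + M$1$1) * norm y"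
  proof -
    have "\<bar>(N *v y)$2\<bar> \<le> M$2$1 * \<bar>y$1\<bar> + M$1$1 * \<bar>y$2\<bar>"
      using n[of 2 1] n[of 1 1] abs_triangle_ineq4[of "M$1$1 * y$2" "M$2$1 * y$1"]
      by (simp add: mulv2_nth N_def abs_mult)
    also have "\<dots> \<le> M$2$1 * norm y + M$1$1 * norm y"
      by (intro add_mono mult_left_mono c n)
    finally show ?thesis by (simp add: algebra_simps)
  qed
  finally have "norm (N *v y) \<le> esum M * norm y" by (simp add: esum_def algebra_simps)
  then have "\<bar>det M\<bar> * norm x \<le> esum M * norm y" by (simp add: 1)
  then show ?thesis using assms(2) by (simp add: y_def field_simps)
qed

lemma word_matrix_append: "word_matrix A (u @ v) = word_matrix A u ** word_matrix A v"
  by (induction u) (auto simp: matrix_mul_assoc)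

lemma word_map_append: "word_map A d (u @ v) x = word_map A d u (word_map A d v x)"
  by (induction u) auto

lemma word_map_diff: "word_map A d w x - word_map A d w y = word_matrix A w *v (x - y)"
  by (induction w)
     (auto simp: ifs_map_def matrix_vector_mul_assoc[symmetric] simp flip: matrix_vector_mult_diff_distrib)

definition permanent :: "real^2^2 \<Rightarrow> real" where
  "permanent M = M$1$1 * M$2$2 + M$1$2 * M$2$1"

lemma permanent_mult: "nonneg_mat M \<Longrightarrow> nonneg_mat N \<Longrightarrow> permanent M * permanent N \<le> permanent (M ** N)"
  using nonneg_matD[of M] nonneg_matD[of N]
  by (simp add: permanent_def mult2_nth algebra_simps)

lemma permanent_esum: "nonneg_mat M \<Longrightarrow> permanent M \<le> (esum M)\<^sup>2"
  using nonneg_matD[of M]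
  by (simp add: permanent_def esum_def power2_eq_square algebra_simps)

section \<open>Products of finitely many positive matrices: estimates uniform in the word\<close>

locale positive_matrices =
  fixes A :: "'m::finite \<Rightarrow> real^2^2"
  assumes inv: "\<And>i. invertible (A i)"
    and pos: "\<And>i j k. A i $ j $ k > 0"
    and contr: "\<And>i. onorm ((*v) (A i)) < 1"
begin

abbreviation "W w \<equiv> word_matrix A w"

text \<open>
  Up to a factor \<open>3\<close>, \<open>nn w\<close> and \<open>bt w\<close> are the singular values of \<open>W w\<close>
  (\<open>alpha_W\<close> below); unlike these they behave simply under concatenation of words.
\<close>
definition "nn w = esum (W w)"
definition "bt w = \<bar>det (W w)\<bar> / nn w"
definition "kap = Max (range (\<lambda>(i, j, k, j', k'). A i $ j $ k / A i $ j' $ k'))"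
definition "gam = Max (range (\<lambda>i. \<bar>det (A i)\<bar> / permanent (A i)))"
definition "cr = Max (range (\<lambda>i. onorm ((*v) (A i))))"
definition "b0 = Min (range (\<lambda>i. bt [i]))"

lemma kap: "A i $ j $ k \<le> kap * A i $ j' $ k'"
proof -
  have "A i $ j $ k / A i $ j' $ k' \<le> kap"
    unfolding kap_def by (rule Max_ge, simp, rule range_eqI[of _ _ "(i, j, k, j', k')"]) simp
  then show ?thesis using pos[of i j' k'] by (simp add: field_simps)
qed

lemma kap_ge1: "kap \<ge> 1"
  using kap[of undefined 1 1 1 1] pos[of undefined 1 1] by simp

lemma nonneg_W: "nonneg_mat (W w)"
proof (induction w)
  case Nil show ?case by (simp add: nonneg_mat_def mat_def)
next
  case (Cons i w)
  then show ?case
    by (auto simp: nonneg_mat_def mult2_nth intro!: add_nonneg_nonneg mult_nonneg_nonneg less_imp_le[OF pos])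
qed

lemmas W_nonneg = nonneg_matD[OF nonneg_W]

lemma det_A: "det (A i) \<noteq> 0" using inv[of i] by (simp add: invertible_det_nz)

lemma det_W: "det (W w) \<noteq> 0"
  by (induction w) (auto simp: det_mul det_A)

lemma nn_pos: "nn w > 0"
  unfolding nn_def by (rule alpha2_esum(5)[OF nonneg_W det_W])

lemma bt_pos: "bt w > 0" using nn_pos[of w] det_W[of w] by (simp add: bt_def)

text \<open>The rows of \<open>W (i # v)\<close> arise from the rows of \<open>A i\<close> by
  multiplication with the same matrix \<open>W v\<close>, so the ratio \<open>kap\<close> of entries
  of one letter survives in words of any length. Each row thus carries at least the fraction
  \<open>1 / (1 + kap)\<close> of the entry sum.\<close>

lemma row_sum_cmp: "nn w \<le> (1 + kap) * (W w $ k $ 1 + W w $ k $ 2)"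
proof -
  have "W w $ k' $ 1 + W w $ k' $ 2 \<le> kap * (W w $ k $ 1 + W w $ k $ 2)" for k'
  proof (cases w)
    case Nil then show ?thesis using kap_ge1 exhaust_2[of k] exhaust_2[of k'] by (auto simp: mat_def)
  next
    case (Cons i v)
    have "A i $ k' $ l * W v $ l $ j \<le> kap * A i $ k $ l * W v $ l $ j" for l j
      by (intro mult_right_mono kap W_nonneg)
    from add_mono[OF add_mono[OF this[of 1 1] this[of 2 1]] add_mono[OF this[of 1 2] this[of 2 2]]]
    show ?thesis by (simp add: Cons mult2_nth algebra_simps)
  qed
  from this[of 1] this[of 2] show ?thesis
    using exhaust_2[of k] by (auto simp: nn_def esum_def algebra_simps)
qed

lemma nn_append_le: "nn (u @ v) \<le> nn u * nn v"
  using W_nonneg[of u] W_nonneg[of v]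
  by (simp add: nn_def word_matrix_append esum_def mult2_nth algebra_simps)

text \<open>\<open>nn (u @ v)\<close> weights the column sums of \<open>W u\<close> with the row
  sums of \<open>W v\<close>, and by \<open>row_sum_cmp\<close> each of the latter is at least a
  fixed fraction of \<open>nn v\<close>. The constant is independent of the lengths; through
  \<open>bt_append_le\<close> it leads to the quasi-Bernoulli property.\<close>

lemma nn_append_ge: "nn u * nn v \<le> (1 + kap) * nn (u @ v)"
proof -
  define r where "r k = W v $ k $ 1 + W v $ k $ 2" for k
  have 1: "nn (u @ v) = (W u $1$1 + W u $2$1) * r 1 + (W u $1$2 + W u $2$2) * r 2"
    by (simp add: nn_def word_matrix_append esum_def mult2_nth algebra_simps r_def)
  have "nn u * nn v = (W u $1$1 + W u $2$1) * nn v + (W u $1$2 + W u $2$2) * nn v"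
    by (simp add: nn_def[of u] esum_def algebra_simps)
  also have "\<dots> \<le> (W u $1$1 + W u $2$1) * ((1 + kap) * r 1) + (W u $1$2 + W u $2$2) * ((1 + kap) * r 2)"
    unfolding r_def by (intro add_mono mult_left_mono row_sum_cmp add_nonneg_nonneg W_nonneg)
  finally show ?thesis by (simp add: 1 algebra_simps)
qed

lemma bt_append_ge: "bt u * bt v \<le> bt (u @ v)"
proof -
  have "bt u * bt v = \<bar>det (W u) * det (W v)\<bar> / (nn u * nn v)" by (simp add: bt_def abs_mult)
  also have "\<dots> \<le> \<bar>det (W u) * det (W v)\<bar> / nn (u @ v)"
    by (intro divide_left_mono nn_append_le) (auto intro!: mult_pos_pos nn_pos)
  finally show ?thesis by (simp add: bt_def word_matrix_append det_mul)
qed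

lemma bt_append_le: "bt (u @ v) \<le> (1 + kap) * (bt u * bt v)"
proof -
  have "bt (u @ v) = (1 + kap) * (\<bar>det (W u) * det (W v)\<bar> / ((1 + kap) * nn (u @ v)))"
    using kap_ge1 by (simp add: bt_def word_matrix_append det_mul)
  also have "\<dots> \<le> (1 + kap) * (\<bar>det (W u) * det (W v)\<bar> / (nn u * nn v))"
    using kap_ge1
    by (intro mult_left_mono divide_left_mono nn_append_ge) (auto intro!: mult_pos_pos nn_pos)
  finally show ?thesis by (simp add: bt_def abs_mult)
qed

lemma cr: "0 \<le> cr" "cr < 1" "norm (A i *v x) \<le> cr * norm x"
proof -
  have ge: "onorm ((*v) (A i)) \<le> cr" for i by (auto simp: cr_def)
  show "0 \<le> cr" using order_trans[OF onorm_pos_le ge[of undefined]] by simp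
  show "cr < 1" by (auto simp: cr_def contr)
  show "norm (A i *v x) \<le> cr * norm x"
    using onorm[of "(*v) (A i)" x] mult_right_mono[OF ge[of i], of "norm x"] by (simp add: mult.commute)
qed

lemma norm_W: "norm (W w *v x) \<le> cr ^ length w * norm x"
proof (induction w)
  case (Cons i w)
  have "norm (W (i # w) *v x) \<le> cr * norm (W w *v x)"
    using cr(3) by (simp flip: matrix_vector_mul_assoc)
  also have "\<dots> \<le> cr * (cr ^ length w * norm x)" by (intro mult_left_mono Cons cr)
  finally show ?case by simp
qed auto

lemma nn_le: "nn w \<le> 4 * cr ^ length w"
proof -
  have "W w $ i $ j \<le> cr ^ length w" for i j
  proof -
    have "\<bar>(W w *v axis j 1) $ i\<bar> \<le> norm (W w *v axis j 1)" by (rule component_le_norm_cart)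
    also have "\<dots> \<le> cr ^ length w" using norm_W[of w "axis j 1"] by simp
    finally show ?thesis by (simp add: matrix_vector_mul_component inner_axis)
  qed
  from add_mono[OF add_mono[OF this[of 1 1] this[of 1 2]] add_mono[OF this[of 2 1] this[of 2 2]]]
  show ?thesis by (simp add: nn_def esum_def)
qed

lemma nn_le4: "nn w \<le> 4"
  using nn_le[of w] power_le_one[of cr "length w"] cr by simp

lemma permanent_pos: "permanent (A i) > 0" by (simp add: permanent_def pos add_pos_pos)

lemma gam: "0 \<le> gam" "gam < 1" "\<bar>det (A i)\<bar> \<le> gam * permanent (A i)"
proof -
  have ge: "\<bar>det (A i)\<bar> / permanent (A i) \<le> gam" for i by (auto simp: gam_def)
  show "0 \<le> gam" using order_trans[OF _ ge[of undefined]] permanent_pos[of undefined] by simp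
  show "\<bar>det (A i)\<bar> \<le> gam * permanent (A i)" using ge[of i] permanent_pos[of i] by (simp add: field_simps)
  have "\<bar>det (A i)\<bar> < permanent (A i)" for i
    using mult_pos_pos[OF pos[of i 1 1] pos[of i 2 2]] mult_pos_pos[OF pos[of i 1 2] pos[of i 2 1]]
    by (auto simp: det_2 permanent_def abs_if)
  then show "gam < 1" using permanent_pos by (auto simp: gam_def)
qed

text \<open>
  The permanent is supermultiplicative on non-negative matrices, whereas \<open>det\<close> is
  multiplicative: hence \<open>det / nn\<^sup>2\<close> decays exponentially, which makes the projective
  action contract.
\<close>
lemma det_W_permanent: "\<bar>det (W w)\<bar> \<le> gam ^ length w * permanent (W w)"
proof (induction w)
  case Nil then show ?case by (simp only: word_matrix.simps det_I) (simp add: permanent_def mat_def)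
next
  case (Cons i w)
  have "\<bar>det (W (i # w))\<bar> = \<bar>det (A i)\<bar> * \<bar>det (W w)\<bar>" by (simp add: det_mul abs_mult)
  also have "\<dots> \<le> (gam * permanent (A i)) * (gam ^ length w * permanent (W w))"
    by (intro mult_mono gam Cons) (use gam(1) permanent_pos[of i] in auto)
  also have "\<dots> = gam ^ length (i # w) * (permanent (A i) * permanent (W w))" by simp
  also have "\<dots> \<le> gam ^ length (i # w) * permanent (W (i # w))"
    using permanent_mult[of "A i" "W w"] nonneg_W gam(1)
    by (intro mult_left_mono) (auto simp: nonneg_mat_def less_imp_le[OF pos])
  finally show ?case .
qed

lemma det_W_nn: "\<bar>det (W w)\<bar> \<le> gam ^ length w * (nn w)\<^sup>2"
  using det_W_permanent[of w] mult_left_mono[OF permanent_esum[OF nonneg_W[of w]], of "gam ^ length w"] gam(1)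
  by (simp add: nn_def)

lemma bt_le_nn: "bt w \<le> nn w"
proof -
  have "\<bar>det (W w)\<bar> \<le> 1 * (nn w)\<^sup>2"
    by (rule order_trans[OF det_W_nn])
       (intro mult_right_mono power_le_one gam(1) less_imp_le[OF gam(2)] zero_le_power2)
  then show ?thesis using nn_pos[of w] by (simp add: bt_def field_simps power2_eq_square)
qed

lemma bt_le: "bt w \<le> 4 * cr ^ length w" using bt_le_nn[of w] nn_le[of w] by linarith

lemma b0: "b0 > 0" "b0 \<le> bt [i]"
  using bt_pos by (auto simp: b0_def)

lemma bt_snoc: "b0 * bt w \<le> bt (w @ [i])"
  using order_trans[OF mult_right_mono[OF b0(2)[of i], of "bt w"]] bt_append_ge[of w "[i]"] bt_pos[of w]
  by (simp add: mult.commute)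

text \<open>Limits how far \<open>bt\<close> can fall between a good time and the time at which a
  given radius is reached.\<close>

lemma bt_append_ge_pow: "b0 ^ length v * bt u \<le> bt (u @ v)"
proof (induction v rule: rev_induct)
  case (snoc i v)
  have "b0 ^ length (v @ [i]) * bt u \<le> b0 * bt (u @ v)" using snoc b0(1) by simp
  also have "\<dots> \<le> bt (u @ (v @ [i]))" using bt_snoc[of "u @ v" i] by simp
  finally show ?case .
qed auto

text \<open>Bounds the overshoot when a word is stopped as soon as \<open>nn\<close> falls below a
  level.\<close>

lemma nn_snoc: "\<exists>c>0. \<forall>w i. c * nn w \<le> nn (w @ [i])"
proof -
  define c where "c = Min (range (\<lambda>i. nn [i])) / (1 + kap)"
  have "c > 0" using nn_pos kap_ge1 by (auto simp: c_def)
  moreover have "c * nn w \<le> nn (w @ [i])" for w i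
  proof -
    have "c * nn w \<le> nn [i] / (1 + kap) * nn w"
      unfolding c_def using kap_ge1 nn_pos[of w] by (intro mult_right_mono divide_right_mono) auto
    also have "\<dots> \<le> nn (w @ [i])" using nn_append_ge[of w "[i]"] kap_ge1 by (simp add: field_simps)
    finally show ?thesis .
  qed
  ultimately show ?thesis by blast
qed

lemma norm_W_ge: "bt w * norm x \<le> norm (W w *v x)"
  unfolding bt_def nn_def using norm_mulv_lower[OF nonneg_W] nn_pos[of w] by (simp add: nn_def)

end

section \<open>The coding map\<close>

lemma space_seq_space [simp]: "space seq_space = UNIV"
  by (simp add: seq_space_def space_PiM)

lemma measurable_seq_component [measurable]: "(\<lambda>a. a k) \<in> seq_space \<rightarrow>\<^sub>M count_space UNIV"
  unfolding seq_space_def by (rule measurable_component_singleton) simp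

lemma measurable_seqI:
  "(\<And>k. (\<lambda>x. f x k) \<in> M \<rightarrow>\<^sub>M count_space UNIV) \<Longrightarrow> f \<in> M \<rightarrow>\<^sub>M seq_space"
  unfolding seq_space_def by (rule measurable_PiM_single') (auto simp: space_PiM)

text \<open>\<open>l\<close> is a finite window of coordinates. The index type is left general
  because one-sided and two-sided sequences are both needed.\<close>

lemma sets_window:
  fixes l :: "'i list" and U :: "('m::finite) list set"
  shows "{a. map a l \<in> U} \<in> sets seq_space"
proof -
  have 1: "{a :: 'i \<Rightarrow> 'm. map a l = u} \<in> sets seq_space" for u
  proof (induction l arbitrary: u)
    case Nil then show ?case using sets.top[of seq_space] by (cases "u = []") auto
  next
    case (Cons k l)
    show ?case
    proof (cases u)
      case (Cons x v)
      have "(\<lambda>a. a k) -` {x} \<inter> space seq_space \<in> sets (seq_space :: ('i \<Rightarrow> 'm) measure)"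
        by (rule measurable_sets[OF measurable_seq_component]) simp
      moreover have "{a :: 'i \<Rightarrow> 'm. map a (k # l) = u} = ((\<lambda>a. a k) -` {x} \<inter> space seq_space) \<inter> {a. map a l = v}"
        using Cons by auto
      ultimately show ?thesis using Cons.IH[of v] by auto
    qed simp
  qed
  have "{a :: 'i \<Rightarrow> 'm. map a l \<in> U} = (\<Union>u\<in>{u. set u \<subseteq> UNIV \<and> length u = length l} \<inter> U. {a. map a l = u})"
    by auto
  also have "\<dots> \<in> sets seq_space"
    by (intro sets.finite_UN finite_Int disjI1 finite_lists_length_eq 1) auto
  finally show ?thesis .
qed

lemma measurable_window:
  fixes f :: "('m::finite) list \<Rightarrow> 'b"
  assumes "\<And>u. f u \<in> space N"
  shows "(\<lambda>a. f (map a l)) \<in> seq_space \<rightarrow>\<^sub>M N"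
proof (rule measurableI)
  fix S assume "S \<in> sets N"
  have "(\<lambda>a. f (map a l)) -` S \<inter> space seq_space = {a. map a l \<in> f -` S}" by auto
  then show "(\<lambda>a. f (map a l)) -` S \<inter> space seq_space \<in> sets seq_space" by (simp only: sets_window)
qed (simp add: assms)

abbreviation pre :: "(nat \<Rightarrow> 'm) \<Rightarrow> nat \<Rightarrow> 'm list" where
  "pre a n \<equiv> map a [0..<n]"

lemma pre_add: "pre a (n + m) = pre a n @ pre (\<lambda>k. a (k + n)) m"
proof (rule nth_equalityI)
  fix i assume "i < length (pre a (n + m))"
  then show "pre a (n + m) ! i = (pre a n @ pre (\<lambda>k. a (k + n)) m) ! i"
    by (cases "i < n") (simp_all add: nth_append less_diff_conv2)
qed simp

lemma cylinder_pre: "cylinder w = {a. pre a (length w) = w}"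
proof -
  have "pre a (length w) = w \<longleftrightarrow> (\<forall>k<length w. a k = w ! k)" for a
    unfolding list_eq_iff_nth_eq[of "pre a (length w)"] by simp
  then show ?thesis by (simp add: cylinder_def)
qed

lemma sets_cylinder [measurable]: "cylinder (w :: 'm::finite list) \<in> sets seq_space"
  using sets_window[of "[0..<length w]" "{w}"] by (simp add: cylinder_pre)

section \<open>Coding of the attractor and separation of its pieces\<close>

locale positive_ifs = positive_matrices A for A :: "'m::finite \<Rightarrow> real^2^2" +
  fixes d :: "'m \<Rightarrow> real^2" and E :: "(real^2) set"
  assumes attr: "is_attractor A d E"
    and sep: "disjoint_family (\<lambda>i. ifs_map A d i ` E)"
begin

abbreviation "T w \<equiv> word_map A d w"
abbreviation "\<pi> \<equiv> coding A d"

lemma E_ne: "E \<noteq> {}" and E_compact: "compact E" and E_eq: "E = (\<Union>i. ifs_map A d i ` E)"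
  using attr by (auto simp: is_attractor_def)

lemma T_in_E: "x \<in> E \<Longrightarrow> T w x \<in> E"
  by (induction w) (use E_eq in auto)

lemma T_dist: "dist (T w x) (T w y) \<le> cr ^ length w * dist x y"
  using norm_W[of w "x - y"] by (simp add: dist_norm word_map_diff)

lemma T_dist_ge: "bt w * dist x y \<le> dist (T w x) (T w y)"
  using norm_W_ge[of w "x - y"] by (simp add: dist_norm word_map_diff)

lemma continuous_T: "isCont (T w) x"
proof (rule lipschitz_on_continuous_within[of "cr ^ length w"])
  show "(cr ^ length w)-lipschitz_on UNIV (T w)"
    by (rule lipschitz_onI) (auto simp: T_dist cr)
qed auto

lemma cr_pow_0: "(\<lambda>n. cr ^ n * c) \<longlonglongrightarrow> 0"
  using tendsto_mult[OF LIMSEQ_realpow_zero[OF cr(1,2)] tendsto_const[of c]] by simp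

text \<open>For a base point in \<open>E\<close>, all iterates from time \<open>N\<close> on lie in
  the image of \<open>E\<close> under \<open>T (pre a N)\<close>, whose diameter is at most
  \<open>cr ^ N * D\<close>. Contraction draws every other base point to the same limit.\<close>

lemma coding_ex: "\<exists>x. \<forall>y. (\<lambda>n. T (pre a n) y) \<longlonglongrightarrow> x"
proof -
  obtain e where e: "e \<in> E" using E_ne by auto
  obtain D where D: "\<And>x y. x \<in> E \<Longrightarrow> y \<in> E \<Longrightarrow> dist x y \<le> D"
    using compact_imp_bounded[OF E_compact] by (auto simp: bounded_two_points)
  have "Cauchy (\<lambda>n. T (pre a n) e)"
  proof (rule metric_CauchyI)
    fix r :: real assume "r > 0"
    then have "eventually (\<lambda>n. cr ^ n * D < r) sequentially"
      using cr_pow_0[of D] by (auto dest: order_tendstoD)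
    then obtain N where N: "cr ^ N * D < r" by (auto simp: eventually_sequentially)
    have "dist (T (pre a m) e) (T (pre a n) e) < r" if mn: "m \<ge> N" "n \<ge> N" for m n
    proof -
      obtain m' n' where mn: "m = N + m'" "n = N + n'" using mn by (metis le_iff_add)
      have "dist (T (pre a m) e) (T (pre a n) e) \<le> cr ^ N * D"
        unfolding mn pre_add word_map_append
        using order_trans[OF T_dist[of "pre a N"] mult_left_mono[OF D[OF T_in_E[OF e] T_in_E[OF e]]]] cr(1) by simp
      then show ?thesis using N by simp
    qed
    then show "\<exists>M. \<forall>m\<ge>M. \<forall>n\<ge>M. dist (T (pre a m) e) (T (pre a n) e) < r" by blast
  qed
  then obtain x where x: "(\<lambda>n. T (pre a n) e) \<longlonglongrightarrow> x"
    using Cauchy_convergent_iff convergent_def by blast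
  have "(\<lambda>n. T (pre a n) y) \<longlonglongrightarrow> x" for y
  proof (rule Lim_transform[OF x])
    show "(\<lambda>n. T (pre a n) y - T (pre a n) e) \<longlonglongrightarrow> 0"
      by (rule Lim_null_comparison[OF _ cr_pow_0[of "dist y e"]])
         (use T_dist[of "pre a _" y e] in \<open>auto simp: dist_norm\<close>)
  qed
  then show ?thesis by blast
qed

lemma coding_lim: "(\<lambda>n. T (pre a n) y) \<longlonglongrightarrow> \<pi> a"
proof -
  obtain x where x: "\<And>y. (\<lambda>n. T (pre a n) y) \<longlonglongrightarrow> x" using coding_ex[of a] by blast
  have "\<pi> a = x"
    unfolding coding_def using x by (intro the_equality) (auto intro: LIMSEQ_unique)
  then show ?thesis using x by simp
qed

lemma coding_in_E: "\<pi> a \<in> E"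
proof -
  obtain e where e: "e \<in> E" using E_ne by auto
  show ?thesis
    by (rule closed_sequentially[OF compact_imp_closed[OF E_compact] _ coding_lim[of a e]])
       (rule T_in_E[OF e])
qed

lemma coding_shift: "\<pi> a = T (pre a n) (\<pi> (\<lambda>k. a (k + n)))"
proof -
  have "(\<lambda>m. T (pre a (n + m)) 0) \<longlonglongrightarrow> T (pre a n) (\<pi> (\<lambda>k. a (k + n)))"
    unfolding pre_add word_map_append
    by (rule isCont_tendsto_compose[OF continuous_T coding_lim])
  moreover have "(\<lambda>m. T (pre a (n + m)) 0) \<longlonglongrightarrow> \<pi> a"
    using LIMSEQ_ignore_initial_segment[OF coding_lim[of a 0], of n] by (simp add: add.commute)
  ultimately show ?thesis using LIMSEQ_unique by blast
qed

text \<open>A code is read off by choosing for each point of \<open>E\<close> a piece that contains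
  it and a preimage in \<open>E\<close>, and iterating this choice.\<close>

lemma coding_surj: "x \<in> E \<Longrightarrow> \<exists>a. x = \<pi> a"
proof -
  assume x: "x \<in> E"
  have "\<forall>x\<in>E. \<exists>i. \<exists>y\<in>E. x = ifs_map A d i y" using E_eq by blast
  then obtain I Y where IY: "\<And>x. x \<in> E \<Longrightarrow> Y x \<in> E \<and> x = ifs_map A d (I x) (Y x)"
    by metis
  define y where "y n = (Y ^^ n) x" for n
  have y: "y n \<in> E" for n by (induction n) (auto simp: y_def x IY)
  define a where "a n = I (y n)" for n
  have *: "x = T (pre a n) (y n)" for n
  proof (induction n)
    case (Suc n)
    have "y n = ifs_map A d (a n) (y (Suc n))" using IY[OF y[of n]] by (simp add: a_def y_def)
    then show ?case using Suc by (simp add: word_map_append)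
  qed (simp add: y_def)
  obtain D where D: "\<And>x y. x \<in> E \<Longrightarrow> y \<in> E \<Longrightarrow> dist x y \<le> D"
    using compact_imp_bounded[OF E_compact] by (auto simp: bounded_two_points)
  have "(\<lambda>n. T (pre a n) x - x) \<longlonglongrightarrow> 0"
  proof (rule Lim_null_comparison[OF _ cr_pow_0[of D]], rule always_eventually, rule allI)
    fix n
    have "dist (T (pre a n) x) (T (pre a n) (y n)) \<le> cr ^ n * D"
      using order_trans[OF T_dist[of "pre a n"] mult_left_mono[OF D[OF x y[of n]]]] cr(1) by simp
    then show "norm (T (pre a n) x - x) \<le> cr ^ n * D" using *[of n] by (simp add: dist_norm)
  qed
  then have "(\<lambda>n. T (pre a n) x) \<longlonglongrightarrow> x" by (simp add: LIM_zero_iff)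
  then have "x = \<pi> a" using coding_lim LIMSEQ_unique by blast
  then show ?thesis by blast
qed

lemma measurable_coding [measurable]: "\<pi> \<in> seq_space \<rightarrow>\<^sub>M borel"
proof (rule borel_measurable_LIMSEQ_metric[of "\<lambda>n a. T (pre a n) 0"])
  show "(\<lambda>a. T (pre a n) 0) \<in> borel_measurable seq_space" for n
    by (rule measurable_window) simp
qed (rule coding_lim)

lemma pieces_separated: "\<exists>e>0. \<forall>i j x y. i \<noteq> j \<longrightarrow> x \<in> E \<longrightarrow> y \<in> E \<longrightarrow> e \<le> dist (ifs_map A d i x) (ifs_map A d j y)"
proof -
  \<comment> \<open>For \<open>i = j\<close> any positive \<open>e\<close> will do; the diagonal is
    included so that a minimum over all pairs can be taken.\<close>
  let ?P = "\<lambda>i j e. e > 0 \<and> (i \<noteq> j \<longrightarrow> (\<forall>x\<in>E. \<forall>y\<in>E. e \<le> dist (ifs_map A d i x) (ifs_map A d j y)))"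
  have "\<exists>e. ?P i j e" for i j
  proof (cases "i = j")
    case False
    have cc: "compact (ifs_map A d i ` E)" for i
      by (rule compact_continuous_image[OF _ E_compact])
         (auto simp: ifs_map_def intro!: continuous_intros matrix_vector_mult_linear_continuous_on)
    have "ifs_map A d i ` E \<inter> ifs_map A d j ` E = {}"
      using sep False by (auto simp: disjoint_family_on_def)
    from separate_compact_closed[OF cc compact_imp_closed[OF cc] this] show ?thesis by auto
  qed (auto intro: exI[of _ 1])
  note ex = this
  obtain e where e: "\<And>i j. e i j > 0"
    "\<And>i j x y. i \<noteq> j \<Longrightarrow> x \<in> E \<Longrightarrow> y \<in> E \<Longrightarrow> e i j \<le> dist (ifs_map A d i x) (ifs_map A d j y)"
    using that[of "\<lambda>i j. SOME e. ?P i j e"] someI_ex[OF ex] by simp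
  define e0 where "e0 = Min (range (\<lambda>(i, j). e i j))"
  have "e0 > 0" using e(1) by (auto simp: e0_def)
  moreover have "e0 \<le> e i j" for i j
    unfolding e0_def by (rule Min_le, simp, rule range_eqI[of _ _ "(i, j)"]) simp
  ultimately show ?thesis using e(2) order_trans by blast
qed

text \<open>At the first index \<open>k\<close> where the sequences differ, the two points are
  images under the common map \<open>T (pre a k)\<close> of points in different first-level pieces,
  which are at least \<open>e\<close> apart. That map shrinks distances at most by the factor
  \<open>bt (pre a k)\<close>, and \<open>bt (pre a n)\<close> is at most
  \<open>4 * (1 + kap)\<close> times this factor.\<close>

lemma coding_separation:
  "\<exists>c>0. \<forall>a b n. b \<notin> cylinder (pre a n) \<longrightarrow> c * bt (pre a n) \<le> dist (\<pi> b) (\<pi> a)"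
proof -
  obtain e where e: "e > 0"
    "\<And>i j x y. i \<noteq> j \<Longrightarrow> x \<in> E \<Longrightarrow> y \<in> E \<Longrightarrow> e \<le> dist (ifs_map A d i x) (ifs_map A d j y)"
    using pieces_separated by blast
  define c where "c = e / (4 * (1 + kap))"
  have "c > 0" using e(1) kap_ge1 by (simp add: c_def)
  moreover have "c * bt (pre a n) \<le> dist (\<pi> b) (\<pi> a)" if b: "b \<notin> cylinder (pre a n)" for a b n
  proof -
    have ex: "\<exists>k. k < n \<and> b k \<noteq> a k" using b by (auto simp: cylinder_def)
    define k where "k = (LEAST k. k < n \<and> b k \<noteq> a k)"
    have k: "k < n" "b k \<noteq> a k" using LeastI_ex[OF ex] by (auto simp: k_def)
    have lt: "b j = a j" if "j < k" for j
      using not_less_Least[of j "\<lambda>k. k < n \<and> b k \<noteq> a k"] that k(1) by (auto simp: k_def)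
    have pb: "pre b k = pre a k" using lt by auto
    let ?a = "\<lambda>j. a (j + k)" and ?b = "\<lambda>j. b (j + k)"
    have "bt (pre a n) \<le> (1 + kap) * (bt (pre a k) * bt (pre ?a (n - k)))"
      using bt_append_le[of "pre a k" "pre ?a (n - k)"] k(1) by (simp flip: pre_add)
    also have "\<dots> \<le> (1 + kap) * (bt (pre a k) * 4)"
      using kap_ge1 bt_pos order_trans[OF bt_le_nn nn_le4]
      by (intro mult_left_mono) (auto intro: less_imp_le)
    finally have "c * bt (pre a n) \<le> c * ((1 + kap) * (bt (pre a k) * 4))"
      using \<open>c > 0\<close> by simp
    also have "\<dots> = bt (pre a k) * e" using kap_ge1 by (simp add: c_def field_simps)
    also have "\<dots> \<le> bt (pre a k) * dist (\<pi> ?b) (\<pi> ?a)"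
    proof (intro mult_left_mono)
      show "e \<le> dist (\<pi> ?b) (\<pi> ?a)"
        using e(2)[OF k(2), of "\<pi> (\<lambda>j. ?b (j + 1))" "\<pi> (\<lambda>j. ?a (j + 1))"] coding_in_E
        by (simp add: coding_shift[of ?a 1] coding_shift[of ?b 1])
    qed (use bt_pos in \<open>auto intro: less_imp_le\<close>)
    also have "\<dots> \<le> dist (\<pi> b) (\<pi> a)"
      using T_dist_ge[of "pre a k"] by (simp add: coding_shift[of a k] coding_shift[of b k] pb)
    finally show ?thesis .
  qed
  ultimately show ?thesis by blast
qed

end

section \<open>Comparison of measures and good times\<close>

lemma algebra_approx:
  assumes "algebra \<Omega> \<A>" "finite_measure M" "finite_measure N"
    and sM: "sets M = sigma_sets \<Omega> \<A>" and sN: "sets N = sigma_sets \<Omega> \<A>"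
    and S: "S \<in> sigma_sets \<Omega> \<A>" and e: "e > 0"
  shows "\<exists>F\<in>\<A>. measure M ((S - F) \<union> (F - S)) + measure N ((S - F) \<union> (F - S)) < e"
proof -
  interpret algebra \<Omega> \<A> by fact
  interpret M: finite_measure M by fact
  interpret N: finite_measure N by fact
  define f where "f X = measure M X + measure N X" for X
  have f_mono: "f X \<le> f Y" if "X \<subseteq> Y" "Y \<in> sets M" for X Y
    using that sM sN unfolding f_def
    by (intro add_mono M.finite_measure_mono N.finite_measure_mono) auto
  have f_Un: "f (X \<union> Y) \<le> f X + f Y" if "X \<in> sets M" "Y \<in> sets M" for X Y
    using that sM sN measure_Un_le[of X M Y] measure_Un_le[of X N Y]
    unfolding f_def by simp
  have A_sets: "F \<in> sets M" if "F \<in> \<A>" for F using that sM by auto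
  have sp: "X \<subseteq> \<Omega>" if "X \<in> sigma_sets \<Omega> \<A>" for X
    using sigma_sets_into_sp[OF space_closed that] .
  have "\<forall>e>0. \<exists>F\<in>\<A>. f ((S - F) \<union> (F - S)) < e"
    using S
  proof (induction rule: sigma_sets.induct)
    case (Basic a)
    then show ?case by (auto intro!: bexI[of _ a] simp: f_def)
  next
    case Empty
    then show ?case by (auto intro!: bexI[of _ "{}"] simp: f_def)
  next
    case (Compl a)
    show ?case
    proof (intro allI impI)
      fix e :: real assume "e > 0"
      then obtain F where F: "F \<in> \<A>" "f ((a - F) \<union> (F - a)) < e" using Compl.IH by auto
      have "((\<Omega> - a) - (\<Omega> - F)) \<union> ((\<Omega> - F) - (\<Omega> - a)) = (a - F) \<union> (F - a)"
        using sp[OF Compl.hyps] sets_into_space[OF F(1)] by auto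
      then show "\<exists>F\<in>\<A>. f ((\<Omega> - a - F) \<union> (F - (\<Omega> - a))) < e"
        using F by (intro bexI[of _ "\<Omega> - F"]) auto
    qed
  next
    case (Union a)
    have a: "a i \<in> sets M" "a i \<in> sets N" for i using Union.hyps sM sN by auto
    show ?case
    proof (intro allI impI)
      fix e :: real assume e: "e > 0"
      \<comment> \<open>\<open>R n\<close> is what the first \<open>n\<close> members miss, and its
        mass tends to 0. It is allowed the error \<open>e / 2\<close>, and each of the
        \<open>n\<close> approximations the error \<open>e'\<close>.\<close>
      define R where "R n = (\<Union>i. a i) - (\<Union>i<n. a i)" for n :: nat
      have R: "R n \<in> sets M" "R n \<in> sets N" for n using a by (auto simp: R_def)
      have "(\<lambda>n. f (R n)) \<longlonglongrightarrow> measure M (\<Inter>n. R n) + measure N (\<Inter>n. R n)"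
        unfolding f_def using R
        by (intro tendsto_add M.finite_Lim_measure_decseq N.finite_Lim_measure_decseq)
           (auto simp: decseq_def R_def)
      moreover have "(\<Inter>n. R n) = {}" by (auto simp: R_def)
      ultimately have "(\<lambda>n. f (R n)) \<longlonglongrightarrow> 0" by simp
      then have "eventually (\<lambda>n. f (R n) < e / 2) sequentially"
        using e by (intro order_tendstoD) auto
      then obtain n where n: "f (R n) < e / 2" by (auto simp: eventually_sequentially)
      define e' where "e' = e / 2 / (real n + 1)"
      have "e' > 0" using e by (simp add: e'_def)
      then have "\<forall>i. \<exists>F\<in>\<A>. f ((a i - F) \<union> (F - a i)) < e'" using Union.IH by auto
      then obtain F where F: "\<And>i. F i \<in> \<A>" "\<And>i. f ((a i - F i) \<union> (F i - a i)) < e'"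
        by metis
      let ?D = "\<lambda>i. (a i - F i) \<union> (F i - a i)"
      let ?F = "\<Union>i<n. F i"
      have D: "?D i \<in> sets M" for i using a F(1) A_sets by auto
      have sub: "f (\<Union>i<k. ?D i) \<le> real k * e'" for k
      proof (induction k)
        case (Suc k)
        have "f (\<Union>i<Suc k. ?D i) = f (?D k \<union> (\<Union>i<k. ?D i))" by (simp add: lessThan_Suc)
        also have "\<dots> \<le> f (?D k) + f (\<Union>i<k. ?D i)"
          using D by (intro f_Un sets.countable_UN'') auto
        also have "\<dots> \<le> e' + real k * e'" using F(2)[of k] Suc by simp
        finally show ?case by (simp add: algebra_simps)
      qed (simp add: f_def)
      have U: "(\<Union>i<n. ?D i) \<in> sets M" using D by (intro sets.countable_UN'') auto
      have "f (((\<Union>i. a i) - ?F) \<union> (?F - (\<Union>i. a i))) \<le> f (R n \<union> (\<Union>i<n. ?D i))"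
        using R(1)[of n] U by (intro f_mono sets.Un) (auto simp: R_def)
      also have "\<dots> \<le> f (R n) + f (\<Union>i<n. ?D i)" by (intro f_Un R U)
      also have "\<dots> < e / 2 + real n * e'" using n sub[of n] by simp
      also have "real n * e' \<le> e / 2" using e by (simp add: e'_def field_simps)
      finally show "\<exists>F\<in>\<A>. f ((\<Union> (range a) - F) \<union> (F - \<Union> (range a))) < e"
        using F(1) by (intro bexI[of _ ?F]) auto
    qed
  qed
  then show ?thesis using e by (simp add: f_def)
qed

text \<open>A domination of \<open>M\<close> by \<open>C\<close> times \<open>N\<close> does not
  pass to complements, so a uniqueness argument on a generator does not apply. Instead
  \<open>S\<close> is approximated by one \<open>F\<close> that is good for both measures at once;
  the error counts once through \<open>M\<close> and \<open>C\<close> times through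
  \<open>N\<close>, hence \<open>e / (C + 1)\<close>.\<close>

lemma measure_le_of_algebra:
  assumes "algebra \<Omega> \<A>" "finite_measure M" "finite_measure N"
    and sM: "sets M = sigma_sets \<Omega> \<A>" and sN: "sets N = sigma_sets \<Omega> \<A>"
    and C: "C \<ge> 0" and le: "\<And>F. F \<in> \<A> \<Longrightarrow> measure M F \<le> C * measure N F"
    and S: "S \<in> sets M"
  shows "measure M S \<le> C * measure N S"
proof (rule field_le_epsilon)
  interpret M: finite_measure M by fact
  interpret N: finite_measure N by fact
  fix e :: real assume "e > 0"
  then have "e / (C + 1) > 0" using C by simp
  then obtain F where F: "F \<in> \<A>"
    and F2: "measure M ((S - F) \<union> (F - S)) + measure N ((S - F) \<union> (F - S)) < e / (C + 1)"
    using algebra_approx[OF assms(1-5)] S sM by metis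
  let ?D = "(S - F) \<union> (F - S)"
  have m: "F \<in> sets M" "F \<in> sets N" "?D \<in> sets M" "?D \<in> sets N" "S \<in> sets N"
  proof -
    show S': "F \<in> sets M" "F \<in> sets N" "S \<in> sets N" using S F sM sN by auto
    from S' S show "?D \<in> sets M" "?D \<in> sets N" by (simp_all add: sets.Un sets.Diff)
  qed
  have "measure M S \<le> measure M (F \<union> ?D)" using S m by (intro M.finite_measure_mono) auto
  also have "\<dots> \<le> measure M F + measure M ?D" using m by (intro measure_Un_le)
  also have "measure M F \<le> C * measure N F" by (rule le[OF F])
  also have "measure N F \<le> measure N (S \<union> ?D)" using S m by (intro N.finite_measure_mono) auto
  also have "\<dots> \<le> measure N S + measure N ?D" using m by (intro measure_Un_le)
  finally have "measure M S \<le> C * (measure N S + measure N ?D) + measure M ?D"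
    using C by (simp add: mult_left_mono)
  also have "\<dots> \<le> C * measure N S + (C + 1) * (measure M ?D + measure N ?D)"
    using C by (simp add: algebra_simps measure_nonneg)
  also have "\<dots> \<le> C * measure N S + (C + 1) * (e / (C + 1))"
    using F2 C by (intro add_left_mono mult_left_mono) auto
  finally show "measure M S \<le> C * measure N S + e" using C by simp
qed

text \<open>Reduces domination to single words read in growing windows. It serves with
  \<open>C = 1\<close> in both directions to identify two measures, and with the quasi-Bernoulli
  constant to compare dependence with independence.\<close>

lemma measure_le_of_windows:
  fixes M N :: "('i \<Rightarrow> 'm::finite) measure" and win :: "nat \<Rightarrow> 'i list"
  assumes fin: "finite_measure M" "finite_measure N"
    and sM: "sets M = sets seq_space" and sN: "sets N = sets seq_space"
    and inc: "\<And>k. set (win k) \<subseteq> set (win (Suc k))" and all: "\<And>i. \<exists>k. i \<in> set (win k)"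
    and C: "C \<ge> 0"
    and le: "\<And>k u. length u = length (win k) \<Longrightarrow>
      measure M {a. map a (win k) = u} \<le> C * measure N {a. map a (win k) = u}"
    and S: "S \<in> sets M"
  shows "measure M S \<le> C * measure N S"
proof -
  interpret M: finite_measure M by fact
  interpret N: finite_measure N by fact
  define \<A> where "\<A> = {{a :: 'i \<Rightarrow> 'm. map a (win k) \<in> U} | k U. True}"
  have mono: "set (win k) \<subseteq> set (win l)" if "k \<le> l" for k l
    using lift_Suc_mono_le[of "\<lambda>k. set (win k)" k l] inc that by simp
  \<comment> \<open>A condition on a window is also one on every larger window, so two such sets can
    be put on a common window; this makes \<open>\<A>\<close> an algebra.\<close>
  have enlarge: "{a :: 'i \<Rightarrow> 'm. map a (win k) \<in> U} = {a. map a (win l) \<in> (\<lambda>a. map a (win l)) ` {a. map a (win k) \<in> U}}"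
    if "k \<le> l" for k l U
  proof -
    have eq: "map a (win k) = map b (win k)" if "map a (win l) = map b (win l)" for a b :: "'i \<Rightarrow> 'm"
      using that mono[OF \<open>k \<le> l\<close>] by (auto simp: map_eq_conv)
    show ?thesis
    proof (rule set_eqI, unfold mem_Collect_eq, rule iffI)
      fix a assume "map a (win l) \<in> (\<lambda>a. map a (win l)) ` {a. map a (win k) \<in> U}"
      then obtain b where "map a (win l) = map b (win l)" "map b (win k) \<in> U"
        unfolding image_iff by blast
      then show "map a (win k) \<in> U" using eq by metis
    qed (rule image_eqI[OF refl], simp)
  qed
  have alg: "algebra UNIV \<A>"
    unfolding algebra_iff_Un
  proof (intro conjI ballI)
    show "{} \<in> \<A>" unfolding \<A>_def by (intro CollectI exI[of _ 0] exI[of _ "{}"]) auto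
    fix F assume "F \<in> \<A>"
    then obtain k U where F: "F = {a. map a (win k) \<in> U}" by (auto simp: \<A>_def)
    show "UNIV - F \<in> \<A>"
      unfolding \<A>_def F by (intro CollectI exI[of _ k] exI[of _ "- U"]) auto
    fix G assume "G \<in> \<A>"
    then obtain l V where G: "G = {a. map a (win l) \<in> V}" by (auto simp: \<A>_def)
    obtain U' where U': "F = {a. map a (win (max k l)) \<in> U'}"
      unfolding F using enlarge[of k "max k l" U] by (auto simp del: map_eq_conv)
    obtain V' where V': "G = {a. map a (win (max k l)) \<in> V'}"
      unfolding G using enlarge[of l "max k l" V] by (auto simp del: map_eq_conv)
    show "F \<union> G \<in> \<A>"
      unfolding \<A>_def U' V' by (intro CollectI exI[of _ "max k l"] exI[of _ "U' \<union> V'"]) auto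
  qed auto
  have sets: "sets (seq_space :: ('i \<Rightarrow> 'm) measure) = sigma_sets UNIV \<A>"
  proof (rule antisym)
    have *: "sets (seq_space :: ('i \<Rightarrow> 'm) measure) = sigma_sets UNIV {{f. f i \<in> X} | i X. True}"
      unfolding seq_space_def sets_PiM_single by simp
    have "{{f. f i \<in> X} | i X. True} \<subseteq> \<A>"
    proof clarify
      fix i and X :: "'m set"
      obtain k where "i \<in> set (win k)" using all by blast
      then obtain j where j: "j < length (win k)" "win k ! j = i" by (auto simp: in_set_conv_nth)
      have "{f. f i \<in> X} = {a. map a (win k) \<in> {u. u ! j \<in> X}}" using j by auto
      then show "{f. f i \<in> X} \<in> \<A>" unfolding \<A>_def by blast
    qed
    then show "sets (seq_space :: ('i \<Rightarrow> 'm) measure) \<subseteq> sigma_sets UNIV \<A>"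
      unfolding * by (rule sigma_sets_mono')
    have "\<A> \<subseteq> sets seq_space" by (auto simp: \<A>_def sets_window)
    then show "sigma_sets UNIV \<A> \<subseteq> sets seq_space"
      using sets.sigma_sets_subset[of \<A> seq_space] by simp
  qed
  show ?thesis
  proof (rule measure_le_of_algebra[OF alg fin _ _ C _ S])
    fix F assume "F \<in> \<A>"
    then obtain k U where F: "F = {a. map a (win k) \<in> U}" by (auto simp: \<A>_def)
    let ?I = "{u. set u \<subseteq> UNIV \<and> length u = length (win k)} \<inter> U"
    let ?c = "\<lambda>u. {a :: 'i \<Rightarrow> 'm. map a (win k) = u}"
    have fin: "finite ?I" by (intro finite_Int disjI1 finite_lists_length_eq) auto
    have FI: "F = (\<Union>u\<in>?I. ?c u)" by (auto simp: F)
    have c: "?c u \<in> sets seq_space" for u using sets_window[of "win k" "{u}"] by simp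
    have "measure M F = (\<Sum>u\<in>?I. measure M (?c u))"
      unfolding FI using c sM by (intro M.finite_measure_finite_Union fin) (auto simp: disjoint_family_on_def)
    also have "\<dots> \<le> (\<Sum>u\<in>?I. C * measure N (?c u))" by (intro sum_mono le) auto
    also have "\<dots> = C * (\<Sum>u\<in>?I. measure N (?c u))" by (simp add: sum_distrib_left)
    also have "(\<Sum>u\<in>?I. measure N (?c u)) = measure N F"
      unfolding FI using c sN by (intro N.finite_measure_finite_Union[symmetric] fin) (auto simp: disjoint_family_on_def)
    finally show "measure M F \<le> C * measure N F" .
  qed (simp_all add: sM sN sets)
qed

text \<open>The maximum over \<open>k \<le> n\<close> of the sums of \<open>f\<close> along the
  first \<open>k\<close> points of the orbit, the empty sum included, in the recursive form that
  Garsia's argument needs.\<close>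

primrec max_sum :: "('a \<Rightarrow> real) \<Rightarrow> ('a \<Rightarrow> 'a) \<Rightarrow> nat \<Rightarrow> 'a \<Rightarrow> real" where
  "max_sum f T 0 x = 0"
| "max_sum f T (Suc n) x = max 0 (f x + max_sum f T n (T x))"

lemma max_sum_nonneg: "max_sum f T n x \<ge> 0"
  by (cases n) auto

lemma max_sum_mono: "max_sum f T n x \<le> max_sum f T (Suc n) x"
proof (induction n arbitrary: x)
  case (Suc n)
  show ?case
    unfolding max_sum.simps(2)[of f T n x] max_sum.simps(2)[of f T "Suc n" x]
    by (intro max.mono order_refl add_left_mono Suc)
qed simp

lemma max_sum_ge: "(\<Sum>j<n. f ((T ^^ j) x)) \<le> max_sum f T n x"
proof (induction n arbitrary: x)
  case (Suc n)
  have "(\<Sum>j<Suc n. f ((T ^^ j) x)) = f x + (\<Sum>j<n. f ((T ^^ j) (T x)))"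
    by (simp only: sum.lessThan_Suc_shift funpow_Suc_right o_def funpow_0 id_def)
  also have "\<dots> \<le> f x + max_sum f T n (T x)" by (intro add_left_mono Suc)
  finally show ?case by simp
qed auto

text \<open>Garsia's proof of the maximal inequality for \<open>f = indicator B - e\<close>: the
  event says that some orbit sum of \<open>f\<close> is positive. Invariance makes the integral of
  \<open>?g n x - ?g n (T x)\<close> vanish.\<close>

lemma maximal_ergodic:
  assumes "prob_space M" and T [measurable]: "T \<in> M \<rightarrow>\<^sub>M M" and inv: "distr M M T = M"
    and B [measurable]: "B \<in> sets M" and e: "e > 0"
  shows "measure M {x\<in>space M. \<exists>n. e * real n < real (card {j. j < n \<and> (T ^^ j) x \<in> B})} \<le> measure M B / e"
proof -
  interpret prob_space M by fact
  define f where "f x = indicator B x - e" for x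
  have f [measurable]: "f \<in> borel_measurable M" unfolding f_def by measurable
  let ?g = "max_sum f T"
  have g [measurable]: "?g n \<in> borel_measurable M" for n
    by (induction n) (simp_all)
  have g_le: "?g n x \<le> real n" for n x
  proof (induction n arbitrary: x)
      case (Suc n)
    have "max_sum f T n (T x) \<le> real n" by (rule Suc)
    moreover have "f x \<le> 1" using e by (simp add: f_def indicator_def)
    ultimately show ?case by simp
  qed auto
  have int: "integrable M (?g n)" for n
    by (rule integrable_const_bound[of _ "real n"]) (auto simp: g_le max_sum_nonneg)
  have "integrable (distr M M T) (?g n)" for n using int by (simp add: inv)
  then have intT: "integrable M (\<lambda>x. ?g n (T x))" for n by (subst (asm) integrable_distr_eq) auto
  have eqT: "(\<integral>x. ?g n (T x) \<partial>M) = (\<integral>x. ?g n x \<partial>M)" for n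
    using integral_distr[of T M M "?g n"] inv by simp
  let ?P = "\<lambda>n. {x\<in>space M. 0 < ?g n x}"
  have P: "measure M (?P n) \<le> measure M B / e" for n
  proof -
    \<comment> \<open>Where \<open>?g n x\<close> is positive, its recursion loses the maximum with
      0 and gives at most \<open>f x + ?g n (T x)\<close>; elsewhere \<open>?g n x\<close> is 0 and
      the left side is not positive.\<close>
    have pw: "?g n x - ?g n (T x) \<le> indicator (?P n \<inter> B) x - e * indicator (?P n) x" if "x \<in> space M" for x
    proof (cases "0 < ?g n x")
      case True
      then obtain m where m: "n = Suc m" by (cases n) auto
      have "?g n x = f x + ?g m (T x)" using True by (auto simp: m max_def split: if_splits)
      also have "\<dots> \<le> f x + ?g n (T x)" unfolding m by (intro add_left_mono max_sum_mono)
      finally show ?thesis using True that by (auto simp: f_def indicator_def)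
    next
      case False
      then show ?thesis using max_sum_nonneg[of f T n "T x"] max_sum_nonneg[of f T n x] by auto
    qed
    have "0 = (\<integral>x. ?g n x - ?g n (T x) \<partial>M)" using int intT eqT by simp
    also have "\<dots> \<le> (\<integral>x. indicator (?P n \<inter> B) x - e * indicator (?P n) x \<partial>M)"
    proof (rule integral_mono[OF _ _ pw])
      show "integrable M (\<lambda>x. ?g n x - ?g n (T x))" using int intT by simp
      have [measurable]: "?P n \<in> sets M" by measurable
      show "integrable M (\<lambda>x. indicator (?P n \<inter> B) x - e * indicator (?P n) x)"
        by (intro Bochner_Integration.integrable_diff integrable_mult_right integrable_real_indicator)
           (auto simp: emeasure_eq_measure)
    qed
    also have "\<dots> = measure M (?P n \<inter> B) - e * measure M (?P n)"
    proof -
      have [measurable]: "?P n \<in> sets M" by measurable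
      show ?thesis
        by (subst Bochner_Integration.integral_diff)
           (auto simp: emeasure_eq_measure Int_absorb2 sets.sets_into_space
             intro!: integrable_mult_right integrable_real_indicator)
    qed
    also have "\<dots> \<le> measure M B - e * measure M (?P n)"
      by (intro diff_right_mono finite_measure_mono) auto
    finally show ?thesis using e by (simp add: field_simps)
  qed
  have inc: "incseq ?P"
    by (rule incseq_SucI) (auto intro: less_le_trans[OF _ max_sum_mono] simp del: max_sum.simps)
  have "(\<lambda>n. measure M (?P n)) \<longlonglongrightarrow> measure M (\<Union>n. ?P n)"
    by (intro finite_Lim_measure_incseq inc) auto
  then have "measure M (\<Union>n. ?P n) \<le> measure M B / e"
    by (rule LIMSEQ_le_const2) (use P in auto)
  moreover have "measure M {x\<in>space M. \<exists>n. e * real n < real (card {j. j < n \<and> (T ^^ j) x \<in> B})}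
      \<le> measure M (\<Union>n. ?P n)"
  proof (rule finite_measure_mono)
    show "{x\<in>space M. \<exists>n. e * real n < real (card {j. j < n \<and> (T ^^ j) x \<in> B})} \<subseteq> (\<Union>n. ?P n)"
    proof clarify
      fix x n assume x: "x \<in> space M" and n: "e * real n < real (card {j. j < n \<and> (T ^^ j) x \<in> B})"
      have "(\<Sum>j<n. f ((T ^^ j) x)) = (\<Sum>j<n. indicator B ((T ^^ j) x)) - e * real n"
        by (simp add: f_def sum_subtractf)
      also have "(\<Sum>j<n. indicator B ((T ^^ j) x) :: real) = real (card {j. j < n \<and> (T ^^ j) x \<in> B})"
        by (subst sum.mono_neutral_cong_right[of _ "{j. j < n \<and> (T ^^ j) x \<in> B}" _ "\<lambda>_. 1"])
           (auto simp: indicator_def)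
      finally have "0 < (\<Sum>j<n. f ((T ^^ j) x))" using n by simp
      then have "0 < ?g n x" using max_sum_ge[of f T x n] by linarith
      then show "x \<in> (\<Union>n. ?P n)" using x by auto
    qed
  qed auto
  ultimately show ?thesis by linarith
qed

text \<open>
  A weak replacement for the ergodic theorem that needs no ergodicity: the orbit of almost
  every point avoids a set of small measure at some time in each long block.
\<close>
lemma AE_good_times:
  assumes "prob_space M" and T [measurable]: "T \<in> M \<rightarrow>\<^sub>M M" and inv: "distr M M T = M"
    and B [measurable]: "\<And>k::nat. B k \<in> sets M" and B0: "(\<lambda>k. measure M (B k)) \<longlonglongrightarrow> 0" and e: "e > 0" "e < 1"
  shows "AE x in M. \<exists>k. \<forall>N\<ge>1. \<exists>n<N. real N - real n \<le> e * real N + 1 \<and> (T ^^ n) x \<notin> B k"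
proof -
  interpret prob_space M by fact
  let ?U = "\<lambda>k. {x\<in>space M. \<exists>n. e / 2 * real n < real (card {j. j < n \<and> (T ^^ j) x \<in> B k})}"
  have U [measurable]: "?U k \<in> sets M" for k
  proof -
    have *: "real (card {j. j < n \<and> (T ^^ j) x \<in> B k}) = (\<Sum>j<n. indicator (B k) ((T ^^ j) x))" for n x
      by (subst sum.mono_neutral_cong_right[of _ "{j. j < n \<and> (T ^^ j) x \<in> B k}" _ "\<lambda>_. 1"])
         (auto simp: indicator_def)
    have [measurable]: "(T ^^ j) \<in> M \<rightarrow>\<^sub>M M" for j by (induction j) auto
    show ?thesis unfolding * by measurable
  qed
  have "measure M (\<Inter>k. ?U k) \<le> 0"
  proof (rule LIMSEQ_le_const)
    show "(\<lambda>k. measure M (B k) / (e / 2)) \<longlonglongrightarrow> 0" using tendsto_divide[OF B0 tendsto_const[of "e / 2"]] e by simp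
    show "\<exists>N. \<forall>n\<ge>N. measure M (\<Inter>k. ?U k) \<le> measure M (B n) / (e / 2)"
    proof (intro exI allI impI)
      fix n
      have "measure M (\<Inter>k. ?U k) \<le> measure M (?U n)" by (intro finite_measure_mono) auto
      also have "\<dots> \<le> measure M (B n) / (e / 2)" using maximal_ergodic[OF assms(1-3) B, of "e / 2" n] e by auto
      finally show "measure M (\<Inter>k. ?U k) \<le> measure M (B n) / (e / 2)" .
    qed
  qed
  then have "measure M (\<Inter>k. ?U k) = 0" using measure_nonneg[of M "\<Inter>k. ?U k"] by linarith
  then have "AE x in M. x \<notin> (\<Inter>k. ?U k)"
    by (intro AE_not_in) (auto simp: null_sets_def emeasure_eq_measure)
  with AE_space[of M] show ?thesis
  proof eventually_elim
    case (elim x)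
    then obtain k where k: "\<And>n. real (card {j. j < n \<and> (T ^^ j) x \<in> B k}) \<le> e / 2 * real n"
      using elim by (force simp: not_less)
    have "\<exists>n<N. real N - real n \<le> e * real N + 1 \<and> (T ^^ n) x \<notin> B k" if N: "N \<ge> 1" for N :: nat
    proof (rule ccontr)
      assume neg: "\<not> ?thesis"
      \<comment> \<open>The final block \<open>{m..<N}\<close> has at least \<open>e * N\<close>
        times, of which at most \<open>e / 2 * N\<close> are bad. Rounding \<open>m\<close> down
        costs the \<open>+ 1\<close> in the gap.\<close>
      define m where "m = nat \<lfloor>(1 - e) * real N\<rfloor>"
      have m1: "(1 - e) * real N < real m + 1" unfolding m_def by linarith
      have "{m..<N} \<subseteq> {j. j < N \<and> (T ^^ j) x \<in> B k}"
      proof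
        fix n assume n: "n \<in> {m..<N}"
        then have "real m \<le> real n" "n < N" by auto
        then have "real N - real n \<le> e * real N + 1" using m1 by (simp add: algebra_simps)
        then show "n \<in> {j. j < N \<and> (T ^^ j) x \<in> B k}" using neg \<open>n < N\<close> by blast
      qed
      then have "card {m..<N} \<le> card {j. j < N \<and> (T ^^ j) x \<in> B k}"
        by (intro card_mono) auto
      then have "real (card {m..<N}) \<le> e / 2 * real N"
        using k[of N] by linarith
      then have *: "real (N - m) \<le> e / 2 * real N" by simp
      have eN: "e * real N > 0" using e N by simp
      have "real m \<le> (1 - e) * real N \<or> m = 0" unfolding m_def by linarith
      then have "real (N - m) \<ge> e * real N \<or> m = 0"
        by (auto simp: algebra_simps) 
      moreover have "e / 2 * real N < e * real N" using eN by simp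
      ultimately have m0: "m = 0" using * by linarith
      then have "1 * real N \<le> e / 2 * real N" using * by simp
      moreover have "e / 2 * real N < 1 * real N" using e N by (intro mult_strict_right_mono) auto
      ultimately show False by linarith
    qed
    then show ?case by blast
  qed
qed

section \<open>Local dimension, box dimension and Hausdorff dimension\<close>

text \<open>By Vitali, the points whose mass ratio exceeds \<open>k + 1\<close> at some radius are
  covered by five-fold enlargements of disjoint balls. Each enlargement has length
  \<open>10 * r\<close>, less than \<open>10 / (k + 1)\<close> times the mass of its ball, so the
  points that fail for every \<open>k\<close> lie in a null set. They are enclosed in Borel sets,
  which avoids asking whether they form one.\<close>

lemma finite_upper_density:
  fixes p :: "real measure"
  assumes "finite_measure p" and sp: "sets p = sets borel"
  shows "\<exists>Z\<in>null_sets lborel. \<forall>x. x \<notin> Z \<longrightarrow> (\<exists>k::nat. \<forall>\<eta>>0. measure p (cball x \<eta>) \<le> (real k + 1) * \<eta>)"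
proof -
  interpret finite_measure p by fact
  have cover: "\<exists>Z\<in>sets lborel. {x. \<exists>\<eta>>0. (real k + 1) * \<eta> < measure p (cball x \<eta>)} \<subseteq> Z \<and>
      emeasure lborel Z \<le> ennreal (10 * measure p UNIV / (real k + 1))" for k :: nat
  proof -
    define B where "B = {x. \<exists>\<eta>>0. (real k + 1) * \<eta> < measure p (cball x \<eta>)}"
    define r where "r x = (SOME \<eta>. \<eta> > 0 \<and> (real k + 1) * \<eta> < measure p (cball x \<eta>))" for x
    have r: "r x > 0 \<and> (real k + 1) * r x < measure p (cball x (r x))" if "x \<in> B" for x
      unfolding r_def by (rule someI_ex) (use that in \<open>auto simp: B_def\<close>)
    have pb: "measure p X \<le> measure p UNIV" for X
      using bounded_measure[of X] sets_eq_imp_space_eq[OF sp] by simp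
    \<comment> \<open>The covering lemma needs bounded radii: \<open>(k + 1) * r x\<close> is below
      the mass of a ball, so \<open>r x\<close> is below the total mass.\<close>
    have rb: "0 < r x \<and> r x \<le> measure p UNIV" if "x \<in> B" for x
    proof -
      have "1 * r x \<le> (real k + 1) * r x" using r[OF that] by (intro mult_right_mono) auto
      then show ?thesis using r[OF that] pb[of "cball x (r x)"] by linarith
    qed
    have "B \<subseteq> (\<Union>i\<in>B. cball i (r i))" using rb by (fastforce intro: less_imp_le)
    then obtain C where C: "countable C" "C \<subseteq> B"
      and dis: "pairwise (\<lambda>i j. disjnt (cball i (r i)) (cball j (r j))) C"
      and cov: "B \<subseteq> (\<Union>i\<in>C. cball i (5 * r i))"
      using Vitali_covering_lemma_cballs[where S = B and K = B and a = "\<lambda>x. x" and r = r and B = "measure p UNIV"] rb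
    by blast
    \<comment> \<open>The countable disjoint family is enumerated by natural numbers and padded with
      empty sets, so that countable additivity applies.\<close>
    define I where "I = to_nat_on C ` C"
    let ?g = "from_nat_into C"
    have gC: "?g n \<in> C" if "n \<in> I" for n using that C(1) by (auto simp: I_def)
    have ginj: "inj_on ?g I" using C(1) by (auto simp: I_def inj_on_def)
    define D where "D n = (if n \<in> I then cball (?g n) (r (?g n)) else {})" for n
    define F where "F n = (if n \<in> I then cball (?g n) (5 * r (?g n)) else {})" for n
    have CI: "C = ?g ` I" using C(1) by (force simp: I_def image_image)
    have "(\<Union>i\<in>?g ` I. cball i (5 * r i)) = (\<Union>n. F n)"
      by (auto simp: F_def split: if_splits)
    then have Zeq: "(\<Union>i\<in>C. cball i (5 * r i)) = (\<Union>n. F n)"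
      by (simp only: CI[symmetric])
    have Ddis: "disjoint_family D"
      unfolding disjoint_family_on_def
    proof (intro ballI impI)
      fix m n :: nat assume "m \<noteq> n"
      show "D m \<inter> D n = {}"
      proof (cases "m \<in> I \<and> n \<in> I")
        case True
        then have "?g m \<noteq> ?g n" using ginj \<open>m \<noteq> n\<close> by (auto simp: inj_on_def)
        then show ?thesis using True gC dis by (auto simp: D_def pairwise_def disjnt_def)
      qed (auto simp: D_def)
    qed
    have FD: "emeasure lborel (F n) \<le> ennreal (10 / (real k + 1)) * emeasure p (D n)" for n
    proof (cases "n \<in> I")
      case True
      let ?x = "?g n"
      have x: "?x \<in> B" using gC[OF True] C by auto
      have "emeasure lborel (F n) = ennreal (10 * r ?x)"
        using True r[OF x] by (simp add: F_def cball_eq_atLeastAtMost)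
      also have "\<dots> \<le> ennreal (10 / (real k + 1) * measure p (D n))"
        using True r[OF x] by (intro ennreal_leI) (simp add: D_def field_simps)
      also have "\<dots> = ennreal (10 / (real k + 1)) * emeasure p (D n)"
        unfolding emeasure_eq_measure by (rule ennreal_mult) simp_all
      finally show ?thesis .
    qed (simp add: F_def)
    have "emeasure lborel (\<Union>n. F n) \<le> (\<Sum>n. emeasure lborel (F n))"
      by (rule emeasure_subadditive_countably) (auto simp: F_def)
    also have "\<dots> \<le> (\<Sum>n. ennreal (10 / (real k + 1)) * emeasure p (D n))"
      by (intro suminf_le FD) auto
    also have "\<dots> = ennreal (10 / (real k + 1)) * (\<Sum>n. emeasure p (D n))" by simp
    also have "(\<Sum>n. emeasure p (D n)) = emeasure p (\<Union>n. D n)"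
      by (rule suminf_emeasure[OF _ Ddis]) (auto simp: D_def sp)
    also have "ennreal (10 / (real k + 1)) * emeasure p (\<Union>n. D n) \<le> ennreal (10 / (real k + 1)) * ennreal (measure p UNIV)"
      by (intro mult_left_mono) (auto simp: emeasure_eq_measure pb)
    also have "\<dots> = ennreal (10 * measure p UNIV / (real k + 1))" by (simp flip: ennreal_mult)
    finally show ?thesis
      using cov unfolding Zeq B_def[symmetric] by (intro bexI[of _ "\<Union>n. F n"]) (auto simp: F_def)
  qed
  then have ex: "\<exists>Z. Z \<in> sets lborel \<and> {x. \<exists>\<eta>>0. (real k + 1) * \<eta> < measure p (cball x \<eta>)} \<subseteq> Z \<and>
      emeasure lborel Z \<le> ennreal (10 * measure p UNIV / (real k + 1))" (is "\<exists>Z. ?P k Z") for k :: nat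
    unfolding Bex_def .
  define Z where "Z k = (SOME Z. ?P k Z)" for k
  have Z: "?P k (Z k)" for k unfolding Z_def by (rule someI_ex[OF ex])
  note Z = Z[THEN conjunct1] Z[THEN conjunct2, THEN conjunct1] Z[THEN conjunct2, THEN conjunct2]
  have le: "emeasure lborel (\<Inter>k. Z k) \<le> ennreal (10 * measure p UNIV / (real k + 1))" for k
  proof -
    have "(\<Inter>k. Z k) \<subseteq> Z k" by blast
    from order_trans[OF emeasure_mono[OF this Z(1)] Z(3)] show ?thesis .
  qed
  have "(\<lambda>k. ennreal (10 * measure p UNIV / (real k + 1))) \<longlonglongrightarrow> ennreal 0"
    using LIMSEQ_Suc[OF lim_const_over_n[of "10 * measure p UNIV"]]
    by (intro tendsto_ennrealI) (simp add: add.commute)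
  then have "emeasure lborel (\<Inter>k. Z k) \<le> ennreal 0"
    by (rule LIMSEQ_le_const) (use le in auto)
  moreover have "(\<Inter>k. Z k) \<in> sets lborel" using Z(1) by (intro sets.countable_INT) auto
  ultimately have "(\<Inter>k. Z k) \<in> null_sets lborel" by (simp add: null_setsI)
  moreover have "\<exists>k::nat. \<forall>\<eta>>0. measure p (cball x \<eta>) \<le> (real k + 1) * \<eta>" if x: "x \<notin> (\<Inter>k. Z k)" for x
  proof -
    obtain k where "x \<notin> Z k" using x by blast
    then show ?thesis using Z(2)[of k] by (intro exI[of _ k] allI impI leI) blast
  qed
  ultimately show ?thesis by blast
qed

lemma borel_measurable_measure_cball:
  fixes M :: "'a::euclidean_space measure"
  assumes "finite_measure M" and sM: "sets M = sets borel"
  shows "(\<lambda>x. measure M (cball x r)) \<in> borel_measurable borel"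
proof -
  interpret finite_measure M by fact
  have "closed {z :: 'a \<times> 'a. dist (fst z) (snd z) \<le> r}"
    by (intro closed_Collect_le continuous_intros)
  then have "{z :: 'a \<times> 'a. dist (fst z) (snd z) \<le> r} \<in> sets (borel \<Otimes>\<^sub>M M)"
    by (simp only: sets_pair_measure_cong[OF refl sM] borel_prod borel_closed)
  then have "(\<lambda>x. emeasure M (Pair x -` {z. dist (fst z) (snd z) \<le> r})) \<in> borel_measurable borel"
    by (rule measurable_emeasure_Pair)
  then have "(\<lambda>x. emeasure M (cball x r)) \<in> borel_measurable borel"
    by (simp add: vimage_def cball_def)
  then show ?thesis by (simp add: measure_def)
qed

text \<open>Turns a condition on all small radii into countably many: rationals slightly above
  \<open>r\<close> suffice for monotone \<open>f\<close> and continuous \<open>g\<close>. This makes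
  the sets of regular points and of heavy strips measurable.\<close>

lemma rational_radii:
  fixes f :: "real \<Rightarrow> real"
  assumes mono: "\<And>r r'. r \<le> r' \<Longrightarrow> f r \<le> f r'" and cont: "isCont g r" and r: "0 < r" "r < R"
    and le: "\<And>q. 0 < q \<Longrightarrow> q < R \<Longrightarrow> q \<in> \<rat> \<Longrightarrow> f q \<le> g q"
  shows "f r \<le> g r"
proof (rule field_le_epsilon)
  fix e :: real assume "e > 0"
  then obtain d where d: "d > 0" "\<And>x. dist x r < d \<Longrightarrow> dist (g x) (g r) < e"
    using cont by (auto simp: continuous_at_eps_delta dist_real_def)
  obtain q where q: "r < q" "q < min R (r + d)" "q \<in> \<rat>"
    using Rats_dense_in_real[of r "min R (r + d)"] r d(1) by auto
  have "f r \<le> f q" using q by (intro mono) auto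
  also have "\<dots> \<le> g q" using q r by (intro le) auto
  also have "g q \<le> g r + e" using d(2)[of q] q by (auto simp: dist_real_def)
  finally show "f r \<le> g r + e" .
qed

text \<open>A pointwise Frostman condition: membership for some \<open>R > 0\<close>, for each
  \<open>t\<close> below \<open>s\<close>, says that the lower local dimension at \<open>x\<close>
  is at least \<open>s\<close>.\<close>

definition upper_regular :: "'a::euclidean_space measure \<Rightarrow> real \<Rightarrow> real \<Rightarrow> 'a set" where
  "upper_regular M t R = {x. \<forall>r. 0 < r \<longrightarrow> r < R \<longrightarrow> measure M (cball x r) \<le> r powr t}"

lemma upper_regular_borel:
  fixes M :: "'a::euclidean_space measure"
  assumes "finite_measure M" and sM: "sets M = sets borel"
  shows "upper_regular M t R \<in> sets borel"
proof -
  interpret finite_measure M by fact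
  note [measurable] = borel_measurable_measure_cball[OF assms]
  have "upper_regular M t R = (\<Inter>q\<in>{q\<in>\<rat>. 0 < q \<and> q < R}. {x\<in>space borel. measure M (cball x q) \<le> q powr t}) \<inter> UNIV"
  proof -
    have "measure M (cball x r) \<le> r powr t"
      if "0 < r" "r < R" "\<And>q. 0 < q \<Longrightarrow> q < R \<Longrightarrow> q \<in> \<rat> \<Longrightarrow> measure M (cball x q) \<le> q powr t" for x r
    proof (rule rational_radii[OF _ _ that])
      show "measure M (cball x r) \<le> measure M (cball x r')" if "r \<le> r'" for r r'
        using that by (intro finite_measure_mono) (auto simp: sM)
      show "isCont (\<lambda>r. r powr t) r" using that(1) by (intro continuous_intros) auto
    qed
    then show ?thesis by (auto simp: upper_regular_def)
  qed
  also have "\<dots> \<in> sets borel"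
  proof (cases "{q\<in>\<rat>. 0 < q \<and> q < R} = {}")
    case False
    then show ?thesis
      by (intro sets.Int sets.countable_INT'' countable_subset[OF _ countable_rat]) auto
  next
    case True
    then show ?thesis by (simp only: True) simp
  qed
  finally show ?thesis .
qed

text \<open>Separates dimension theory from dynamics: \<open>cov\<close> supplies all the upper
  bounds on dimensions, \<open>low\<close> all the lower ones.\<close>

locale mass_distribution = prob_space M for M :: "'a::euclidean_space measure" +
  fixes E :: "'a set" and s K R :: real
  assumes sM: "sets M = sets borel" and compE: "compact E" and ME: "AE x in M. x \<in> E"
    and s: "s > 0" and K: "K > 0" and R: "R > 0"
    and cov: "\<And>\<delta>. 0 < \<delta> \<Longrightarrow> \<delta> < R \<Longrightarrow>
      \<exists>\<C>. finite \<C> \<and> real (card \<C>) \<le> K * \<delta> powr (- s) \<and> delta_cover \<delta> E \<C>"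
    and low: "\<And>t. t < s \<Longrightarrow> AE x in M. \<exists>r>0. x \<in> upper_regular M t r"
begin

lemma setsE: "E \<in> sets M" using compE by (simp add: sM compact_imp_closed)

lemma cballM: "cball x r \<in> sets M" by (simp add: sM)

lemmas fin = finite_measure_axioms

text \<open>The radii \<open>1 / real (Suc n)\<close> exhaust almost every point, so one of them
  already works on a set of positive mass.\<close>

lemma upper_regular_positive:
  assumes "t < s"
  shows "\<exists>r>0. \<exists>F\<in>sets M. measure M F > 0 \<and> F \<subseteq> E \<inter> upper_regular M t r"
proof (rule ccontr)
  assume neg: "\<not> ?thesis"
  let ?F = "\<lambda>n::nat. E \<inter> upper_regular M t (1 / real (Suc n))"
  have F: "?F n \<in> sets M" for n using setsE upper_regular_borel[OF fin sM] sM by auto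
  have "1 / real (Suc n) > 0" for n by simp
  then have "\<not> measure M (?F n) > 0" for n using neg F by blast
  then have "measure M (?F n) = 0" for n using zero_less_measure_iff by blast
  then have "AE x in M. x \<notin> ?F n" for n
    using F by (intro AE_not_in) (auto simp: null_sets_def emeasure_eq_measure)
  then have "AE x in M. \<forall>n. x \<notin> ?F n" unfolding AE_all_countable ..
  with ME low[OF assms] have "AE x in M. False"
  proof eventually_elim
    case (elim x)
    then obtain r where r: "r > 0" "x \<in> upper_regular M t r" by blast
    obtain n where n: "1 / real (Suc n) < r" using reals_Archimedean[OF r(1)] by (auto simp: inverse_eq_divide)
    then have "x \<in> upper_regular M t (1 / real (Suc n))" using r(2) by (auto simp: upper_regular_def)
    then show False using elim by auto
  qed
  then show False by simp
qed

text \<open>The mass distribution principle: the part of a covering set in \<open>F\<close> lies in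
  a ball around one of its points, with the diameter as radius, and such balls are light.\<close>

lemma measure_cover_le:
  assumes U: "F \<subseteq> (\<Union>i. U i)" "\<And>i::nat. bounded (U i)" "\<And>i. diameter (U i) < r"
    and F: "F \<in> sets M" "F \<subseteq> upper_regular M t r" and t: "t > 0" and r: "r > 0"
  shows "ennreal (measure M F) \<le> (\<Sum>i. ennreal (diameter (U i) powr t))"
proof -
  define V where "V i = (if U i \<inter> F = {} then {} else cball (SOME x. x \<in> U i \<inter> F) (diameter (U i)))" for i
  have V: "V i \<in> sets M" for i by (simp add: V_def sM)
  have x: "(SOME x. x \<in> U i \<inter> F) \<in> U i \<inter> F" if "U i \<inter> F \<noteq> {}" for i
    using some_in_eq[of "U i \<inter> F"] that by simp
  have FV: "F \<subseteq> (\<Union>i. V i)"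
  proof
    fix y assume y: "y \<in> F"
    then obtain i where i: "y \<in> U i" using U(1) by auto
    then have ne: "U i \<inter> F \<noteq> {}" using y by auto
    have "y \<in> V i"
      using ne diameter_bounded_bound[OF U(2)[of i] _ i, of "SOME x. x \<in> U i \<inter> F"] x[OF ne] by (auto simp: V_def)
    then show "y \<in> (\<Union>i. V i)" by auto
  qed
  have Vle: "emeasure M (V i) \<le> ennreal (diameter (U i) powr t)" for i
  proof (cases "U i \<inter> F = {}")
    case False
    let ?x = "SOME x. x \<in> U i \<inter> F"
    have reg: "measure M (cball ?x q) \<le> q powr t" if "0 < q" "q < r" for q
      using x[OF False] F(2) that by (auto simp: upper_regular_def)
    have "measure M (cball ?x (diameter (U i))) \<le> diameter (U i) powr t"
    proof (cases "diameter (U i) = 0")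
      case True
      \<comment> \<open>Regularity speaks of positive radii only. Radius 0 is reached as a limit, in
        which \<open>t > 0\<close> makes the bound vanish.\<close>
      have "measure M (cball ?x 0) \<le> 0"
      proof (rule tendsto_lowerbound[of "\<lambda>q. q powr t" 0 "at_right 0"])
        have "((\<lambda>q. q powr t) \<longlongrightarrow> 0 powr t) (at_right 0)"
          by (rule tendsto_powr2) (use t in \<open>auto intro!: tendsto_intros eventually_at_right_less[THEN eventually_mono]\<close>)
        then show "((\<lambda>q. q powr t) \<longlongrightarrow> 0) (at_right 0)" by simp
        show "\<forall>\<^sub>F q in at_right 0. measure M (cball ?x 0) \<le> q powr t"
          unfolding eventually_at_right_field
        proof (intro exI[of _ r] conjI allI impI r)
          fix q :: real assume q: "0 < q" "q < r"
          have "measure M (cball ?x 0) \<le> measure M (cball ?x q)"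
            using q by (intro finite_measure_mono) (auto simp: sM)
          also have "\<dots> \<le> q powr t" by (rule reg[OF q])
          finally show "measure M (cball ?x 0) \<le> q powr t" .
        qed
      qed auto
      then show ?thesis using True by simp
    next
      case False
      then show ?thesis using U(3)[of i] diameter_ge_0[OF U(2)[of i]] by (intro reg) auto
    qed
    then show ?thesis using False by (simp add: V_def emeasure_eq_measure ennreal_leI)
  qed (simp add: V_def)
  have "ennreal (measure M F) \<le> emeasure M (\<Union>i. V i)"
    unfolding emeasure_eq_measure[symmetric] using FV V F(1) by (intro emeasure_mono) auto
  also have "\<dots> \<le> (\<Sum>i. emeasure M (V i))" using V by (intro emeasure_subadditive_countably) auto
  also have "\<dots> \<le> (\<Sum>i. ennreal (diameter (U i) powr t))" by (intro suminf_le Vle) auto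
  finally show ?thesis .
qed

lemma hausdorff_measure_pos: "0 < t \<Longrightarrow> t < s \<Longrightarrow> hausdorff_measure t E \<noteq> 0"
proof -
  assume t: "0 < t" "t < s"
  obtain r F where F: "r > 0" "F \<in> sets M" "measure M F > 0" "F \<subseteq> E \<inter> upper_regular M t r"
    using upper_regular_positive[OF t(2)] by metis
  have "ennreal (measure M F) \<le> hausdorff_premeasure t (r / 2) E"
    unfolding hausdorff_premeasure_def
  proof (rule INF_greatest)
    fix U :: "nat \<Rightarrow> 'a set" assume "U \<in> {U. delta_cover (r / 2) E (range U)}"
    then have U: "E \<subseteq> (\<Union>i. U i)" "\<And>i. bounded (U i)" "\<And>i. diameter (U i) \<le> r / 2"
      by (auto simp: delta_cover_def)
    have lt: "diameter (U i) < r" for i using U(3)[of i] F(1) by linarith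
    show "ennreal (measure M F) \<le> (\<Sum>i. ennreal (diameter (U i) powr t))"
      by (rule measure_cover_le[OF _ U(2) lt F(2) _ t(1) F(1)]) (use F(4) U(1) in auto)
  qed
  also have "\<dots> \<le> hausdorff_measure t E"
    unfolding hausdorff_measure_def using F(1) by (intro SUP_upper) auto
  finally show ?thesis using F(3) by auto
qed

lemma hausdorff_premeasure_anti: "\<delta> \<le> \<delta>' \<Longrightarrow> hausdorff_premeasure t \<delta>' E \<le> hausdorff_premeasure t \<delta> E"
  unfolding hausdorff_premeasure_def
  by (rule INF_superset_mono) (auto simp: delta_cover_def intro: order_trans)

lemma hausdorff_measure_0: "t > s \<Longrightarrow> hausdorff_measure t E = 0"
proof -
  assume t: "t > s"
  have pre: "hausdorff_premeasure t \<delta> E \<le> ennreal (K * \<delta> powr (t - s))" if \<delta>: "0 < \<delta>" "\<delta> < R" for \<delta>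
  proof -
    obtain \<C> where C: "finite \<C>" "real (card \<C>) \<le> K * \<delta> powr (- s)" "delta_cover \<delta> E \<C>"
      using cov[OF \<delta>] by blast
    obtain h where h: "bij_betw h {0..<card \<C>} \<C>" using ex_bij_betw_nat_finite[OF C(1)] by blast
    \<comment> \<open>The finite cover is padded with empty sets, which have diameter 0 and add
      nothing to the sum.\<close>
    define U where "U i = (if i < card \<C> then h i else {})" for i
    have hC: "h i \<in> \<C>" if "i < card \<C>" for i using h that by (auto simp: bij_betw_def)
    have "delta_cover \<delta> E (range U)"
      unfolding delta_cover_def
    proof (intro conjI)
      have "\<C> = h ` {0..<card \<C>}" using h by (simp add: bij_betw_def)
      then have "\<Union>\<C> \<subseteq> \<Union>(range U)" by (force simp: U_def)
      then show "E \<subseteq> \<Union>(range U)" using C(3) by (auto simp: delta_cover_def)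
      show "\<forall>V\<in>range U. bounded V \<and> diameter V \<le> \<delta>"
        using C(3) hC \<delta> by (auto simp: U_def delta_cover_def)
    qed
    then have "hausdorff_premeasure t \<delta> E \<le> (\<Sum>i. ennreal (diameter (U i) powr t))"
      unfolding hausdorff_premeasure_def by (intro INF_lower) auto
    also have "\<dots> = (\<Sum>i<card \<C>. ennreal (diameter (U i) powr t))"
      by (rule suminf_finite) (use t s in \<open>auto simp: U_def\<close>)
    also have "\<dots> \<le> (\<Sum>i<card \<C>. ennreal (\<delta> powr t))"
    proof (intro sum_mono ennreal_leI powr_mono2)
      fix i assume "i \<in> {..<card \<C>}"
      then have "U i \<in> \<C>" using hC by (simp add: U_def)
      then show "0 \<le> diameter (U i)" "diameter (U i) \<le> \<delta>"
        using C(3) by (auto simp: delta_cover_def intro: diameter_ge_0)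
    qed (use t s in auto)
    also have "\<dots> = ennreal (real (card \<C>) * \<delta> powr t)" by (simp add: ennreal_mult ennreal_of_nat_eq_real_of_nat)
    also have "\<dots> \<le> ennreal (K * \<delta> powr (- s) * \<delta> powr t)"
      by (intro ennreal_leI mult_right_mono C(2)) auto
    also have "K * \<delta> powr (- s) * \<delta> powr t = K * \<delta> powr (t - s)" by (simp flip: powr_add)
    finally show ?thesis .
  qed
  have "hausdorff_premeasure t \<delta> E = 0" if \<delta>: "\<delta> > 0" for \<delta>
  proof -
    have "hausdorff_premeasure t \<delta> E \<le> ennreal 0"
    proof (rule tendsto_lowerbound)
      have "((\<lambda>q. q powr (t - s)) \<longlongrightarrow> 0 powr (t - s)) (at_right 0)"
        by (rule tendsto_powr2) (use t in \<open>auto intro!: tendsto_intros eventually_at_right_less[THEN eventually_mono]\<close>)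
      from tendsto_mult[OF tendsto_const[of K] this]
      show "((\<lambda>q. ennreal (K * q powr (t - s))) \<longlongrightarrow> ennreal 0) (at_right 0)"
        by (intro tendsto_ennrealI) simp
      show "\<forall>\<^sub>F q in at_right 0. hausdorff_premeasure t \<delta> E \<le> ennreal (K * q powr (t - s))"
        unfolding eventually_at_right_field
      proof (intro exI[of _ "min \<delta> R"] conjI allI impI)
        fix q :: real assume q: "0 < q" "q < min \<delta> R"
        show "hausdorff_premeasure t \<delta> E \<le> ennreal (K * q powr (t - s))"
          by (rule order_trans[OF hausdorff_premeasure_anti[of q] pre]) (use q in auto)
      qed (use \<delta> R in auto)
    qed auto
    then show ?thesis by simp
  qed
  then have "hausdorff_measure t E \<le> 0"
    unfolding hausdorff_measure_def by (intro SUP_least) auto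
  then show ?thesis by simp
qed

lemma hausdorff_dim_eq: "hausdorff_dim E = s"
  unfolding hausdorff_dim_def
proof (rule antisym)
  let ?S = "{t. t > 0 \<and> hausdorff_measure t E = 0}"
  have lb: "s \<le> t" if "t \<in> ?S" for t using that hausdorff_measure_pos[of t] by force
  have mem: "t \<in> ?S" if "t > s" for t using that s hausdorff_measure_0[of t] by simp
  show "s \<le> Inf ?S"
    by (rule cInf_greatest) (use lb mem[of "s + 1"] in auto)
  show "Inf ?S \<le> s"
  proof (rule field_le_epsilon)
    fix e :: real assume "e > 0"
    then have "s + e \<in> ?S" by (intro mem) simp
    then show "Inf ?S \<le> s + e" by (intro cInf_lower bdd_belowI[of _ s] lb)
  qed
qed

lemma covering_number_cover:
  assumes "0 < \<delta>" "\<delta> < R"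
  shows "\<exists>\<C>. finite \<C> \<and> card \<C> = covering_number \<delta> E \<and> delta_cover \<delta> E \<C>"
  unfolding covering_number_def by (rule LeastI_ex) (use cov[OF assms] in blast)

lemma covering_number_le:
  assumes "0 < \<delta>" "\<delta> < R"
  shows "real (covering_number \<delta> E) \<le> K * \<delta> powr (- s)"
proof -
  obtain \<C> where C: "finite \<C>" "real (card \<C>) \<le> K * \<delta> powr (- s)" "delta_cover \<delta> E \<C>"
    using cov[OF assms] by blast
  have "covering_number \<delta> E \<le> card \<C>"
    unfolding covering_number_def by (rule Least_le) (use C in blast)
  then show ?thesis using C(2) by linarith
qed

text \<open>Each set of a minimal cover that meets \<open>F\<close> sits in a ball of mass at most
  \<open>c\<close>. With \<open>F\<close> of positive mass this bounds the covering number from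
  below; with \<open>F\<close> consisting of light points it bounds the mass of \<open>F\<close>
  from above.\<close>

lemma measure_le_covering:
  assumes \<delta>: "0 < \<delta>" "\<delta> < R" and F: "F \<in> sets M" "F \<subseteq> E" "\<And>x. x \<in> F \<Longrightarrow> measure M (cball x \<delta>) \<le> c"
    and c: "c \<ge> 0"
  shows "measure M F \<le> real (covering_number \<delta> E) * c"
proof -
  obtain \<C> where C: "finite \<C>" "card \<C> = covering_number \<delta> E" "delta_cover \<delta> E \<C>"
    using covering_number_cover[OF \<delta>] by blast
  define V where "V U = (if U \<inter> F = {} then {} else cball (SOME x. x \<in> U \<inter> F) \<delta>)" for U
  have x: "(SOME x. x \<in> U \<inter> F) \<in> U \<inter> F" if "U \<inter> F \<noteq> {}" for U
    using some_in_eq[of "U \<inter> F"] that by simp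
  have "F \<subseteq> (\<Union>U\<in>\<C>. V U)"
  proof
    fix y assume y: "y \<in> F"
    then obtain U where U: "U \<in> \<C>" "y \<in> U" using C(3) F(2) by (auto simp: delta_cover_def)
    then have ne: "U \<inter> F \<noteq> {}" using y by auto
    have b: "bounded U" "diameter U \<le> \<delta>" using C(3) U by (auto simp: delta_cover_def)
    have "dist (SOME x. x \<in> U \<inter> F) y \<le> diameter U"
      using diameter_bounded_bound[OF b(1) _ U(2)] x[OF ne] by auto
    then have "y \<in> V U" using ne b(2) by (auto simp: V_def)
    then show "y \<in> (\<Union>U\<in>\<C>. V U)" using U by auto
  qed
  then have "measure M F \<le> measure M (\<Union>U\<in>\<C>. V U)"
    using C(1) by (intro finite_measure_mono sets.finite_UN) (auto simp: V_def sM)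
  also have "\<dots> \<le> (\<Sum>U\<in>\<C>. measure M (V U))"
    using C(1) by (intro finite_measure_subadditive_finite) (auto simp: V_def sM)
  also have "\<dots> \<le> (\<Sum>U\<in>\<C>. c)"
    by (intro sum_mono) (use F(3) x c in \<open>auto simp: V_def\<close>)
  finally show ?thesis using C(2) by simp
qed

lemma ln_inverse_tendsto_0: "((\<lambda>\<delta>::real. c / - ln \<delta>) \<longlongrightarrow> 0) (at_right 0)"
proof -
  have "filterlim (\<lambda>\<delta>::real. - ln \<delta>) at_top (at_right 0)"
    by (rule filterlim_compose[OF filterlim_uminus_at_top_at_bot ln_at_0])
  then show ?thesis
    by (intro tendsto_divide_0[OF tendsto_const] filterlim_at_top_imp_at_infinity)
qed

lemma has_box_dim: "has_box_dim E s"
  unfolding has_box_dim_def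
proof (rule tendstoI)
  fix e :: real assume e: "e > 0"
  define t where "t = s - e / 2"
  obtain r F where F: "r > 0" "F \<in> sets M" "measure M F > 0" "F \<subseteq> E \<inter> upper_regular M t r"
    using upper_regular_positive[of t] e t_def that by (metis diff_less_eq half_gt_zero less_add_same_cancel1)
  let ?m = "measure M F"
  have ev1: "\<forall>\<^sub>F \<delta> in at_right (0::real). ln K / - ln \<delta> < e / 2"
    using ln_inverse_tendsto_0[of "ln K"] e by (intro order_tendstoD) auto
  have ev2: "\<forall>\<^sub>F \<delta> in at_right (0::real). - (e / 2) < ln ?m / - ln \<delta>"
    using ln_inverse_tendsto_0[of "ln ?m"] e by (intro order_tendstoD) auto
  have ev3: "\<forall>\<^sub>F \<delta> in at_right 0. 0 < \<delta> \<and> \<delta> < min 1 (min r R)"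
    unfolding eventually_at_right_field by (rule exI[of _ "min 1 (min r R)"]) (use F R in auto)
  show "\<forall>\<^sub>F \<delta> in at_right 0. dist (ln (real (covering_number \<delta> E)) / - ln \<delta>) s < e"
    using ev1 ev2 ev3
  proof eventually_elim
    case (elim \<delta>)
    let ?N = "real (covering_number \<delta> E)"
    have \<delta>: "0 < \<delta>" "\<delta> < 1" "\<delta> < r" "\<delta> < R" using elim by auto
    then have l: "- ln \<delta> > 0" by simp
    have lo: "?m \<le> ?N * \<delta> powr t"
      by (rule measure_le_covering[OF \<delta>(1,4) F(2)]) (use F(4) \<delta> in \<open>auto simp: upper_regular_def\<close>)
    then have "?N * \<delta> powr t > 0" using F(3) by linarith
    then have Np: "?N > 0" by (simp add: zero_less_mult_iff)
    have "ln ?m \<le> ln (?N * \<delta> powr t)" using lo F(3) by simp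
    also have "\<dots> = ln ?N + t * ln \<delta>" using Np \<delta> by (simp add: ln_mult ln_powr)
    finally have "ln ?m + t * (- ln \<delta>) \<le> ln ?N" by simp
    then have "(ln ?m + t * (- ln \<delta>)) / - ln \<delta> \<le> ln ?N / - ln \<delta>" using l by (intro divide_right_mono) auto
    then have 1: "ln ?m / - ln \<delta> + t \<le> ln ?N / - ln \<delta>"
      using l unfolding add_divide_distrib by (metis nonzero_mult_div_cancel_right less_irrefl)
    have "ln ?N \<le> ln (K * \<delta> powr (- s))" using covering_number_le[OF \<delta>(1,4)] Np by simp
    also have "\<dots> = ln K + s * (- ln \<delta>)" using K \<delta> by (simp add: ln_mult ln_powr)
    finally have "ln ?N / - ln \<delta> \<le> (ln K + s * (- ln \<delta>)) / - ln \<delta>" using l by (intro divide_right_mono) auto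
    then have 2: "ln ?N / - ln \<delta> \<le> ln K / - ln \<delta> + s"       using l unfolding add_divide_distrib by (metis nonzero_mult_div_cancel_right less_irrefl)
    show ?case using 1 2 elim(1,2) unfolding dist_real_def t_def by linarith
  qed
qed

text \<open>Borel-Cantelli along dyadic radii: by the covering bound, the points whose ball of
  radius \<open>?d n\<close> is lighter than \<open>?d n powr ?u\<close> have mass at most the term
  of a geometric series.\<close>

lemma AE_lower_bound:
  assumes e: "e > 0"
  shows "AE x in M. \<exists>R>0. \<forall>r. 0 < r \<longrightarrow> r < R \<longrightarrow> r powr (s + e) \<le> measure M (cball x r)"
proof -
  let ?d = "\<lambda>n::nat. (1 / 2 :: real) ^ n"
  \<comment> \<open>One half of \<open>e\<close> makes the masses summable; the other half pays for
    the passage from dyadic radii to all radii.\<close>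
  let ?u = "s + e / 2"
  define B where "B n = E \<inter> {x\<in>space borel. measure M (cball x (?d n)) < ?d n powr ?u}" for n
  have B: "B n \<in> sets M" for n
    unfolding B_def using setsE borel_measurable_measure_cball[OF fin sM, of "?d n"] sM
    by (intro sets.Int) auto
  have dpowr: "?d n powr x = ((1/2) powr x) ^ n" for n x
    by (simp add: powr_power powr_realpow[symmetric] powr_powr mult.commute)
  have "(\<lambda>n. ?d n) \<longlonglongrightarrow> 0" by (intro LIMSEQ_realpow_zero) auto
  then have "eventually (\<lambda>n. ?d n < R) sequentially" using R by (intro order_tendstoD)
  then obtain n0 where n0: "\<And>n. n \<ge> n0 \<Longrightarrow> ?d n < R" by (auto simp: eventually_sequentially)
  have Bm: "measure M (B n) \<le> K * ((1/2) powr (e / 2)) ^ n" if n: "n \<ge> n0" for n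
  proof -
    have "measure M (B n) \<le> real (covering_number (?d n) E) * ?d n powr ?u"
      using n0[OF n] B by (intro measure_le_covering) (auto simp: B_def)
    also have "\<dots> \<le> K * ?d n powr (- s) * ?d n powr ?u"
      using n0[OF n] by (intro mult_right_mono covering_number_le) auto
    also have "\<dots> = K * ?d n powr (e / 2)" by (simp flip: powr_add)
    finally show ?thesis by (simp only: dpowr)
  qed
  have "summable (\<lambda>n. K * ((1/2) powr (e / 2)) ^ n)"
    using e powr_less_mono2[of "e / 2" "1 / 2 :: real" 1] by (intro summable_mult summable_geometric) simp
  then have "summable (\<lambda>n. measure M (B n))"
    by (rule summable_comparison_test_ev[rotated])
       (use Bm in \<open>auto simp: eventually_sequentially intro!: exI[of _ n0]\<close>)
  then have "AE x in M. eventually (\<lambda>n. x \<in> space M - B n) sequentially"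
    using B by (intro borel_cantelli_AE1) (auto simp: less_top[symmetric])
  with ME show ?thesis
  proof eventually_elim
    case (elim x)
    then obtain n1 where n1: "\<And>n. n \<ge> n1 \<Longrightarrow> x \<notin> B n" by (auto simp: eventually_sequentially)
    \<comment> \<open>The second bound makes \<open>r powr (e / 2)\<close> at most
      \<open>(1/2) powr ?u\<close>, which absorbs the factor 2 between \<open>r\<close> and the
      dyadic radius below it.\<close>
    define R' where "R' = min (?d n1) ((1/2) powr (?u / (e / 2)))"
    have R': "R' > 0" by (simp add: R'_def)
    have R1: "R' \<le> 1" unfolding R'_def by (intro min.coboundedI1 power_le_one) auto
    show ?case
    proof (intro exI[of _ R'] conjI allI impI R')
      fix r assume r: "0 < r" "r < R'"
      have r1: "r < 1" using r R1 by linarith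
      have ex: "\<exists>n. ?d n \<le> r" using real_arch_pow_inv[OF r(1), of "1/2"] by (auto intro: less_imp_le)
      define n where "n = (LEAST n. ?d n \<le> r)"
      have n: "?d n \<le> r" unfolding n_def by (rule LeastI_ex[OF ex])
      have "n \<noteq> 0" using n r1 by (intro notI) simp
      then obtain m where m: "n = Suc m" by (cases n) auto
      have "\<not> ?d m \<le> r" using not_less_Least[of m "\<lambda>n. ?d n \<le> r"] m by (simp add: n_def)
      then have half: "r / 2 \<le> ?d n" using m by simp
      have "n \<ge> n1"
      proof (rule ccontr)
        assume "\<not> n \<ge> n1"
        then have "?d n1 \<le> ?d n" by (intro power_decreasing) auto
        then show False using n r(2) unfolding R'_def by linarith
      qed
      then have nb: "?d n powr ?u \<le> measure M (cball x (?d n))"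
        using n1[of n] elim by (auto simp: B_def)
      have "s + e = ?u + e / 2" by simp
      then have "r powr (s + e) = r powr (?u + e / 2)" by (rule arg_cong)
      also have "\<dots> = r powr ?u * r powr (e / 2)" by (rule powr_add)
      also have "r powr (e / 2) \<le> ((1/2) powr (?u / (e / 2))) powr (e / 2)"
        using r e by (intro powr_mono2) (auto simp: R'_def)
      also have "\<dots> = (1/2) powr ?u"
        unfolding powr_powr using e by (intro arg_cong[where f = "\<lambda>y. (1/2) powr y"]) (simp add: field_simps)
      also have "r powr ?u * (1/2) powr ?u = (r / 2) powr ?u"
        using r by (simp add: powr_mult[symmetric])
      also have "\<dots> \<le> ?d n powr ?u" using half r s e by (intro powr_mono2) auto
      also have "\<dots> \<le> measure M (cball x (?d n))" by (rule nb)
      also have "\<dots> \<le> measure M (cball x r)" using n by (intro finite_measure_mono cballM) auto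
      finally show "r powr (s + e) \<le> measure M (cball x r)"
        using r by (simp add: mult_left_mono)
    qed
  qed
qed

lemma exact_dimensional: "exact_dimensional M"
  unfolding exact_dimensional_def
proof (rule exI[of _ s])
  let ?e = "\<lambda>n::nat. 1 / real (Suc n)"
  have "AE x in M. \<forall>n. \<exists>r>0. x \<in> upper_regular M (s - ?e n) r"
    unfolding AE_all_countable by (intro allI low) simp
  moreover have "AE x in M. \<forall>n. \<exists>R>0. \<forall>r. 0 < r \<longrightarrow> r < R \<longrightarrow> r powr (s + ?e n) \<le> measure M (cball x r)"
    unfolding AE_all_countable by (intro allI AE_lower_bound) simp
  ultimately show "AE x in M. ((\<lambda>\<delta>. ln (measure M (cball x \<delta>)) / ln \<delta>) \<longlongrightarrow> s) (at_right 0)"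
  proof eventually_elim
    case (elim x)
    show ?case
    proof (rule tendstoI)
      fix e :: real assume "e > 0"
      then obtain n where n: "?e n < e" using reals_Archimedean by (auto simp: inverse_eq_divide)
      obtain r1 r2 where r: "r1 > 0" "r2 > 0" "x \<in> upper_regular M (s - ?e n) r1"
        "\<And>r. 0 < r \<Longrightarrow> r < r2 \<Longrightarrow> r powr (s + ?e n) \<le> measure M (cball x r)"
        using elim by meson
      show "\<forall>\<^sub>F \<delta> in at_right 0. dist (ln (measure M (cball x \<delta>)) / ln \<delta>) s < e"
        unfolding eventually_at_right_field
      proof (intro exI[of _ "min 1 (min r1 r2)"] conjI allI impI)
        fix \<delta> :: real assume d: "0 < \<delta>" "\<delta> < min 1 (min r1 r2)"
        let ?m = "measure M (cball x \<delta>)"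
        have up: "?m \<le> \<delta> powr (s - ?e n)" using r(3) d by (auto simp: upper_regular_def)
        have lo: "\<delta> powr (s + ?e n) \<le> ?m" using d by (intro r(4)) auto
        have "0 < \<delta> powr (s + ?e n)" using d by simp
        then have mp: "?m > 0" using lo by linarith
        have l: "ln \<delta> < 0" using d by simp
        have "ln (\<delta> powr (s + ?e n)) \<le> ln ?m" "ln ?m \<le> ln (\<delta> powr (s - ?e n))"
          using up lo mp \<open>0 < \<delta> powr (s + ?e n)\<close> by (simp_all only: ln_le_cancel_iff less_le_trans)
        then have "(s + ?e n) * ln \<delta> \<le> ln ?m" "ln ?m \<le> (s - ?e n) * ln \<delta>"
          using d by (simp_all add: ln_powr del: of_nat_Suc)
        then have "ln ?m / ln \<delta> \<le> s + ?e n" "s - ?e n \<le> ln ?m / ln \<delta>"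
          using l by (simp_all add: neg_divide_le_eq neg_le_divide_eq del: of_nat_Suc)
        then show "dist (ln ?m / ln \<delta>) s < e" using n unfolding dist_real_def by linarith
      qed (use r in auto)
    qed
  qed
qed

end

section \<open>The Furstenberg direction\<close>

text \<open>Directions in \<open>Q2\<close> are described by their normals in the closed positive
  quadrant. Normalising these by the coordinate sum makes matrices act on \<open>t\<close> by
  fractional linear maps; \<open>rot\<close> leads from the normal back to the direction.\<close>

definition simplex_vec :: "real \<Rightarrow> real^2" where
  "simplex_vec t = vector [t, 1 - t]"

definition rot :: "real^2 \<Rightarrow> real^2" where
  "rot v = vector [- (v $ 2), v $ 1]"

lemma simplex_vec_nth [simp]: "simplex_vec t $ 1 = t" "simplex_vec t $ 2 = 1 - t"
  by (simp_all add: simplex_vec_def)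

lemma rot_nth [simp]: "rot v $ 1 = - (v $ 2)" "rot v $ 2 = v $ 1"
  by (simp_all add: rot_def)

lemma rot_scaleR: "rot (c *\<^sub>R v) = c *\<^sub>R rot v"
  by (simp add: vec2_eq_iff)

lemma rot_eq_0 [simp]: "rot v = 0 \<longleftrightarrow> v = 0"
  by (auto simp: vec2_eq_iff)

lemma simplex_vec_ne_0 [simp]: "simplex_vec t \<noteq> 0"
  by (auto simp: vec2_eq_iff)

lemma direction_of_scaleR:
  assumes "c \<noteq> 0" shows "direction_of (c *\<^sub>R v) = direction_of v"
proof (cases "c > 0")
  case True
  then have "inverse (norm (c *\<^sub>R v)) *\<^sub>R c *\<^sub>R v = inverse (norm v) *\<^sub>R v" by simp
  then show ?thesis by (simp only: direction_of_def)
next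
  case False
  then have "direction_of (- ((- c) *\<^sub>R v)) = direction_of v"
    unfolding direction_of_minus using assms by (simp add: direction_of_def field_simps)
  then show ?thesis by simp
qed

lemma rep_direction_of:
  assumes "v \<noteq> 0"
  shows "\<exists>c. c \<noteq> 0 \<and> rep_direction (direction_of v) = c *\<^sub>R v"
proof -
  have "norm (v /\<^sub>R norm v) = 1" using assms by simp
  then have "rep_direction (direction_of v) = v /\<^sub>R norm v \<or> rep_direction (direction_of v) = - (v /\<^sub>R norm v)"
    unfolding direction_of_def
    using Quotient_rep_abs_fold_unmap[OF Quotient_direction] Quotient_rep_abs[OF Quotient_direction, of "v /\<^sub>R norm v"]
    by (metis minus_minus)
  then show ?thesis
  proof
    assume "rep_direction (direction_of v) = v /\<^sub>R norm v"
    then show ?thesis using assms by (intro exI[of _ "inverse (norm v)"]) simp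
  next
    assume "rep_direction (direction_of v) = - (v /\<^sub>R norm v)"
    then show ?thesis using assms by (intro exI[of _ "- inverse (norm v)"]) simp
  qed
qed

lemma dist_direction_of_le:
  assumes "u \<noteq> 0" "v \<noteq> 0"
  shows "dist (direction_of u) (direction_of v) \<le> norm (u /\<^sub>R norm u - v /\<^sub>R norm v)"
proof -
  have "norm (u /\<^sub>R norm u) = 1" "norm (v /\<^sub>R norm v) = 1" using assms by simp_all
  then have "dist (direction_of u) (direction_of v) =
      min (norm (u /\<^sub>R norm u - v /\<^sub>R norm v)) (norm (u /\<^sub>R norm u + v /\<^sub>R norm v))"
    unfolding direction_of_def by (intro dist_direction.abs_eq) (simp_all add: eq_onp_def)
  then show ?thesis by simp
qed

lemma isCont_direction_of: "v \<noteq> 0 \<Longrightarrow> isCont direction_of v"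
proof -
  assume v: "v \<noteq> 0"
  let ?g = "\<lambda>u. norm (u /\<^sub>R norm u - v /\<^sub>R norm v)"
  have "(?g \<longlongrightarrow> norm (v /\<^sub>R norm v - v /\<^sub>R norm v)) (at v)"
    by (intro tendsto_intros) (use v in auto)
  then have g: "(?g \<longlongrightarrow> 0) (at v)" by simp
  have ne: "\<forall>\<^sub>F u in at v. u \<noteq> 0"
    by (rule tendsto_imp_eventually_ne[OF tendsto_ident_at v])
  have le: "\<forall>\<^sub>F u in at v. norm (dist (direction_of u) (direction_of v)) \<le> ?g u"
    using ne
  proof eventually_elim
    case (elim u)
    have "norm (dist (direction_of u) (direction_of v)) = dist (direction_of u) (direction_of v)"
      by (simp only: real_norm_def abs_of_nonneg zero_le_dist)
    then show ?case using dist_direction_of_le[OF elim v] by (simp only:)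
  qed
  show ?thesis
    unfolding isCont_def by (rule tendsto_dist_iff[THEN iffD2, OF Lim_null_comparison[OF le g]])
qed

lemma continuous_simplex_direction: "continuous_on UNIV (\<lambda>t. direction_of (rot (simplex_vec t)))"
proof -
  have *: "rot (simplex_vec t) = t *\<^sub>R vector [1, 1] + vector [-1, 0]" for t
    by (simp add: vec2_eq_iff)
  have "isCont (\<lambda>t. rot (simplex_vec t)) t" for t
    unfolding * by (intro continuous_intros)
  then show ?thesis
    by (intro continuous_at_imp_continuous_on ballI isCont_o2[OF _ isCont_direction_of]) auto
qed

lemma matrix_inv_mult: "invertible B \<Longrightarrow> matrix_inv B ** B = mat 1"
  unfolding invertible_def matrix_inv_def by (drule someI_ex) simp

text \<open>Up to the factor \<open>det B\<close>, the matrix \<open>B\<close> takes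
  \<open>rot (transpose B *v x)\<close> to \<open>rot x\<close>. The inverse thus acts on directions
  as the transpose acts on their normals, and the inverses in \<open>rho\<close> disappear.\<close>

lemma proj_map_direction_of_rot:
  assumes "invertible B" "x \<noteq> 0"
  shows "proj_map B (direction_of (rot x)) = direction_of (rot (transpose B *v x))"
proof -
  have "B *v rot (transpose B *v x) = det B *\<^sub>R rot x"
    by (simp add: vec2_eq_iff mulv2_nth transpose_def det_2 algebra_simps)
  then have "matrix_inv B *v (B *v rot (transpose B *v x)) = det B *\<^sub>R (matrix_inv B *v rot x)"
    by (simp add: matrix_vector_mult_scaleR)
  then have 1: "rot (transpose B *v x) = det B *\<^sub>R (matrix_inv B *v rot x)"
    by (simp only: matrix_vector_mul_assoc matrix_inv_mult[OF assms(1)] matrix_vector_mul_lid)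
  have 2: "direction_of (matrix_inv B *v rot x) = direction_of (rot (transpose B *v x))"
    unfolding 1 using assms(1) by (intro direction_of_scaleR[symmetric]) (simp add: invertible_det_nz)
  have "rot x \<noteq> 0" using assms by simp
  from rep_direction_of[OF this] obtain c where c: "c \<noteq> 0" "rep_direction (direction_of (rot x)) = c *\<^sub>R rot x" by blast
  show ?thesis
    unfolding proj_map_def c(2) by (simp add: matrix_vector_mult_scaleR direction_of_scaleR[OF c(1)] 2)
qed

lemma Q2_eq: "\<theta> \<in> Q2 \<longleftrightarrow> (\<exists>t\<in>{0..1}. \<theta> = direction_of (rot (simplex_vec t)))"
proof
  assume "\<theta> \<in> Q2"
  then obtain v where v: "v \<noteq> 0" "v $ 1 * v $ 2 \<le> 0" "\<theta> = direction_of v" by (auto simp: Q2_def)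
  have key: "\<exists>t\<in>{0..1}. direction_of v = direction_of (rot (simplex_vec t))"
    if "v \<noteq> 0" "v $ 1 \<le> 0" "v $ 2 \<ge> 0" for v
  proof -
    let ?s = "v $ 2 - v $ 1"
    have s: "?s > 0" using that by (auto simp: vec2_eq_iff)
    have "?s * (v $ 2 / ?s) = v $ 2" using s by simp
    then have "v = ?s *\<^sub>R rot (simplex_vec (v $ 2 / ?s))"
      by (simp only: vec2_eq_iff vector_scaleR_component rot_nth simplex_vec_nth right_diff_distrib real_scaleR_def
          mult_minus_right) simp
    then have "direction_of v = direction_of (rot (simplex_vec (v $ 2 / ?s)))"
      using direction_of_scaleR[of ?s] s by (metis less_irrefl)
    moreover have "v $ 2 / ?s \<in> {0..1}" using s that by auto
    ultimately show ?thesis by blast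
  qed
  consider "v $ 1 \<le> 0" "v $ 2 \<ge> 0" | "v $ 1 \<ge> 0" "v $ 2 \<le> 0"
    using v(2) by (auto simp: mult_le_0_iff)
  then show "\<exists>t\<in>{0..1}. \<theta> = direction_of (rot (simplex_vec t))"
  proof cases
    case 1 then show ?thesis using key[of v] v by simp
  next
    case 2 then show ?thesis using key[of "- v"] v by simp
  qed
next
  assume "\<exists>t\<in>{0..1}. \<theta> = direction_of (rot (simplex_vec t))"
  then obtain t where t: "t \<in> {0..1}" "\<theta> = direction_of (rot (simplex_vec t))" by blast
  then have "(t - 1) * t \<le> 0" by (intro mult_nonpos_nonneg) auto
  then show "\<theta> \<in> Q2" unfolding Q2_def t(2)
    by (intro CollectI exI[of _ "rot (simplex_vec t)"]) auto
qed

section \<open>Projective contraction on normals\<close>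

context positive_matrices
begin

text \<open>
  The transpose of \<open>W w\<close> acts on the directions of the positive quadrant by \<open>tau w\<close>, in the
  coordinate \<open>t\<close> of \<open>(t, 1 - t)\<close>.
\<close>
definition "rowsum w t = t * (W w $1$1 + W w $1$2) + (1 - t) * (W w $2$1 + W w $2$2)"
definition "tau w t = (t * W w $1$1 + (1 - t) * W w $2$1) / rowsum w t"

lemma rowsum_ge: "t \<in> {0..1} \<Longrightarrow> nn w \<le> (1 + kap) * rowsum w t"
proof -
  assume t: "t \<in> {0..1}"
  have "nn w = t * nn w + (1 - t) * nn w" by (simp add: algebra_simps)
  also have "\<dots> \<le> t * ((1 + kap) * (W w $1$1 + W w $1$2)) + (1 - t) * ((1 + kap) * (W w $2$1 + W w $2$2))"
    using t by (intro add_mono mult_left_mono row_sum_cmp) auto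
  finally show ?thesis by (simp add: rowsum_def algebra_simps)
qed

lemma rowsum_pos: "t \<in> {0..1} \<Longrightarrow> rowsum w t > 0"
proof -
  assume "t \<in> {0..1}"
  then have "(1 + kap) * rowsum w t > 0" using less_le_trans[OF nn_pos rowsum_ge] by blast
  then show ?thesis using kap_ge1 by (simp add: zero_less_mult_iff)
qed

lemma tau_mem: "t \<in> {0..1} \<Longrightarrow> tau w t \<in> {0..1}"
proof -
  assume t: "t \<in> {0..1}"
  have "0 \<le> t * W w $1$1 + (1 - t) * W w $2$1" "0 \<le> t * W w $1$2 + (1 - t) * W w $2$2"
    using t by (auto intro!: add_nonneg_nonneg mult_nonneg_nonneg W_nonneg)
  moreover have "rowsum w t = (t * W w $1$1 + (1 - t) * W w $2$1) + (t * W w $1$2 + (1 - t) * W w $2$2)"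
    by (simp add: rowsum_def algebra_simps)
  ultimately show ?thesis using rowsum_pos[OF t, of w] by (simp add: tau_def)
qed

lemma transpose_W_simplex:
  "t \<in> {0..1} \<Longrightarrow> transpose (W w) *v simplex_vec t = rowsum w t *\<^sub>R simplex_vec (tau w t)"
  using rowsum_pos[of t w]
  by (simp add: vec2_eq_iff mulv2_nth transpose_def tau_def field_simps) (simp add: rowsum_def algebra_simps)

lemma tau_append: "t \<in> {0..1} \<Longrightarrow> tau (u @ v) t = tau v (tau u t)"
proof -
  assume t: "t \<in> {0..1}"
  have "transpose (W (u @ v)) *v simplex_vec t = transpose (W v) *v (transpose (W u) *v simplex_vec t)"
    by (simp only: word_matrix_append matrix_transpose_mul matrix_vector_mul_assoc)
  also have "\<dots> = (rowsum u t * rowsum v (tau u t)) *\<^sub>R simplex_vec (tau v (tau u t))"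
    by (simp only: transpose_W_simplex[OF t] transpose_W_simplex[OF tau_mem[OF t]]
        matrix_vector_mult_scaleR scaleR_scaleR)
  finally have eq: "rowsum (u @ v) t *\<^sub>R simplex_vec (tau (u @ v) t)
      = (rowsum u t * rowsum v (tau u t)) *\<^sub>R simplex_vec (tau v (tau u t))"
    by (simp only: transpose_W_simplex[OF t])
  have "rowsum (u @ v) t = rowsum u t * rowsum v (tau u t)"
    using arg_cong[OF eq, of "\<lambda>x. x $ 1 + x $ 2"] by (simp add: algebra_simps)
  then show ?thesis
    using arg_cong[OF eq, of "\<lambda>x. x $ 1"] rowsum_pos[OF t, of u] rowsum_pos[OF tau_mem[OF t], of v u] by simp
qed

text \<open>The difference of two values of a fractional linear map is
  \<open>det (W w) * (t - t')\<close> over the product of the two denominators. These are at least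
  \<open>nn w / (1 + kap)\<close>, so \<open>det_W_nn\<close> bounds the quotient.\<close>

lemma tau_lipschitz:
  assumes t: "t \<in> {0..1}" "t' \<in> {0..1}"
  shows "\<bar>tau w t - tau w t'\<bar> \<le> (1 + kap)\<^sup>2 * gam ^ length w * \<bar>t - t'\<bar>"
proof -
  note p = rowsum_pos[OF t(1), of w] rowsum_pos[OF t(2), of w]
  have "tau w t - tau w t' = det (W w) * (t - t') / (rowsum w t * rowsum w t')"
    using p by (simp add: tau_def field_simps) (simp add: rowsum_def det_2 algebra_simps)
  then have "\<bar>tau w t - tau w t'\<bar> = \<bar>det (W w)\<bar> * \<bar>t - t'\<bar> / (rowsum w t * rowsum w t')"
    using p by (simp add: abs_mult)
  also have "\<dots> \<le> (gam ^ length w * (nn w)\<^sup>2) * \<bar>t - t'\<bar> / (rowsum w t * rowsum w t')"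
    using p by (intro divide_right_mono mult_right_mono det_W_nn) auto
  also have "\<dots> \<le> (gam ^ length w * (((1 + kap) * rowsum w t) * ((1 + kap) * rowsum w t'))) * \<bar>t - t'\<bar> / (rowsum w t * rowsum w t')"
    unfolding power2_eq_square using p gam(1) nn_pos[of w] kap_ge1
    by (intro divide_right_mono mult_right_mono mult_left_mono mult_mono rowsum_ge t) auto
  also have "\<dots> = (1 + kap)\<^sup>2 * gam ^ length w * \<bar>t - t'\<bar>"
    using p by (simp add: power2_eq_square)
  finally show ?thesis .
qed

lemma inner_W_simplex:
  "t \<in> {0..1} \<Longrightarrow> (W w *v x) \<bullet> simplex_vec t = rowsum w t * (x \<bullet> simplex_vec (tau w t))"
proof -
  assume "t \<in> {0..1}"
  from transpose_W_simplex[OF this, of w]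
  have "W w $1$1 * t + W w $2$1 * (1 - t) = rowsum w t * tau w t"
    "W w $1$2 * t + W w $2$2 * (1 - t) = rowsum w t * (1 - tau w t)"
    by (simp_all add: vec2_eq_iff mulv2_nth transpose_def)
  moreover have "(W w *v x) \<bullet> simplex_vec t =
    x $ 1 * (W w $1$1 * t + W w $2$1 * (1 - t)) + x $ 2 * (W w $1$2 * t + W w $2$2 * (1 - t))"
    by (simp add: inner2 mulv2_nth algebra_simps)
  ultimately show ?thesis by (simp only:) (simp add: inner2 algebra_simps)
qed

text \<open>The letters from \<open>a (1 - int n)\<close> to \<open>a 0\<close> in the order of
  time. By \<open>tau_append\<close> the oldest letter acts first, which is the order of composition
  in \<open>rho\<close>.\<close>

definition past :: "(int \<Rightarrow> 'm) \<Rightarrow> nat \<Rightarrow> 'm list" where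
  "past a n = rev (map (\<lambda>k. a (- int k)) [0..<n])"

text \<open>The starting value 0 stands for an arbitrary point of the unit interval, by
  \<open>tau_past_lim\<close>.\<close>

definition normal_coord :: "(int \<Rightarrow> 'm) \<Rightarrow> real" where
  "normal_coord a = lim (\<lambda>n. tau (past a n) 0)"

lemma length_past [simp]: "length (past a n) = n"
  by (simp add: past_def)

lemma past_add: "past a (n + k) = rev (map (\<lambda>k. a (- int k)) [n..<n + k]) @ past a n"
  unfolding past_def by (simp only: upt_add_eq_append[of 0 n k, simplified] map_append rev_append)

lemma gam_pow_0: "(\<lambda>n. (1 + kap)\<^sup>2 * gam ^ n) \<longlonglongrightarrow> 0"
  using tendsto_mult[OF tendsto_const LIMSEQ_realpow_zero[OF gam(1,2)]] by simp

lemma tau_past_close: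
  assumes "t \<in> {0..1}" "t' \<in> {0..1}"
  shows "\<bar>tau (past a n) t - tau (past a n) t'\<bar> \<le> (1 + kap)\<^sup>2 * gam ^ n"
proof -
  have "\<bar>t - t'\<bar> \<le> 1" using assms by auto
  then have "(1 + kap)\<^sup>2 * gam ^ n * \<bar>t - t'\<bar> \<le> (1 + kap)\<^sup>2 * gam ^ n * 1"
    using gam(1) by (intro mult_left_mono) auto
  then show ?thesis using tau_lipschitz[OF assms, of "past a n"] by simp
qed

text \<open>Every longer past ends with \<open>past a N\<close>, which acts last, so all later
  values lie in the image of the unit interval under \<open>tau (past a N)\<close>, an exponentially
  small set.\<close>

lemma tau_past_lim:
  assumes t: "t \<in> {0..1}"
  shows "(\<lambda>n. tau (past a n) t) \<longlonglongrightarrow> normal_coord a"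
proof -
  have "Cauchy (\<lambda>n. tau (past a n) 0)"
  proof (rule metric_CauchyI)
    fix e :: real assume "e > 0"
    then have "eventually (\<lambda>n. (1 + kap)\<^sup>2 * gam ^ n < e) sequentially"
      using gam_pow_0 by (auto dest: order_tendstoD)
    then obtain N where N: "(1 + kap)\<^sup>2 * gam ^ N < e" by (auto simp: eventually_sequentially)
    have "dist (tau (past a m) 0) (tau (past a n) 0) < e" if mn: "m \<ge> N" "n \<ge> N" for m n
    proof -
      obtain m' n' where mn: "m = N + m'" "n = N + n'" using mn by (metis le_iff_add)
      show ?thesis
        unfolding mn past_add dist_real_def
        using tau_past_close[OF tau_mem tau_mem, of 0 0] N
        by (simp add: tau_append tau_mem) (meson atLeastAtMost_iff order_refl zero_le_one le_less_trans)
    qed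
    then show "\<exists>M. \<forall>m\<ge>M. \<forall>n\<ge>M. dist (tau (past a m) 0) (tau (past a n) 0) < e" by blast
  qed
  then have 0: "(\<lambda>n. tau (past a n) 0) \<longlonglongrightarrow> normal_coord a"
    unfolding normal_coord_def by (simp add: Cauchy_convergent convergent_LIMSEQ_iff[symmetric] Cauchy_convergent_iff)
  show ?thesis
  proof (rule Lim_transform[OF 0])
    show "(\<lambda>n. tau (past a n) t - tau (past a n) 0) \<longlonglongrightarrow> 0"
      by (rule Lim_null_comparison[OF _ gam_pow_0]) (use tau_past_close[OF t, of 0] in auto)
  qed
qed

lemma normal_coord_mem: "normal_coord a \<in> {0..1}"
  using closed_sequentially[OF closed_atLeastAtMost _ tau_past_lim[of 0 a]] tau_mem[of 0] by auto

text \<open>The shift appends the letter \<open>a 1\<close> at the recent end of the past, where it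
  acts last; continuity of \<open>tau [a 1]\<close> gives the limit.\<close>

lemma normal_coord_shift1: "normal_coord (\<lambda>k. a (k + 1)) = tau [a 1] (normal_coord a)"
proof -
  have p: "past (\<lambda>k. a (k + 1)) (Suc n) = past a n @ [a 1]" for n
  proof -
    have "map (\<lambda>k. a (- int k + 1)) [0..<Suc n] = a 1 # map (\<lambda>k. a (- int k)) [0..<n]"
      by (simp only: upt_conv_Cons[of 0 "Suc n", OF zero_less_Suc] list.map map_Suc_upt[symmetric])
         (simp add: o_def algebra_simps)
    then show ?thesis unfolding past_def by (simp del: upt_Suc)
  qed
  have "(\<lambda>n. tau (past (\<lambda>k. a (k + 1)) (Suc n)) 0) \<longlonglongrightarrow> normal_coord (\<lambda>k. a (k + 1))"
    by (rule LIMSEQ_Suc[OF tau_past_lim]) simp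
  moreover have "(\<lambda>n. tau (past (\<lambda>k. a (k + 1)) (Suc n)) 0) \<longlonglongrightarrow> tau [a 1] (normal_coord a)"
  proof -
    have "(\<lambda>n. tau [a 1] (tau (past a n) 0) - tau [a 1] (normal_coord a)) \<longlonglongrightarrow> 0"
    proof (rule Lim_null_comparison[OF always_eventually, rule_format])
      show "norm (tau [a 1] (tau (past a n) 0) - tau [a 1] (normal_coord a))
          \<le> (1 + kap)\<^sup>2 * gam ^ length [a 1] * \<bar>tau (past a n) 0 - normal_coord a\<bar>" for n
        unfolding real_norm_def by (rule tau_lipschitz[OF tau_mem normal_coord_mem]) simp
      have "(\<lambda>n. \<bar>tau (past a n) 0 - normal_coord a\<bar>) \<longlonglongrightarrow> 0"
        using tendsto_rabs_zero[OF LIM_zero[OF tau_past_lim]] by simp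
      from tendsto_mult[OF tendsto_const this]
      show "(\<lambda>n. (1 + kap)\<^sup>2 * gam ^ length [a 1] * \<bar>tau (past a n) 0 - normal_coord a\<bar>) \<longlonglongrightarrow> 0" by simp
    qed
    then show ?thesis by (simp add: p tau_append LIM_zero_iff)
  qed
  ultimately show ?thesis using LIMSEQ_unique by blast
qed

definition future :: "(int \<Rightarrow> 'm) \<Rightarrow> nat \<Rightarrow> 'm" where
  "future a k = a (int k + 1)"

text \<open>Time 0 belongs to the past, so the future begins with \<open>a 1\<close>, and its first
  \<open>n\<close> letters are exactly those that the past gains under \<open>n\<close> shifts. This
  equivariance identifies the normal of a pulled-back strip without error.\<close>

lemma normal_coord_shift:
  "normal_coord (\<lambda>k. a (k + int n)) = tau (pre (future a) n) (normal_coord a)"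
proof (induction n)
  case 0
  have "normal_coord a = tau [] (normal_coord a)" using normal_coord_mem[of a]
    by (simp add: tau_def rowsum_def mat_def)
  then show ?case by simp
next
  case (Suc n)
  have "normal_coord (\<lambda>k. a (k + int (Suc n))) = normal_coord (\<lambda>k. (\<lambda>k. a (k + int n)) (k + 1))"
    by (simp add: algebra_simps)
  also have "\<dots> = tau [a (1 + int n)] (normal_coord (\<lambda>k. a (k + int n)))"
    by (rule normal_coord_shift1)
  finally show ?case
    using Suc normal_coord_mem by (simp add: tau_append future_def add.commute)
qed

lemma normal_coord_cong:
  assumes "\<And>k. k \<le> 0 \<Longrightarrow> a k = b k" shows "normal_coord a = normal_coord b"
proof -
  have "past a n = past b n" for n using assms by (simp add: past_def)
  then show ?thesis by (simp add: normal_coord_def)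
qed

lemma measurable_normal_coord [measurable]: "normal_coord \<in> borel_measurable seq_space"
proof (rule borel_measurable_LIMSEQ_real[of _ "\<lambda>n a. tau (past a n) 0"])
  fix n
  have "(\<lambda>a. tau (rev (map a (map (\<lambda>k. - int k) [0..<n]))) 0) \<in> borel_measurable seq_space"
    by (rule measurable_window) simp
  then show "(\<lambda>a. tau (past a n) 0) \<in> borel_measurable seq_space"
    by (simp add: past_def o_def)
qed (rule tau_past_lim, simp)

lemma foldr_proj_map:
  assumes "x \<noteq> 0"
  shows "foldr (\<lambda>k. proj_map (A (c k))) l (direction_of (rot x)) =
      direction_of (rot (transpose (W (rev (map c l))) *v x)) \<and> transpose (W (rev (map c l))) *v x \<noteq> 0"
proof (induction l)
  case Nil show ?case using assms by (simp add: transpose_mat)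
next
  case (Cons k l)
  let ?y = "transpose (W (rev (map c l))) *v x"
  have eq: "transpose (W (rev (map c (k # l)))) *v x = transpose (A (c k)) *v ?y"
    by (simp only: list.map rev.simps word_matrix_append matrix_transpose_mul matrix_vector_mul_assoc
        word_matrix.simps matrix_mul_rid)
  have "invertible (transpose (A (c k)))" using inv by (simp add: invertible_det_nz)
  then have "transpose (A (c k)) *v ?y \<noteq> 0"
    using Cons.IH matrix_left_invertible_ker invertible_left_inverse by blast
  then show ?case
    using Cons.IH proj_map_direction_of_rot[OF inv] unfolding eq by simp
qed

text \<open>On normals the composed maps act by \<open>tau (past a (Suc n))\<close>, and
  \<open>tau_past_lim\<close> gives the same limit for every starting direction in
  \<open>Q2\<close>.\<close>

lemma rho_eq: "rho A a = direction_of (rot (simplex_vec (normal_coord a)))"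
  unfolding rho_def
proof (rule the_equality)
  have *: "(\<lambda>n. foldr (\<lambda>k. proj_map (A (a (- int k)))) [0..<Suc n] \<theta>)
      \<longlonglongrightarrow> direction_of (rot (simplex_vec (normal_coord a)))" if \<theta>: "\<theta> \<in> Q2" for \<theta>
  proof -
    obtain t where t: "t \<in> {0..1}" "\<theta> = direction_of (rot (simplex_vec t))" using \<theta> Q2_eq by blast
    have "foldr (\<lambda>k. proj_map (A (a (- int k)))) [0..<Suc n] \<theta> =
        direction_of (rot (simplex_vec (tau (past a (Suc n)) t)))" for n
    proof -
      have "rowsum (past a (Suc n)) t \<noteq> 0" using rowsum_pos[OF t(1)] by (metis less_irrefl)
      then show ?thesis
        using foldr_proj_map[of "simplex_vec t" "\<lambda>k. a (- int k)" "[0..<Suc n]"] t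
        by (simp only: past_def[symmetric] transpose_W_simplex rot_scaleR direction_of_scaleR
            simplex_vec_ne_0 not_False_eq_True simp_thms)
    qed
    moreover have "(\<lambda>n. direction_of (rot (simplex_vec (tau (past a (Suc n)) t))))
        \<longlonglongrightarrow> direction_of (rot (simplex_vec (normal_coord a)))"
      using continuous_on_tendsto_compose[OF continuous_simplex_direction LIMSEQ_Suc[OF tau_past_lim[OF t(1)]]] by simp
    ultimately show ?thesis by simp
  qed
  then show "\<forall>\<theta>\<in>Q2. (\<lambda>n. foldr (\<lambda>k. proj_map (A (a (- int k)))) [0..<Suc n] \<theta>)
      \<longlonglongrightarrow> direction_of (rot (simplex_vec (normal_coord a)))" by blast
  fix r assume r: "\<forall>\<theta>\<in>Q2. (\<lambda>n. foldr (\<lambda>k. proj_map (A (a (- int k)))) [0..<Suc n] \<theta>) \<longlonglongrightarrow> r"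
  have "direction_of (rot (simplex_vec 0)) \<in> Q2" using Q2_eq by force
  then show "r = direction_of (rot (simplex_vec (normal_coord a)))" using r * LIMSEQ_unique by blast
qed

lemma measurable_rho: "rho A \<in> seq_space \<rightarrow>\<^sub>M borel"
proof -
  have "(\<lambda>t. direction_of (rot (simplex_vec t))) \<in> borel_measurable borel"
    by (rule borel_measurable_continuous_onI[OF continuous_simplex_direction])
  from measurable_compose[OF measurable_normal_coord this]
  show ?thesis by (simp add: rho_eq[abs_def])
qed

end

section \<open>Gibbs bounds and coverings of the attractor\<close>

text \<open>The rectangle is cut along \<open>q\<close> into slices of length \<open>b\<close>. A
  slice extends at most \<open>b\<close> along \<open>q\<close> and \<open>2 * b\<close> across, so
  \<open>3 * b\<close> bounds its diameter. With \<open>L\<close> the ceiling of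
  \<open>a / b\<close>, at most \<open>2 * L + 1\<close> slices occur.\<close>

lemma rectangle_cover:
  fixes S :: "(real^2) set"
  assumes q: "norm q = 1" and a: "a \<ge> 0" and b: "b > 0"
    and S: "\<And>y. y \<in> S \<Longrightarrow> \<bar>(y - y0) \<bullet> q\<bar> \<le> a" "\<And>y. y \<in> S \<Longrightarrow> \<bar>(y - y0) \<bullet> rot q\<bar> \<le> b"
  shows "\<exists>\<C>. finite \<C> \<and> real (card \<C>) \<le> 2 * (a / b) + 3 \<and> delta_cover (3 * b) S \<C>"
proof -
  define L where "L = \<lceil>a / b\<rceil>"
  define P where "P k = {y\<in>S. real_of_int k * b \<le> (y - y0) \<bullet> q \<and> (y - y0) \<bullet> q \<le> (real_of_int k + 1) * b}" for k
  have L: "0 \<le> L" "real_of_int L \<le> a / b + 1" "a / b \<le> real_of_int L"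
    using divide_nonneg_pos[OF a b] unfolding L_def by linarith+
  have cover: "S \<subseteq> \<Union>(P ` {-L..L})"
  proof
    fix y assume y: "y \<in> S"
    define k where "k = \<lfloor>(y - y0) \<bullet> q / b\<rfloor>"
    have "\<bar>(y - y0) \<bullet> q / b\<bar> \<le> a / b" using S(1)[OF y] b by (simp add: abs_divide divide_right_mono)
    then have "- real_of_int L \<le> (y - y0) \<bullet> q / b" "(y - y0) \<bullet> q / b \<le> real_of_int L"
      using L(3) by linarith+
    then have "k \<in> {-L..L}" unfolding k_def by (simp add: le_floor_iff floor_le_iff)
    moreover have "real_of_int k \<le> (y - y0) \<bullet> q / b" "(y - y0) \<bullet> q / b \<le> real_of_int k + 1"
      unfolding k_def by linarith+
    then have "y \<in> P k" using y b by (simp add: P_def field_simps)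
    ultimately show "y \<in> \<Union>(P ` {-L..L})" by blast
  qed
  have pyth: "(norm v)\<^sup>2 = (v \<bullet> q)\<^sup>2 + (v \<bullet> rot q)\<^sup>2" for v
  proof -
    have "(v \<bullet> q)\<^sup>2 + (v \<bullet> rot q)\<^sup>2 = (norm v)\<^sup>2 * (norm q)\<^sup>2"
      unfolding norm2_sq by (simp add: inner2 power2_eq_square algebra_simps)
    then show ?thesis by (simp add: q)
  qed
  have dst: "norm (x - y) \<le> 3 * b" if "x \<in> P k" "y \<in> P k" for x y k
  proof (rule power2_le_imp_le)
    have "\<bar>(x - y) \<bullet> q\<bar> \<le> b"
      using that unfolding P_def by (auto simp: inner_diff_left algebra_simps)
    then have 1: "((x - y) \<bullet> q)\<^sup>2 \<le> b\<^sup>2" using b by (simp add: abs_le_square_iff[symmetric])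
    have "\<bar>(x - y) \<bullet> rot q\<bar> \<le> 2 * b"
      using that S(2)[of x] S(2)[of y] unfolding P_def by (auto simp: inner_diff_left)
    then have 2: "((x - y) \<bullet> rot q)\<^sup>2 \<le> (2 * b)\<^sup>2" using b by (intro power2_le_iff_abs_le[THEN iffD2]) auto
    show "(norm (x - y))\<^sup>2 \<le> (3 * b)\<^sup>2"
    proof -
      have "(3 * b)\<^sup>2 = 9 * b\<^sup>2" "(2 * b)\<^sup>2 = 4 * b\<^sup>2" by (simp_all add: power_mult_distrib)
      then show ?thesis using 1 2 zero_le_power2[of b] unfolding pyth by linarith
    qed
  qed (use b in auto)
  have "delta_cover (3 * b) S (P ` {-L..L})"
    unfolding delta_cover_def
  proof (intro conjI cover ballI)
    fix U assume "U \<in> P ` {-L..L}"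
    then obtain k where k: "U = P k" by blast
    show "bounded U" unfolding k bounded_two_points
      using dst by (intro exI[of _ "3 * b"]) (auto simp: dist_norm)
    show "diameter U \<le> 3 * b" unfolding k
      by (rule diameter_le) (use b dst in auto)
  qed
  moreover have "real (card (P ` {-L..L})) \<le> 2 * (a / b) + 3"
  proof -
    have "card (P ` {-L..L}) \<le> card {-L..L}" by (rule card_image_le) simp
    also have "\<dots> = nat (2 * L + 1)" by simp
    finally have "real (card (P ` {-L..L})) \<le> real_of_int (2 * L + 1)" using L(1) by linarith
    then show ?thesis using L(2) by simp
  qed
  ultimately show ?thesis by blast
qed

locale kaenmaki_ifs = positive_ifs A d E for A :: "'m::finite \<Rightarrow> real^2^2" and d E +
  fixes \<mu> :: "(nat \<Rightarrow> 'm) measure"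
  assumes kaen: "is_kaenmaki_measure A \<mu>"
begin

abbreviation "s \<equiv> affinity_dim A"

lemma mu_prob: "prob_space \<mu>" and mu_sets: "sets \<mu> = sets seq_space"
  using kaen by (auto simp: is_kaenmaki_measure_def)

sublocale mu: prob_space \<mu> by (rule mu_prob)

lemma mu_space [simp]: "space \<mu> = UNIV"
  using sets_eq_imp_space_eq[OF mu_sets] by simp

abbreviation "mc w \<equiv> measure \<mu> (cylinder w)"

lemma gibbs_sv:
  "\<exists>C>0. \<forall>w. sv_function s (W w) \<le> C * mc w \<and> mc w \<le> C * sv_function s (W w)"
proof -
  obtain C where C: "C > 0" "\<And>w. inverse C * sv_function s (W w) \<le> mc w"
    "\<And>w. mc w \<le> C * sv_function s (W w)"
    using kaen by (auto simp: is_kaenmaki_measure_def)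
  then show ?thesis by (intro exI[of _ C]) (auto simp: field_simps)
qed

lemmas alpha_W = alpha1_esum[OF nonneg_W, folded nn_def] alpha2_esum(1-4)[OF nonneg_W det_W, folded nn_def, folded bt_def]

text \<open>The sign of \<open>s\<close> is not known at this stage, hence the two cases and the
  exponent \<open>\<bar>s\<bar>\<close> on the factor 3 between \<open>nn\<close> and
  \<open>alpha1\<close>.\<close>

lemma gibbs_small:
  assumes "s < 1"
  shows "\<exists>G>0. \<forall>w. nn w powr s \<le> G * mc w"
proof -
  obtain C where C: "C > 0" "\<And>w. sv_function s (W w) \<le> C * mc w" using gibbs_sv by blast
  have "nn w powr s \<le> 3 powr \<bar>s\<bar> * C * mc w" for w
  proof -
    have "nn w powr s \<le> 3 powr \<bar>s\<bar> * alpha1 (W w) powr s"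
    proof (cases "s \<ge> 0")
      case True
      have "nn w powr s \<le> (3 * alpha1 (W w)) powr s"
        using alpha_W[of w] nn_pos[of w] True by (intro powr_mono2) auto
      then show ?thesis using True alpha_W[of w] by (simp add: powr_mult)
    next
      case False
      have "nn w powr s \<le> 1 * alpha1 (W w) powr s"
        using alpha_W[of w] False by (simp add: powr_mono2')
      also have "\<dots> \<le> 3 powr \<bar>s\<bar> * alpha1 (W w) powr s"
        by (intro mult_right_mono ge_one_powr_ge_zero) auto
      finally show ?thesis .
    qed
    also have "alpha1 (W w) powr s = sv_function s (W w)" using assms by (simp add: sv_function_def)
    also have "3 powr \<bar>s\<bar> * sv_function s (W w) \<le> 3 powr \<bar>s\<bar> * (C * mc w)"
      by (intro mult_left_mono C) auto
    finally show ?thesis by (simp add: mult.assoc)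
  qed
  then show ?thesis using C(1) by (intro exI[of _ "3 powr \<bar>s\<bar> * C"]) auto
qed

text \<open>For \<open>s \<ge> 1\<close> this is the singular value function at \<open>s\<close> up
  to a constant, with \<open>nn\<close> and \<open>bt\<close> in place of the singular
  values.\<close>

definition "Phi w = nn w * bt w powr (s - 1)"

lemma Phi_pos: "Phi w > 0" using nn_pos bt_pos[of w] by (simp add: Phi_def)

lemma gibbs:
  assumes "s \<ge> 1"
  shows "\<exists>G>0. \<forall>w. Phi w \<le> G * mc w \<and> mc w \<le> G * Phi w"
proof -
  obtain C where C: "C > 0" "\<And>w. sv_function s (W w) \<le> C * mc w" "\<And>w. mc w \<le> C * sv_function s (W w)"
    using gibbs_sv by blast
  have sv: "sv_function s (W w) = alpha1 (W w) * alpha2 (W w) powr (s - 1)" for w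
    using assms alpha_W[of w] by (auto simp: sv_function_def)
  define G where "G = C * (3 + 3 powr (s - 1))"
  have G: "C * 3 \<le> G" "C * 3 powr (s - 1) \<le> G" "G > 0"
    using C(1) by (auto simp: G_def algebra_simps add_pos_pos)
  have "Phi w \<le> G * mc w \<and> mc w \<le> G * Phi w" for w
  proof
    have "Phi w \<le> (3 * alpha1 (W w)) * alpha2 (W w) powr (s - 1)"
      unfolding Phi_def using alpha_W[of w] bt_pos[of w] assms by (intro mult_mono powr_mono2) auto
    also have "\<dots> = 3 * sv_function s (W w)" by (simp add: sv)
    also have "\<dots> \<le> 3 * (C * mc w)" by (intro mult_left_mono C) auto
    also have "\<dots> \<le> G * mc w" using mult_right_mono[OF G(1), of "mc w"] by (simp add: mult_ac)
    finally show "Phi w \<le> G * mc w" .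
    have "sv_function s (W w) \<le> nn w * (3 * bt w) powr (s - 1)"
      unfolding sv using alpha_W[of w] assms nn_pos[of w] by (intro mult_mono powr_mono2) auto
    also have "\<dots> = 3 powr (s - 1) * Phi w" using bt_pos[of w] by (simp add: Phi_def powr_mult)
    finally have "C * sv_function s (W w) \<le> C * (3 powr (s - 1) * Phi w)" using C(1) by simp
    also have "\<dots> \<le> G * Phi w" using mult_right_mono[OF G(2), of "Phi w"] Phi_pos[of w] by (simp add: mult_ac)
    finally show "mc w \<le> G * Phi w" using C(3)[of w] by linarith
  qed
  then show ?thesis using G(3) by blast
qed

lemma Phi_append:
  assumes "s \<ge> 1"
  shows "Phi (u @ v) \<le> (1 + kap) powr (s - 1) * (Phi u * Phi v)"
proof -
  have "Phi (u @ v) \<le> (nn u * nn v) * ((1 + kap) * (bt u * bt v)) powr (s - 1)"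
    unfolding Phi_def using assms bt_pos[of "u @ v"] nn_pos[of u] nn_pos[of v]
    by (intro mult_mono powr_mono2 nn_append_le bt_append_le) auto
  also have "\<dots> = (1 + kap) powr (s - 1) * (Phi u * Phi v)"
    using bt_pos[of u] bt_pos[of v] kap_ge1 by (simp add: Phi_def powr_mult)
  finally show ?thesis .
qed

text \<open>\<open>Phi\<close> is submultiplicative up to a constant, and the Gibbs bounds carry
  this over to \<open>\<mu>\<close>.\<close>

lemma quasi_bernoulli:
  assumes "s \<ge> 1"
  shows "\<exists>C>0. \<forall>u v. mc (u @ v) \<le> C * (mc u * mc v)"
proof -
  obtain G where G: "G > 0" "\<And>w. Phi w \<le> G * mc w" "\<And>w. mc w \<le> G * Phi w"
    using gibbs[OF assms] by blast
  let ?k = "(1 + kap) powr (s - 1)"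
  have "mc (u @ v) \<le> G * ?k * G * G * (mc u * mc v)" for u v
  proof -
    have "mc (u @ v) \<le> G * Phi (u @ v)" by (rule G)
    also have "\<dots> \<le> G * (?k * (Phi u * Phi v))" using G(1) by (intro mult_left_mono Phi_append assms) auto
    also have "\<dots> \<le> G * (?k * ((G * mc u) * (G * mc v)))"
      using G(1) Phi_pos[of v] by (intro mult_left_mono mult_mono G(2)) (auto intro: less_imp_le)
    finally show ?thesis by (simp add: mult_ac)
  qed
  then show ?thesis using G(1) kap_ge1 by (intro exI[of _ "G * ?k * G * G"]) auto
qed

text \<open>Each sequence is read until \<open>g\<close> first drops to \<open>\<delta>\<close>;
  \<open>g\<close> will be \<open>nn\<close> when \<open>s < 1\<close> and \<open>bt\<close> when
  \<open>s \<ge> 1\<close>. The stopped words have bounded length, hence are finitely many, and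
  their cylinders are disjoint, hence the masses add up to at most 1.\<close>

lemma stopping_words:
  assumes g: "\<And>w. g w \<le> 4 * cr ^ length w" and c: "\<And>w i. c * g w \<le> g (w @ [i])" "c > 0"
    and \<delta>: "0 < \<delta>" "\<delta> < g []"
  shows "\<exists>Ws. finite Ws \<and> (\<forall>w\<in>Ws. c * \<delta> \<le> g w \<and> g w \<le> \<delta>) \<and> E \<subseteq> (\<Union>w\<in>Ws. T w ` E) \<and> (\<Sum>w\<in>Ws. mc w) \<le> 1"
proof -
  have "eventually (\<lambda>n. cr ^ n * 4 < \<delta>) sequentially"
    by (rule order_tendstoD(2)[OF cr_pow_0 \<delta>(1)])
  then obtain N where N: "4 * cr ^ N < \<delta>" by (auto simp: eventually_sequentially mult.commute)
  have gN: "g (pre a N) \<le> \<delta>" for a using g[of "pre a N"] N by simp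
  define n where "n a = (LEAST k. g (pre a k) \<le> \<delta>)" for a
  have n: "g (pre a (n a)) \<le> \<delta>" for a unfolding n_def by (rule LeastI[of _ N]) (rule gN)
  have nN: "n a \<le> N" for a unfolding n_def by (rule Least_le) (rule gN)
  \<comment> \<open>Stopping depends only on the letters already read, so sequences that agree up to
    the stopping time of one of them stop together. This makes the cylinders of \<open>Ws\<close>
    disjoint.\<close>
  have n_cong: "n b = n a" if "pre b (n a) = pre a (n a)" for a b
  proof -
    have eq: "pre b k = pre a k" if "k \<le> n a" for k
      using that \<open>pre b (n a) = pre a (n a)\<close> by (auto simp: map_eq_conv)
    show ?thesis
    proof (rule antisym)
      show "n b \<le> n a" unfolding n_def[of b]
        by (rule Least_le) (simp only: that n)
      then have "g (pre a (n b)) \<le> \<delta>" by (simp only: eq[symmetric] n)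
      then show "n a \<le> n b" unfolding n_def[of a] by (rule Least_le)
    qed
  qed
  define Ws where "Ws = range (\<lambda>a. pre a (n a))"
  have fin: "finite Ws"
  proof (rule finite_subset)
    show "Ws \<subseteq> {w. set w \<subseteq> UNIV \<and> length w \<le> N}" using nN by (auto simp: Ws_def)
  qed (rule finite_lists_length_le, simp)
  have bounds: "c * \<delta> \<le> g w \<and> g w \<le> \<delta>" if w: "w \<in> Ws" for w
  proof -
    obtain a where a: "w = pre a (n a)" using w by (auto simp: Ws_def)
    \<comment> \<open>Since \<open>\<delta> < g []\<close>, at least one letter is read; without its
      last letter the word still has \<open>g\<close> above \<open>\<delta>\<close>, which bounds
      the overshoot by the factor \<open>c\<close>.\<close>
    have "n a \<noteq> 0" using n[of a] \<delta>(2) by (intro notI) simp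
    then obtain m where m: "n a = Suc m" by (cases "n a") auto
    have "\<not> g (pre a m) \<le> \<delta>" using not_less_Least[of m "\<lambda>k. g (pre a k) \<le> \<delta>"] m by (simp add: n_def)
    then have "c * \<delta> \<le> c * g (pre a m)" using c(2) by simp
    also have "\<dots> \<le> g (pre a m @ [a m])" by (rule c)
    finally show ?thesis using n[of a] by (simp add: a m)
  qed
  have cov: "E \<subseteq> (\<Union>w\<in>Ws. T w ` E)"
  proof
    fix x assume "x \<in> E"
    then obtain a where "x = \<pi> a" using coding_surj by blast
    then have "x = T (pre a (n a)) (\<pi> (\<lambda>k. a (k + n a)))" using coding_shift by metis
    then show "x \<in> (\<Union>w\<in>Ws. T w ` E)" using coding_in_E by (auto simp: Ws_def)
  qed
  have sub: "pre b (n b) = w" if w: "w \<in> Ws" and b: "b \<in> cylinder w" for b w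
  proof -
    obtain a where a: "w = pre a (n a)" using w by (auto simp: Ws_def)
    have "pre b (n a) = pre a (n a)" using b unfolding cylinder_pre a by simp
    then show ?thesis using n_cong[of b a] a by simp
  qed
  have "(\<Sum>w\<in>Ws. mc w) = measure \<mu> (\<Union>w\<in>Ws. cylinder w)"
    using fin sub by (intro mu.finite_measure_finite_Union[symmetric])
      (auto simp: mu_sets disjoint_family_on_def)
  also have "\<dots> \<le> 1" by simp
  finally show ?thesis using fin bounds cov by blast
qed

text \<open>The pieces of stopped words are covered one by one. The number of sets allowed for a
  piece is proportional to its mass, so the total is controlled by the sum of the masses, which is
  at most 1.\<close>

lemma cover_of_stopping:
  assumes g: "\<And>w. g w \<le> 4 * cr ^ length w" "\<And>w. g w > 0" and c: "\<And>w i. c * g w \<le> g (w @ [i])" "c > 0" "c \<le> 1"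
    and K1: "K1 > 0"
    and piece: "\<And>w. \<exists>\<C>. finite \<C> \<and> real (card \<C>) \<le> K1 * mc w * g w powr (- s) \<and> delta_cover (K1 * g w) (T w ` E) \<C>"
  shows "\<exists>K>0. \<exists>R>0. \<forall>\<delta>. 0 < \<delta> \<longrightarrow> \<delta> < R \<longrightarrow>
    (\<exists>\<C>. finite \<C> \<and> real (card \<C>) \<le> K * \<delta> powr (- s) \<and> delta_cover \<delta> E \<C>)"
proof -
  obtain \<C> where C: "\<And>w. finite (\<C> w)" "\<And>w. real (card (\<C> w)) \<le> K1 * mc w * g w powr (- s)"
    "\<And>w. delta_cover (K1 * g w) (T w ` E) (\<C> w)"
    using piece by metis
  \<comment> \<open>The factor \<open>c powr (- \<bar>s\<bar>)\<close> compares
    \<open>g w powr (- s)\<close> with \<open>e powr (- s)\<close> for either sign of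
    \<open>s\<close>, and \<open>K1 powr s\<close> undoes the scaling
    \<open>e = \<delta> / K1\<close>.\<close>
  define K where "K = K1 * (c powr (- \<bar>s\<bar>) * K1 powr s)"
  have "\<exists>\<C>. finite \<C> \<and> real (card \<C>) \<le> K * \<delta> powr (- s) \<and> delta_cover \<delta> E \<C>"
    if \<delta>: "0 < \<delta>" "\<delta> < K1 * g []" for \<delta>
  proof -
    define e where "e = \<delta> / K1"
    have e: "0 < e" "e < g []" using \<delta> K1 by (auto simp: e_def field_simps)
    obtain Ws where Ws: "finite Ws" "\<And>w. w \<in> Ws \<Longrightarrow> c * e \<le> g w \<and> g w \<le> e"
      "E \<subseteq> (\<Union>w\<in>Ws. T w ` E)" "(\<Sum>w\<in>Ws. mc w) \<le> 1"
      using stopping_words[of g c e, OF g(1) c(1,2) e] by blast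
    have pw: "g w powr (- s) \<le> c powr (- \<bar>s\<bar>) * e powr (- s)" if "w \<in> Ws" for w
    proof (cases "s \<ge> 0")
      case True
      have "g w powr (- s) \<le> (c * e) powr (- s)"
        using Ws(2)[OF that] True e c by (intro powr_mono2') auto
      then show ?thesis using True e c by (simp add: powr_mult)
    next
      case False
      have "g w powr (- s) \<le> 1 * e powr (- s)"
        using Ws(2)[OF that] False g(2)[of w] by (simp add: powr_mono2)
      also have "1 \<le> c powr (- \<bar>s\<bar>)" using powr_mono2'[of "- \<bar>s\<bar>" c 1] c by simp
      finally show ?thesis by (simp add: mult_right_mono)
    qed
    have "real (card (\<Union>w\<in>Ws. \<C> w)) \<le> (\<Sum>w\<in>Ws. real (card (\<C> w)))"
      using card_UN_le[OF Ws(1), of \<C>] by (simp flip: of_nat_sum)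
    also have "\<dots> \<le> (\<Sum>w\<in>Ws. K1 * mc w * (c powr (- \<bar>s\<bar>) * e powr (- s)))"
      using K1 by (intro sum_mono order_trans[OF C(2)] mult_left_mono pw) auto
    also have "\<dots> = K1 * (c powr (- \<bar>s\<bar>) * e powr (- s)) * (\<Sum>w\<in>Ws. mc w)"
      by (simp add: sum_distrib_left mult_ac)
    also have "\<dots> \<le> K1 * (c powr (- \<bar>s\<bar>) * e powr (- s)) * 1"
      using K1 by (intro mult_left_mono Ws(4)) auto
    also have "e powr (- s) = K1 powr s * \<delta> powr (- s)"
      using K1 \<delta>(1) by (simp add: e_def powr_divide powr_minus field_simps)
    finally have card: "real (card (\<Union>w\<in>Ws. \<C> w)) \<le> K * \<delta> powr (- s)" by (simp add: K_def mult_ac)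
    have "delta_cover \<delta> E (\<Union>w\<in>Ws. \<C> w)"
      unfolding delta_cover_def
    proof (intro conjI ballI)
      show "E \<subseteq> \<Union>(\<Union>w\<in>Ws. \<C> w)"
      proof
        fix x assume "x \<in> E"
        with Ws(3) obtain w where w: "w \<in> Ws" "x \<in> T w ` E" by (rule UN_E[OF subsetD])
        moreover have "T w ` E \<subseteq> \<Union>(\<C> w)" using C(3)[of w] unfolding delta_cover_def ..
        ultimately obtain U where "U \<in> \<C> w" "x \<in> U" by (meson UnionE subsetD)
        then show "x \<in> \<Union>(\<Union>w\<in>Ws. \<C> w)" using w(1) by (intro UnionI[of U] UN_I)
      qed
      fix U assume "U \<in> (\<Union>w\<in>Ws. \<C> w)"
      then obtain w where w: "w \<in> Ws" "U \<in> \<C> w" by blast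
      then have "bounded U" "diameter U \<le> K1 * g w" using C(3)[of w] by (auto simp: delta_cover_def)
      moreover have "K1 * g w \<le> \<delta>" using Ws(2)[OF w(1)] K1 by (simp add: e_def field_simps)
      ultimately show "bounded U" "diameter U \<le> \<delta>" by auto
    qed
    then show ?thesis using card Ws(1) C(1) by blast
  qed
  moreover have "K > 0" "K1 * g [] > 0" using K1 c g(2)[of "[]"] by (auto simp: K_def)
  ultimately show ?thesis by blast
qed

lemma norm_W_le: "norm (W w *v v) \<le> nn w * norm v"
proof -
  have c: "\<bar>v$i\<bar> \<le> norm v" for i by (rule component_le_norm_cart)
  have k: "\<bar>(W w *v v) $ i\<bar> \<le> (W w $ i $ 1 + W w $ i $ 2) * norm v" for i
  proof -
    have "\<bar>(W w *v v) $ i\<bar> \<le> W w $ i $ 1 * \<bar>v$1\<bar> + W w $ i $ 2 * \<bar>v$2\<bar>"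
      using W_nonneg[of w i 1] W_nonneg[of w i 2] abs_triangle_ineq[of "W w $ i $ 1 * v$1" "W w $ i $ 2 * v$2"]
      by (simp add: mulv2_nth abs_mult)
    also have "\<dots> \<le> W w $ i $ 1 * norm v + W w $ i $ 2 * norm v"
      by (intro add_mono mult_left_mono c W_nonneg)
    finally show ?thesis by (simp add: algebra_simps)
  qed
  have "norm (W w *v v) \<le> \<bar>(W w *v v)$1\<bar> + \<bar>(W w *v v)$2\<bar>"
    using norm_le_l1_cart[of "W w *v v"] by (simp add: sum_2)
  then show ?thesis using k[of 1] k[of 2] by (simp add: nn_def esum_def algebra_simps)
qed

lemma E_diam: "\<exists>D>0. \<forall>x\<in>E. \<forall>y\<in>E. norm (x - y) \<le> D"
proof -
  obtain D where D: "\<And>x y. x \<in> E \<Longrightarrow> y \<in> E \<Longrightarrow> dist x y \<le> D"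
    using compact_imp_bounded[OF E_compact] by (auto simp: bounded_two_points)
  show ?thesis
    by (rule exI[of _ "\<bar>D\<bar> + 1"]) (use D in \<open>force simp: dist_norm\<close>)
qed

text \<open>Each piece is its own covering set, of diameter at most a multiple of
  \<open>nn w\<close>; \<open>gibbs_small\<close> says that one set per piece is within the
  allowance.\<close>

lemma cover_small:
  assumes "s < 1"
  shows "\<exists>K>0. \<exists>R>0. \<forall>\<delta>. 0 < \<delta> \<longrightarrow> \<delta> < R \<longrightarrow>
    (\<exists>\<C>. finite \<C> \<and> real (card \<C>) \<le> K * \<delta> powr (- s) \<and> delta_cover \<delta> E \<C>)"
proof -
  obtain G where G: "G > 0" "\<And>w. nn w powr s \<le> G * mc w" using gibbs_small[OF assms] by blast
  obtain D where D: "D > 0" "\<And>x y. x \<in> E \<Longrightarrow> y \<in> E \<Longrightarrow> norm (x - y) \<le> D" using E_diam by blast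
  obtain c where c: "c > 0" "\<And>w i. c * nn w \<le> nn (w @ [i])" using nn_snoc by blast
  have c': "min c 1 * nn w \<le> nn (w @ [i])" for w i
    using order_trans[OF mult_right_mono c(2)[of w i], of "min c 1"] nn_pos[of w] by simp
  show ?thesis
  proof (rule cover_of_stopping[OF nn_le nn_pos c', of "G + D"])
    fix w
    have d: "norm (x - y) \<le> (G + D) * nn w" if "x \<in> T w ` E" "y \<in> T w ` E" for x y
    proof -
      obtain x' y' where xy: "x' \<in> E" "y' \<in> E" "x = T w x'" "y = T w y'" using \<open>x \<in> _\<close> \<open>y \<in> _\<close> by blast
      have "norm (x - y) \<le> nn w * norm (x' - y')" using norm_W_le by (simp add: xy word_map_diff)
      also have "\<dots> \<le> nn w * (G + D)" using D(2)[OF xy(1,2)] G(1) nn_pos[of w] by (intro mult_left_mono) auto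
      finally show ?thesis by (simp add: mult.commute)
    qed
    have "1 = nn w powr s * nn w powr (- s)" using nn_pos[of w] by (simp flip: powr_add)
    also have "\<dots> \<le> G * mc w * nn w powr (- s)" by (intro mult_right_mono G) auto
    also have "\<dots> \<le> (G + D) * mc w * nn w powr (- s)" using D(1) by (intro mult_right_mono) auto
    finally have "real (card {T w ` E}) \<le> (G + D) * mc w * nn w powr (- s)" by simp
    moreover have "delta_cover ((G + D) * nn w) (T w ` E) {T w ` E}"
      unfolding delta_cover_def bounded_two_points using d G(1) D(1) nn_pos[of w]
      by (auto simp: dist_norm intro!: diameter_le)
    ultimately show "\<exists>\<C>. finite \<C> \<and> real (card \<C>) \<le> (G + D) * mc w * nn w powr (- s)
        \<and> delta_cover ((G + D) * nn w) (T w ` E) \<C>" by (intro exI[of _ "{T w ` E}"]) auto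
  qed (use c G D in auto)
qed

text \<open>A piece fits into a rectangle with sides about \<open>nn w\<close> and
  \<open>bt w\<close>. The number \<open>nn w / bt w\<close> of squares equals
  \<open>Phi w * bt w powr (- s)\<close>, which the Gibbs bound turns into the allowance
  proportional to the mass.\<close>

lemma cover_large:
  assumes "s \<ge> 1"
  shows "\<exists>K>0. \<exists>R>0. \<forall>\<delta>. 0 < \<delta> \<longrightarrow> \<delta> < R \<longrightarrow>
    (\<exists>\<C>. finite \<C> \<and> real (card \<C>) \<le> K * \<delta> powr (- s) \<and> delta_cover \<delta> E \<C>)"
proof -
  obtain G where G: "G > 0" "\<And>w. Phi w \<le> G * mc w" using gibbs[OF assms] by blast
  obtain D where D: "D > 0" "\<And>x y. x \<in> E \<Longrightarrow> y \<in> E \<Longrightarrow> norm (x - y) \<le> D" using E_diam by blast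
  obtain x0 where x0: "x0 \<in> E" using E_ne by blast
  have c': "min b0 1 * bt w \<le> bt (w @ [i])" for w i
    using order_trans[OF mult_right_mono bt_snoc[of w i], of "min b0 1"] bt_pos[of w] by simp
  show ?thesis
  proof (rule cover_of_stopping[OF bt_le bt_pos c', of "4 * G + 12 * D"])
    fix w
    \<comment> \<open>The image \<open>?z\<close> of \<open>(1, 1)\<close> marks the long side, as
      its norm is at least \<open>nn w / 2\<close>. The extent across it is controlled by the
      determinant, because \<open>(W w *v v) \<bullet> rot (W w *v u)\<close> equals
      \<open>det (W w) * (v \<bullet> rot u)\<close>.\<close>
    let ?o = "vector [1, 1] :: real^2"
    let ?M = "W w" let ?z = "W w *v ?o"
    have z: "nn w \<le> 2 * norm ?z"
    proof -
      have "nn w = ?z $ 1 + ?z $ 2" by (simp add: nn_def esum_def mulv2_nth)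
      then show ?thesis using component_le_norm_cart[of ?z 1] component_le_norm_cart[of ?z 2] by linarith
    qed
    then have zp: "norm ?z > 0" using nn_pos[of w] by linarith
    define q where "q = inverse (norm ?z) *\<^sub>R ?z"
    have q: "norm q = 1" using zp by (simp add: q_def)
    have 1: "\<bar>(y - T w x0) \<bullet> q\<bar> \<le> nn w * D" if y: "y \<in> T w ` E" for y
    proof -
      obtain x where x: "x \<in> E" "y = T w x" using y by blast
      have "\<bar>(y - T w x0) \<bullet> q\<bar> \<le> norm (y - T w x0)"
        using Cauchy_Schwarz_ineq2[of "y - T w x0" q] q by simp
      also have "\<dots> \<le> nn w * norm (x - x0)" using norm_W_le by (simp add: x word_map_diff)
      also have "\<dots> \<le> nn w * D" using D(2)[OF x(1) x0] nn_pos[of w] by (intro mult_left_mono) auto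
      finally show ?thesis .
    qed
    have 2: "\<bar>(y - T w x0) \<bullet> rot q\<bar> \<le> 4 * D * bt w" if y: "y \<in> T w ` E" for y
    proof -
      obtain x where x: "x \<in> E" "y = T w x" using y by blast
      let ?v = "x - x0"
      have "(y - T w x0) \<bullet> rot ?z = det ?M * (?v $ 2 - ?v $ 1)"
        by (simp add: x word_map_diff inner2 mulv2_nth det_2 algebra_simps)
      then have "\<bar>(y - T w x0) \<bullet> rot ?z\<bar> = \<bar>det ?M\<bar> * \<bar>?v $ 2 - ?v $ 1\<bar>" by (simp add: abs_mult)
      also have "\<bar>?v $ 2 - ?v $ 1\<bar> \<le> 2 * D"
        using component_le_norm_cart[of ?v 1] component_le_norm_cart[of ?v 2] D(2)[OF x(1) x0] by linarith
      finally have "\<bar>(y - T w x0) \<bullet> rot ?z\<bar> \<le> \<bar>det ?M\<bar> * (2 * D)" by (simp add: mult_left_mono)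
      then have "\<bar>(y - T w x0) \<bullet> rot q\<bar> \<le> \<bar>det ?M\<bar> * (2 * D) / norm ?z"
        using zp by (simp add: q_def rot_scaleR abs_mult field_simps)
      also have "\<dots> \<le> \<bar>det ?M\<bar> * (2 * D) / (nn w / 2)"
        using z nn_pos[of w] zp D(1) by (intro divide_left_mono) auto
      also have "\<dots> = 4 * D * bt w" by (simp add: bt_def)
      finally show ?thesis .
    qed
    have b: "4 * D * bt w > 0" using D(1) bt_pos by simp
    obtain \<C> where C: "finite \<C>" "real (card \<C>) \<le> 2 * (nn w * D / (4 * D * bt w)) + 3"
      "delta_cover (3 * (4 * D * bt w)) (T w ` E) \<C>"
      using rectangle_cover[OF q _ b 1 2] nn_pos[of w] D(1) by force
    have "real (card \<C>) \<le> nn w / bt w / 2 + 3" using C(2) D(1) by (simp add: field_simps)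
    also have "\<dots> \<le> 4 * (nn w / bt w)"
    proof -
      have "1 \<le> nn w / bt w" using bt_le_nn[of w] bt_pos[of w] by (simp add: field_simps)
      moreover have "x / 2 + 3 \<le> 4 * x" if "1 \<le> x" for x :: real using that by simp
      ultimately show ?thesis by blast
    qed
    also have "nn w / bt w = Phi w * bt w powr (- s)"
    proof -
      have "bt w powr (s - 1) * bt w powr (- s) = bt w powr (- 1)" by (simp flip: powr_add)
      also have "\<dots> = inverse (bt w)" using bt_pos[of w] by (simp add: powr_minus)
      finally show ?thesis by (simp add: Phi_def divide_inverse mult.assoc)
    qed
    also have "4 * (Phi w * bt w powr (- s)) \<le> 4 * ((G * mc w) * bt w powr (- s))"
      by (intro mult_left_mono mult_right_mono G) auto
    also have "\<dots> = (4 * G) * mc w * bt w powr (- s)" by simp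
    also have "\<dots> \<le> (4 * G + 12 * D) * mc w * bt w powr (- s)"
      using D(1) by (intro mult_right_mono) auto
    finally have "real (card \<C>) \<le> (4 * G + 12 * D) * mc w * bt w powr (- s)" .
    moreover have "3 * (4 * D * bt w) \<le> (4 * G + 12 * D) * bt w"
      using G(1) bt_pos[of w] by (simp add: algebra_simps)
    then have "delta_cover ((4 * G + 12 * D) * bt w) (T w ` E) \<C>"
      using C(3) by (auto simp: delta_cover_def intro: order_trans)
    ultimately show "\<exists>\<C>. finite \<C> \<and> real (card \<C>) \<le> (4 * G + 12 * D) * mc w * bt w powr (- s)
        \<and> delta_cover ((4 * G + 12 * D) * bt w) (T w ` E) \<C>" using C(1) by blast
  qed (use b0 G D in auto)
qed

end

section \<open>Absolute continuity and independence of past and future\<close>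

lemma null_sets_lborel_scale:
  assumes "B \<in> null_sets lborel" "k \<noteq> (0::real)"
  shows "emeasure lborel {c. k * c \<in> B} = 0"
proof -
  have B: "B \<in> sets borel" using assms(1) by (auto simp: null_sets_def)
  have "emeasure lborel B = emeasure (density (distr lborel borel ((*) k)) (\<lambda>_. ennreal \<bar>k\<bar>)) B"
    using lborel_distr_mult'[OF assms(2)] by simp
  also have "\<dots> = ennreal \<bar>k\<bar> * emeasure (distr lborel borel ((*) k)) B"
    using B by (simp add: emeasure_density_const)
  also have "emeasure (distr lborel borel ((*) k)) B = emeasure lborel ((*) k -` B)"
    using B by (simp add: emeasure_distr)
  finally show ?thesis using assms by (simp add: vimage_def null_sets_def)
qed

text \<open>Projecting along \<open>rot x\<close> leaves \<open>y \<bullet> x\<close> unchanged, and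
  on the orthogonal line this functional is a nonzero multiple \<open>k\<close> of the length
  parameter. So the preimage of \<open>B\<close> is null for the line measure, and absolute
  continuity applies.\<close>

lemma projection_abs_cont_null:
  assumes "sets M = sets borel" and ac: "projection_abs_cont M (direction_of (rot x))" and x: "x \<noteq> 0"
    and B: "B \<in> null_sets lborel"
  shows "emeasure M {y. y \<bullet> x \<in> B} = 0"
proof -
  define \<theta> where "\<theta> = direction_of (rot x)"
  define u where "u = rep_direction \<theta>"
  have Bm [measurable]: "B \<in> sets borel" using B by (auto simp: null_sets_def)
  obtain c where c: "c \<noteq> 0" "u = c *\<^sub>R rot x"
    using rep_direction_of[of "rot x"] x unfolding u_def \<theta>_def by auto
  have ux: "u \<bullet> x = 0" by (simp add: c inner2)
  define k where "k = rot u \<bullet> x"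
  have "k = - c * (x \<bullet> x)" by (simp add: k_def c inner2 algebra_simps)
  then have k: "k \<noteq> 0" using c x by simp
  have [measurable]: "(\<lambda>y. y \<bullet> x) \<in> borel_measurable borel" by simp
  define Z where "Z = {y. y \<bullet> x \<in> B}"
  have Z: "Z \<in> sets borel" unfolding Z_def
    using measurable_sets[of "\<lambda>y. y \<bullet> x" borel borel B] by (simp add: vimage_def)
  have pm: "(\<lambda>t. t *\<^sub>R rot u) \<in> borel_measurable borel" by (intro borel_measurable_continuous_onI continuous_intros)
  have perp: "perp_line_measure \<theta> = distr lborel borel (\<lambda>t. t *\<^sub>R rot u)"
    by (simp add: perp_line_measure_def u_def rot_def Let_def)
  have "emeasure (perp_line_measure \<theta>) Z = emeasure lborel {t. k * t \<in> B}"
    unfolding perp using pm Z by (subst emeasure_distr) (auto simp: Z_def k_def vimage_def mult.commute)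
  also have "\<dots> = 0" by (rule null_sets_lborel_scale[OF B k])
  finally have "Z \<in> null_sets (perp_line_measure \<theta>)" using Z by (simp add: null_sets_def perp)
  then have "Z \<in> null_sets (distr M borel (orth_proj \<theta>))"
    using ac unfolding projection_abs_cont_def absolutely_continuous_def \<theta>_def by blast
  moreover have "orth_proj \<theta> \<in> M \<rightarrow>\<^sub>M borel"
    unfolding measurable_cong_sets[OF assms(1) refl] orth_proj_def[abs_def]
    by (intro borel_measurable_continuous_onI continuous_intros)
  ultimately have "emeasure M (orth_proj \<theta> -` Z \<inter> space M) = 0"
    using Z by (simp add: null_sets_def emeasure_distr)
  moreover have "orth_proj \<theta> -` Z \<inter> space M = {y. y \<bullet> x \<in> B}"
    using sets_eq_imp_space_eq[OF assms(1)] ux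
    by (auto simp: Z_def orth_proj_def inner_diff_left u_def)
  ultimately show ?thesis by simp
qed

lemma lborel_projection_null:
  fixes S :: "(real^2) set"
  assumes "compact S" "s < 1" "R > 0" "K > 0"
    and cov: "\<And>\<delta>. 0 < \<delta> \<Longrightarrow> \<delta> < R \<Longrightarrow>
      \<exists>\<C>. finite \<C> \<and> real (card \<C>) \<le> K * \<delta> powr (- s) \<and> delta_cover \<delta> S \<C>"
  shows "(\<lambda>y. y \<bullet> x) ` S \<in> null_sets lborel"
proof -
  let ?B = "(\<lambda>y. y \<bullet> x) ` S"
  have "compact ?B" by (intro compact_continuous_image continuous_intros assms)
  then have B: "?B \<in> sets lborel" by (simp add: compact_imp_closed)
  let ?h = "2 * norm x"
  have le: "emeasure lborel ?B \<le> ennreal (K * ?h * \<delta> powr (1 - s))" if \<delta>: "0 < \<delta>" "\<delta> < R" for \<delta>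
  proof -
    obtain \<C> where C: "finite \<C>" "real (card \<C>) \<le> K * \<delta> powr (- s)" "delta_cover \<delta> S \<C>"
      using cov[OF \<delta>] by blast
    define I where "I U = cball ((SOME y. y \<in> U) \<bullet> x) (norm x * \<delta>)" for U :: "(real^2) set"
    have "?B \<subseteq> (\<Union>U\<in>\<C>. I U)"
    proof clarify
      fix y assume "y \<in> S"
      then obtain U where U: "U \<in> \<C>" "y \<in> U" using C(3) by (auto simp: delta_cover_def)
      let ?z = "SOME y. y \<in> U"
      have z: "?z \<in> U" using U(2) by (rule someI)
      have "dist ?z y \<le> \<delta>"
        using diameter_bounded_bound[of U ?z y] z U C(3) by (force simp: delta_cover_def)
      have "\<bar>(?z - y) \<bullet> x\<bar> \<le> norm (?z - y) * norm x" by (rule Cauchy_Schwarz_ineq2)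
      also have "\<dots> \<le> \<delta> * norm x" using \<open>dist ?z y \<le> \<delta>\<close> by (intro mult_right_mono) (auto simp: dist_norm)
      finally have "y \<bullet> x \<in> I U" by (simp add: I_def dist_real_def inner_diff_left mult.commute)
      then show "y \<bullet> x \<in> (\<Union>U\<in>\<C>. I U)" using U by blast
    qed
    then have "emeasure lborel ?B \<le> emeasure lborel (\<Union>U\<in>\<C>. I U)"
      using C(1) by (intro emeasure_mono) (auto simp: I_def)
    also have "\<dots> \<le> (\<Sum>U\<in>\<C>. emeasure lborel (I U))"
      using C(1) by (intro emeasure_subadditive_finite) (auto simp: I_def)
    also have "\<dots> = (\<Sum>U\<in>\<C>. ennreal (?h * \<delta>))"
      using \<delta> by (intro sum.cong refl) (simp add: I_def cball_eq_atLeastAtMost)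
    also have "\<dots> = ennreal (real (card \<C>) * (?h * \<delta>))"
      using \<delta> by (simp add: ennreal_mult ennreal_of_nat_eq_real_of_nat)
    also have "\<dots> \<le> ennreal (K * \<delta> powr (- s) * (?h * \<delta>))"
      using \<delta> by (intro ennreal_leI mult_right_mono C(2)) auto
    also have "K * \<delta> powr (- s) * (?h * \<delta>) = K * ?h * (\<delta> powr (- s) * \<delta> powr 1)" using \<delta> by simp
    also have "\<dots> = K * ?h * \<delta> powr (1 - s)" by (subst powr_add[symmetric]) simp
    finally show ?thesis .
  qed
  have "emeasure lborel ?B \<le> ennreal 0"
  proof (rule tendsto_lowerbound)
    have "((\<lambda>q. q powr (1 - s)) \<longlongrightarrow> 0 powr (1 - s)) (at_right 0)"
      by (rule tendsto_powr2) (use assms(2) in \<open>auto intro!: tendsto_intros eventually_at_right_less[THEN eventually_mono]\<close>)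
    from tendsto_mult[OF tendsto_const[of "K * ?h"] this]
    show "((\<lambda>q. ennreal (K * ?h * q powr (1 - s))) \<longlongrightarrow> ennreal 0) (at_right 0)"
      by (intro tendsto_ennrealI) simp
    show "\<forall>\<^sub>F q in at_right 0. emeasure lborel ?B \<le> ennreal (K * ?h * q powr (1 - s))"
      unfolding eventually_at_right_field by (rule exI[of _ R]) (use assms(3) le in auto)
  qed auto
  then show ?thesis using B by (simp add: null_sets_def)
qed

section \<open>The two-sided process\<close>

locale furstenberg_ifs = kaenmaki_ifs A d E \<mu> for A :: "'m::finite \<Rightarrow> real^2^2" and d E \<mu> +
  fixes \<nu> :: "(int \<Rightarrow> 'm) measure"
  assumes ext: "is_two_sided_extension \<mu> \<nu>"
    and ac: "AE \<theta> in furstenberg_measure A \<nu>. projection_abs_cont (distr \<mu> borel (coding A d)) \<theta>"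
begin

definition "sh a = (\<lambda>k. a (k + 1))" for a :: "int \<Rightarrow> 'm"

lemma nu_prob: "prob_space \<nu>" and nu_sets: "sets \<nu> = sets seq_space"
  and nu_inv: "distr \<nu> \<nu> sh = \<nu>"
  using ext by (auto simp: is_two_sided_extension_def sh_def[abs_def] cong: distr_cong)

sublocale nu: prob_space \<nu> by (rule nu_prob)

lemma nu_space [simp]: "space \<nu> = UNIV"
  using sets_eq_imp_space_eq[OF nu_sets] by simp

lemma meas_nu: "measurable \<nu> N = measurable seq_space N" and meas_mu: "measurable \<mu> N = measurable seq_space N"
  by (rule measurable_cong_sets[OF nu_sets refl], rule measurable_cong_sets[OF mu_sets refl])

lemma meas_to_nu: "measurable N \<nu> = measurable N seq_space"
  by (rule measurable_cong_sets[OF refl nu_sets])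

lemma measurable_sh [measurable]: "sh \<in> \<nu> \<rightarrow>\<^sub>M \<nu>"
  unfolding meas_nu meas_to_nu sh_def[abs_def] by (rule measurable_seqI) (rule measurable_seq_component)

lemma measurable_future [measurable]: "future \<in> seq_space \<rightarrow>\<^sub>M seq_space"
  unfolding future_def[abs_def] by (rule measurable_seqI) (rule measurable_seq_component)

lemma nu_block: "measure \<nu> {a. map (\<lambda>j. a (m + int j)) [0..<length u] = u} = mc u"
proof -
  let ?S = "\<lambda>m. {a. map (\<lambda>j. a (m + int j)) [0..<length u] = u}"
  have Sm: "?S m \<in> sets \<nu>" for m
    using sets_window[of "map (\<lambda>j. m + int j) [0..<length u]" "{u}"] by (simp add: nu_sets o_def)
  have step: "measure \<nu> (?S (m + 1)) = measure \<nu> (?S m)" for m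
  proof -
    have "measure \<nu> (?S m) = measure (distr \<nu> \<nu> sh) (?S m)" by (simp add: nu_inv)
    also have "\<dots> = measure \<nu> (sh -` ?S m \<inter> space \<nu>)" by (rule measure_distr[OF measurable_sh Sm])
    also have "sh -` ?S m \<inter> space \<nu> = ?S (m + 1)" by (simp add: vimage_def sh_def add_ac)
    finally show ?thesis by simp
  qed
  have "measure \<nu> (?S m) = measure \<nu> (?S 1)"
  proof (induction m rule: int_induct[where k = 1])
    case (step2 i) then show ?case using step[of "i - 1"] by simp
  qed (use step in simp_all)
  also have "?S 1 = {a. \<forall>k<length u. a (int k + 1) = u ! k}"
    by (auto simp: list_eq_iff_nth_eq[of "map _ [0..<length u]" u] add.commute)
  also have "measure \<nu> \<dots> = mc u" using ext by (auto simp: is_two_sided_extension_def)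
  finally show ?thesis .
qed

text \<open>The extension prescribes cylinder probabilities only; domination with
  \<open>C = 1\<close> in both directions extends the agreement to all measurable sets.\<close>

lemma distr_future: "distr \<nu> seq_space future = \<mu>"
proof (rule measure_eqI)
  let ?D = "distr \<nu> seq_space future"
  have fut: "future \<in> \<nu> \<rightarrow>\<^sub>M seq_space" by (simp add: meas_nu measurable_future)
  interpret D: prob_space ?D by (rule nu.prob_space_distr[OF fut])
  show "sets ?D = sets \<mu>" by (simp add: mu_sets)
  fix S assume S: "S \<in> sets ?D"
  have eq: "measure ?D {a. pre a k = u} = measure \<mu> {a. pre a k = u}" if "length u = length [0..<k]" for k u
  proof -
    have m: "{a. pre a k = u} \<in> sets seq_space" using sets_window[of "[0..<k]" "{u}"] by simp
    have "measure ?D {a. pre a k = u} = measure \<nu> (future -` {a. pre a k = u} \<inter> space \<nu>)"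
      by (rule measure_distr[OF fut m])
    also have "future -` {a. pre a k = u} \<inter> space \<nu> = {a. map (\<lambda>j. a (1 + int j)) [0..<length u] = u}"
      using that by (simp add: vimage_def future_def[abs_def] add.commute del: map_eq_conv)
    also have "measure \<nu> \<dots> = mc u" by (rule nu_block)
    finally show ?thesis using that by (simp add: cylinder_pre)
  qed
  have win: "set [0..<k] \<subseteq> set [0..<Suc k]" "\<exists>k. i \<in> set [0..<k]" for k i :: nat
    by (auto intro: exI[of _ "Suc i"])
  have "measure ?D S \<le> 1 * measure \<mu> S"
    by (rule measure_le_of_windows[where win = "\<lambda>k. [0..<k]", OF D.finite_measure_axioms mu.finite_measure_axioms _ mu_sets win])
       (use eq S in auto)
  moreover have "measure \<mu> S \<le> 1 * measure ?D S"
    by (rule measure_le_of_windows[where win = "\<lambda>k. [0..<k]", OF mu.finite_measure_axioms D.finite_measure_axioms mu_sets _ win])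
       (use eq S mu_sets in auto)
  ultimately show "emeasure ?D S = emeasure \<mu> S"
    by (simp add: D.emeasure_eq_measure mu.emeasure_eq_measure)
qed

lemma AE_abs_cont:
  "AE a in \<nu>. projection_abs_cont (distr \<mu> borel \<pi>) (direction_of (rot (simplex_vec (normal_coord a))))"
  using AE_distrD[OF _ ac[unfolded furstenberg_measure_def]] measurable_rho by (simp add: meas_nu rho_eq)

lemma abs_cont_mu_null:
  assumes "projection_abs_cont (distr \<mu> borel \<pi>) (direction_of (rot (simplex_vec t)))" "B \<in> null_sets lborel"
  shows "AE b in \<mu>. \<pi> b \<bullet> simplex_vec t \<notin> B"
proof -
  let ?Z = "{y. y \<bullet> simplex_vec t \<in> B}"
  have Z: "?Z \<in> sets borel"
    using measurable_sets[of "\<lambda>y. y \<bullet> simplex_vec t" borel borel B] null_setsD2[OF assms(2)]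
    by (simp add: vimage_def)
  have "emeasure (distr \<mu> borel \<pi>) ?Z = 0"
    by (rule projection_abs_cont_null[OF _ assms(1) _ assms(2)]) auto
  then have "AE y in distr \<mu> borel \<pi>. y \<notin> ?Z"
    using Z by (intro AE_not_in) (auto simp: null_sets_def)
  then show ?thesis
    using AE_distrD[of \<pi> \<mu> borel] measurable_coding by (simp add: meas_mu)
qed

lemma s_ge_1: "s \<ge> 1"
proof (rule ccontr)
  assume "\<not> s \<ge> 1"
  then have s: "s < 1" by simp
  obtain K R where KR: "K > 0" "R > 0" "\<And>\<delta>. 0 < \<delta> \<Longrightarrow> \<delta> < R \<Longrightarrow>
      \<exists>\<C>. finite \<C> \<and> real (card \<C>) \<le> K * \<delta> powr (- s) \<and> delta_cover \<delta> E \<C>"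
    using cover_small[OF s] by blast
  obtain a where a: "projection_abs_cont (distr \<mu> borel \<pi>) (direction_of (rot (simplex_vec (normal_coord a))))"
    using eventually_happens'[OF _ AE_abs_cont] nu.ae_filter_bot by blast
  let ?x = "simplex_vec (normal_coord a)"
  have "AE b in \<mu>. \<pi> b \<bullet> ?x \<notin> (\<lambda>y. y \<bullet> ?x) ` E"
    by (rule abs_cont_mu_null[OF a lborel_projection_null[OF E_compact s KR(2,1,3)]])
  then have "AE b in \<mu>. False" using coding_in_E by auto
  then show False by simp
qed

text \<open>Restricted to \<open>cylinder w\<close>, the law of the shifted sequence is dominated on
  words by the quasi-Bernoulli bound, hence on all measurable sets. The extension is needed because
  a strip is not determined by finitely many letters.\<close>

lemma quasi_bernoulli_shift:
  "\<exists>C>0. \<forall>w. \<forall>S\<in>sets seq_space. measure \<mu> (cylinder w \<inter> {b. (\<lambda>k. b (k + length w)) \<in> S}) \<le> C * mc w * measure \<mu> S"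
proof -
  obtain C where C: "C > 0" "\<And>u v. mc (u @ v) \<le> C * (mc u * mc v)" using quasi_bernoulli[OF s_ge_1] by blast
  have "measure \<mu> (cylinder w \<inter> {b. (\<lambda>k. b (k + length w)) \<in> S}) \<le> C * mc w * measure \<mu> S"
    if S: "S \<in> sets seq_space" for w S
  proof -
    let ?D = "density \<mu> (indicator (cylinder w))"
    let ?f = "\<lambda>b k. b (k + length w)"
    let ?M = "distr ?D seq_space ?f"
    have f: "?f \<in> seq_space \<rightarrow>\<^sub>M seq_space" by (rule measurable_seqI) (rule measurable_seq_component)
    then have fD: "?f \<in> ?D \<rightarrow>\<^sub>M seq_space" by (simp add: meas_mu)
    have cw: "cylinder w \<in> sets \<mu>" by (simp add: mu_sets sets_cylinder)
    have eM: "emeasure ?M X = emeasure \<mu> (cylinder w \<inter> {b. ?f b \<in> X})" if X: "X \<in> sets seq_space" for X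
    proof -
      have "emeasure ?M X = emeasure ?D (?f -` X \<inter> space ?D)" by (rule emeasure_distr[OF fD X])
      also have "\<dots> = emeasure \<mu> (cylinder w \<inter> (?f -` X \<inter> space ?D))"
        using measurable_sets[OF fD X] by (intro emeasure_restricted cw) simp
      finally show ?thesis by (simp add: vimage_def)
    qed
    then have mM: "measure ?M X = measure \<mu> (cylinder w \<inter> {b. ?f b \<in> X})" if "X \<in> sets seq_space" for X
      using that by (simp add: measure_def)
    have fin: "finite_measure ?M"
      by (rule finite_measureI) (simp add: eM[OF sets.top[of seq_space], simplified] mu.emeasure_eq_measure)
    have "measure ?M S \<le> C * mc w * measure \<mu> S"
    proof (rule measure_le_of_windows[where win = "\<lambda>k. [0..<k]", OF fin mu.finite_measure_axioms _ mu_sets])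
      fix k and u :: "'m list" assume u: "length u = length [0..<k]"
      have "{a :: nat \<Rightarrow> 'm. pre a k = u} \<in> sets seq_space" using sets_window[of "[0..<k]" "{u}"] by simp
      then have "measure ?M {a. pre a k = u} = measure \<mu> (cylinder w \<inter> {b. pre (?f b) k = u})" by (simp add: mM)
      also have "cylinder w \<inter> {b. pre (?f b) k = u} = cylinder (w @ u)"
        using u by (auto simp: cylinder_pre pre_add simp del: map_eq_conv)
      also have "mc (w @ u) \<le> C * (mc w * mc u)" by (rule C)
      finally show "measure ?M {a. pre a k = u} \<le> C * mc w * measure \<mu> {a. pre a k = u}"
        using u by (simp add: cylinder_pre mult.assoc)
    qed (use C(1) S in \<open>auto intro: exI[of _ "Suc _"]\<close>)
    then show ?thesis by (simp add: mM[OF S])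
  qed
  then show ?thesis using C(1) by blast
qed

text \<open>Glues the past of one sequence to the future of another. The image of the product
  measure is the law under which past and future are independent with unchanged marginals.\<close>

definition join :: "(int \<Rightarrow> 'm) \<times> (int \<Rightarrow> 'm) \<Rightarrow> int \<Rightarrow> 'm" where
  "join z k = (if k \<le> 0 then fst z k else snd z k)"

lemma measurable_join: "join \<in> \<nu> \<Otimes>\<^sub>M \<nu> \<rightarrow>\<^sub>M seq_space"
proof (rule measurable_seqI)
  fix k :: int
  have 1: "(\<lambda>z. fst z k) \<in> \<nu> \<Otimes>\<^sub>M \<nu> \<rightarrow>\<^sub>M count_space UNIV"
    by (rule measurable_compose[OF measurable_fst]) (simp add: meas_nu)
  have 2: "(\<lambda>z. snd z k) \<in> \<nu> \<Otimes>\<^sub>M \<nu> \<rightarrow>\<^sub>M count_space UNIV"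
    by (rule measurable_compose[OF measurable_snd]) (simp add: meas_nu)
  show "(\<lambda>z. join z k) \<in> \<nu> \<Otimes>\<^sub>M \<nu> \<rightarrow>\<^sub>M count_space UNIV"
    using 1 2 by (cases "k \<le> 0") (simp_all add: join_def)
qed

text \<open>In the window from \<open>- k\<close> to \<open>k\<close> a word splits after time 0
  into a past block of length \<open>k + 1\<close> and a future block of length \<open>k\<close>,
  for which the claim is the quasi-Bernoulli bound. Events that are null under independence are
  therefore null for \<open>\<nu>\<close>.\<close>

lemma nu_le_join:
  "\<exists>C>0. \<forall>S\<in>sets seq_space. measure \<nu> S \<le> C * measure (distr (\<nu> \<Otimes>\<^sub>M \<nu>) seq_space join) S"
proof -
  obtain C where C: "C > 0" "\<And>u v. mc (u @ v) \<le> C * (mc u * mc v)" using quasi_bernoulli[OF s_ge_1] by blast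
  interpret P: pair_prob_space \<nu> \<nu> ..
  let ?N = "distr (\<nu> \<Otimes>\<^sub>M \<nu>) seq_space join"
  interpret N: prob_space ?N by (rule P.prob_space_distr[OF measurable_join])
  let ?win = "\<lambda>k. map (\<lambda>j. int j - int k) [0..<2 * k + 1]"
  have "measure \<nu> S \<le> C * measure ?N S" if S: "S \<in> sets seq_space" for S
  proof (rule measure_le_of_windows[where win = ?win, OF nu.finite_measure_axioms N.finite_measure_axioms nu_sets])
    show "set (?win k) \<subseteq> set (?win (Suc k))" for k
    proof
      fix x assume "x \<in> set (?win k)"
      then obtain j where "j < 2 * k + 1" "x = int j - int k" by force
      then show "x \<in> set (?win (Suc k))" by (auto simp: image_iff intro!: bexI[of _ "Suc j"])
    qed
    show "\<exists>k. i \<in> set (?win k)" for i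
      by (rule exI[of _ "nat \<bar>i\<bar>"]) (auto simp: image_iff intro!: bexI[of _ "nat (i + \<bar>i\<bar>)"])
    fix k and u :: "'m list" assume u: "length u = length (?win k)"
    define u1 where "u1 = take (k + 1) u"
    define u2 where "u2 = drop (k + 1) u"
    have u12: "u = u1 @ u2" "length u1 = k + 1" "length u2 = k" using u by (auto simp: u1_def u2_def)
    let ?X = "{a. map a (?win k) = u}"
    let ?A = "{a. map (\<lambda>j. a (- int k + int j)) [0..<length u1] = u1}"
    let ?B = "{a. map (\<lambda>j. a (1 + int j)) [0..<length u2] = u2}"
    have X: "?X \<in> sets seq_space" using sets_window[of "?win k" "{u}"] by simp
    have AB: "?A \<in> sets \<nu>" "?B \<in> sets \<nu>"
      using sets_window[of "map (\<lambda>j. - int k + int j) [0..<length u1]" "{u1}"]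
        sets_window[of "map (\<lambda>j. 1 + int j) [0..<length u2]" "{u2}"] by (simp_all add: nu_sets o_def)
    have "measure \<nu> ?X = mc u"
      using nu_block[of "- int k" u] u by (simp add: o_def)
    also have "\<dots> \<le> C * (mc u1 * mc u2)" unfolding u12(1) by (rule C)
    also have "mc u1 * mc u2 = measure \<nu> ?A * measure \<nu> ?B" by (simp only: nu_block)
    also have "\<dots> = measure (\<nu> \<Otimes>\<^sub>M \<nu>) (?A \<times> ?B)"
      using AB by (simp add: measure_def nu.emeasure_pair_measure_Times enn2real_mult)
    also have "?A \<times> ?B = join -` ?X \<inter> space (\<nu> \<Otimes>\<^sub>M \<nu>)"
    proof -
      have split: "map (\<lambda>j. c (int j - int k)) [0..<2 * k + 1] =
          map (\<lambda>j. c (- int k + int j)) [0..<k + 1] @ map (\<lambda>j. c (1 + int j)) [0..<k]" for c :: "int \<Rightarrow> 'm"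
      proof -
        have "[0..<2 * k + 1] = [0..<k + 1] @ map (\<lambda>j. j + (k + 1)) [0..<k]"
          using upt_add_eq_append[of 0 "k + 1" k] map_add_upt[of "k + 1" k] by (simp add: mult_2 add_ac)
        then show ?thesis by (simp add: o_def algebra_simps del: upt_Suc)
      qed
      have p1: "map (\<lambda>j. join z (- int k + int j)) [0..<k + 1] = map (\<lambda>j. fst z (- int k + int j)) [0..<k + 1]" for z
        by (auto simp: join_def)
      have p2: "map (\<lambda>j. join z (1 + int j)) [0..<k] = map (\<lambda>j. snd z (1 + int j)) [0..<k]" for z
        by (auto simp: join_def)
      have "join z \<in> ?X \<longleftrightarrow> z \<in> ?A \<times> ?B" for z
      proof -
        have "join z \<in> ?X \<longleftrightarrow> map (\<lambda>j. join z (int j - int k)) [0..<2 * k + 1] = u1 @ u2"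
          by (simp add: u12(1) o_def del: upt_Suc map_eq_conv)
        also have "\<dots> \<longleftrightarrow> map (\<lambda>j. fst z (- int k + int j)) [0..<k + 1] = u1 \<and> map (\<lambda>j. snd z (1 + int j)) [0..<k] = u2"
          unfolding split p1 p2 using u12 by (intro append_eq_append_conv) simp
        also have "\<dots> \<longleftrightarrow> z \<in> ?A \<times> ?B"
          unfolding u12(2,3) by (cases z) (simp only: fst_conv snd_conv mem_Sigma_iff mem_Collect_eq)
        finally show ?thesis .
      qed
      then show ?thesis by (auto simp: space_pair_measure)
    qed
    also have "measure (\<nu> \<Otimes>\<^sub>M \<nu>) (join -` ?X \<inter> space (\<nu> \<Otimes>\<^sub>M \<nu>)) = measure ?N ?X"
      by (rule measure_distr[OF measurable_join X, symmetric])
    finally show "measure \<nu> ?X \<le> C * measure ?N ?X" .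
  qed (use C(1) S nu_sets in auto)
  then show ?thesis using C(1) by blast
qed

end

section \<open>Lower local dimension\<close>

lemma measurable_simplex_vec [measurable]: "simplex_vec \<in> borel \<rightarrow>\<^sub>M borel"
proof -
  have "simplex_vec t = t *\<^sub>R vector [1, -1] + vector [0, 1]" for t by (simp add: vec2_eq_iff)
  then show ?thesis
    unfolding fun_eq_iff[symmetric] by (simp add: borel_measurable_continuous_onI continuous_intros cong: measurable_cong)
qed

lemma norm_simplex_vec: "t \<in> {0..1} \<Longrightarrow> norm (simplex_vec t) \<le> 1"
proof -
  assume t: "t \<in> {0..1}"
  then have "t\<^sup>2 \<le> t" "(1 - t)\<^sup>2 \<le> 1 - t" by (auto simp: power2_eq_square mult_left_le)
  then have "(norm (simplex_vec t))\<^sup>2 \<le> 1\<^sup>2" by (simp add: norm2_sq)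
  then show ?thesis by (rule power2_le_imp_le) simp
qed

section \<open>Heavy strips\<close>

context furstenberg_ifs
begin

definition strip :: "(int \<Rightarrow> 'm) \<Rightarrow> real \<Rightarrow> (nat \<Rightarrow> 'm) set" where
  "strip a \<eta> = {b. \<bar>(\<pi> b - \<pi> (future a)) \<bullet> simplex_vec (normal_coord a)\<bar> \<le> \<eta>}"

text \<open>Outside \<open>Bad k\<close>, the image of \<open>\<mu>\<close> under the functional
  given by the normal of \<open>a\<close> puts mass at most \<open>(k + 1) * \<eta>\<close> on each
  interval of radius \<open>\<eta>\<close> around the image of the point coded by the future of
  \<open>a\<close>.\<close>

definition Bad :: "nat \<Rightarrow> (int \<Rightarrow> 'm) set" where
  "Bad k = {a. \<exists>\<eta>>0. (real k + 1) * \<eta> < measure \<mu> (strip a \<eta>)}"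

lemma strip_fun_measurable:
  "(\<lambda>z. \<bar>(\<pi> (snd z) - \<pi> (future (fst z))) \<bullet> simplex_vec (normal_coord (fst z))\<bar>)
    \<in> borel_measurable (seq_space \<Otimes>\<^sub>M seq_space)"
  by measurable

lemma sets_strip: "strip a \<eta> \<in> sets seq_space"
proof -
  have "(\<lambda>b. \<bar>(\<pi> b - \<pi> (future a)) \<bullet> simplex_vec (normal_coord a)\<bar>) \<in> borel_measurable seq_space"
    by measurable
  then have "{b\<in>space seq_space. \<bar>(\<pi> b - \<pi> (future a)) \<bullet> simplex_vec (normal_coord a)\<bar> \<le> \<eta>} \<in> sets seq_space"
    by measurable
  then show ?thesis by (simp add: strip_def)
qed

lemma measure_strip_measurable: "(\<lambda>a. measure \<mu> (strip a \<eta>)) \<in> borel_measurable seq_space"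
proof -
  let ?f = "\<lambda>z. \<bar>(\<pi> (snd z) - \<pi> (future (fst z))) \<bullet> simplex_vec (normal_coord (fst z))\<bar>"
  have "{z\<in>space (seq_space \<Otimes>\<^sub>M seq_space). ?f z \<le> \<eta>} \<in> sets (seq_space \<Otimes>\<^sub>M seq_space)"
    using strip_fun_measurable by measurable
  then have "{z. ?f z \<le> \<eta>} \<in> sets (seq_space \<Otimes>\<^sub>M \<mu>)"
    by (simp add: space_pair_measure sets_pair_measure_cong[OF refl mu_sets])
  then have "(\<lambda>a. emeasure \<mu> (Pair a -` {z. ?f z \<le> \<eta>})) \<in> borel_measurable seq_space"
    by (rule mu.measurable_emeasure_Pair)
  then show ?thesis by (simp add: vimage_def strip_def measure_def)
qed

lemma strip_mono: "\<eta> \<le> \<eta>' \<Longrightarrow> measure \<mu> (strip a \<eta>) \<le> measure \<mu> (strip a \<eta>')"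
  by (intro mu.finite_measure_mono) (auto simp: strip_def[of a \<eta>'] mu_sets sets_strip[unfolded strip_def] strip_def[of a \<eta>])

lemma sets_Bad: "Bad k \<in> sets seq_space"
proof -
  let ?Q = "{q\<in>\<rat>. (0::real) < q}"
  let ?U = "\<Union>q\<in>?Q. {a\<in>space seq_space. (real k + 1) * q < measure \<mu> (strip a q)}"
  have "Bad k = ?U"
  proof (rule set_eqI)
    fix a
    have "a \<notin> Bad k" if a: "a \<notin> ?U"
    proof -
      have "measure \<mu> (strip a \<eta>) \<le> (real k + 1) * \<eta>" if "\<eta> > 0" for \<eta>
      proof (rule rational_radii[where f = "\<lambda>q. measure \<mu> (strip a q)" and g = "\<lambda>q. (real k + 1) * q"
            and r = \<eta> and R = "\<eta> + 1"])
        show "isCont (\<lambda>q. (real k + 1) * q) \<eta>" by (intro continuous_intros)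
        show "measure \<mu> (strip a q) \<le> (real k + 1) * q" if "0 < q" "q \<in> \<rat>" for q
          using a that by (auto simp: not_less)
      qed (use that strip_mono in auto)
      then show ?thesis unfolding Bad_def mem_Collect_eq by (meson not_less)
    qed
    moreover have "a \<in> Bad k" if "a \<in> ?U" using that by (auto simp: Bad_def)
    ultimately show "a \<in> Bad k \<longleftrightarrow> a \<in> ?U" by blast
  qed
  also have "?U \<in> sets seq_space"
  proof (rule sets.countable_UN'')
    show "countable ?Q" by (rule countable_subset[OF _ countable_rat]) blast
    show "{a\<in>space seq_space. (real k + 1) * q < measure \<mu> (strip a q)} \<in> sets seq_space" for q
      by (rule borel_measurable_less[OF borel_measurable_const measure_strip_measurable])
  qed
  finally show ?thesis .
qed

lemma future_join: "future (join (a, b)) = future b"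
  by (simp add: future_def[abs_def] join_def)

lemma normal_coord_join: "normal_coord (join (a, b)) = normal_coord a"
  by (rule normal_coord_cong) (simp add: join_def)

lemma AE_mu_imp_AE_nu: "AE b in \<mu>. P b \<Longrightarrow> AE a in \<nu>. P (future a)"
proof -
  assume "AE b in \<mu>. P b"
  then have "AE b in distr \<nu> seq_space future. P b" by (simp only: distr_future)
  from AE_distrD[OF _ this] show ?thesis by (simp add: meas_nu measurable_future)
qed

text \<open>A fixed past fixes the direction, so a single projected measure is involved and
  \<open>finite_upper_density\<close> leaves a Lebesgue null set to avoid. Absolute continuity makes
  this set negligible for the independent future \<open>b\<close>.\<close>

lemma Bad_product:
  assumes "projection_abs_cont (distr \<mu> borel \<pi>) (direction_of (rot (simplex_vec (normal_coord a))))"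
  shows "AE b in \<nu>. \<exists>k. join (a, b) \<notin> Bad k"
proof -
  let ?x = "simplex_vec (normal_coord a)"
  let ?f = "\<lambda>b. \<pi> b \<bullet> ?x"
  let ?p = "distr \<mu> borel ?f"
  have f: "?f \<in> borel_measurable \<mu>" unfolding meas_mu by measurable
  interpret p: prob_space ?p by (rule mu.prob_space_distr[OF f])
  obtain Z where Z: "Z \<in> null_sets lborel"
    "\<And>x. x \<notin> Z \<Longrightarrow> \<exists>k::nat. \<forall>\<eta>>0. measure ?p (cball x \<eta>) \<le> (real k + 1) * \<eta>"
    using finite_upper_density[OF p.finite_measure_axioms] by auto
  have "AE b in \<nu>. \<pi> (future b) \<bullet> ?x \<notin> Z"
    by (rule AE_mu_imp_AE_nu[OF abs_cont_mu_null[OF assms Z(1)]])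
  then show ?thesis
  proof eventually_elim
    case (elim b)
    obtain k :: nat where k: "\<And>\<eta>. \<eta> > 0 \<Longrightarrow> measure ?p (cball (\<pi> (future b) \<bullet> ?x) \<eta>) \<le> (real k + 1) * \<eta>"
      using Z(2)[OF elim] by blast
    have "measure \<mu> (strip (join (a, b)) \<eta>) \<le> (real k + 1) * \<eta>" if "\<eta> > 0" for \<eta>
    proof -
      have "measure ?p (cball (\<pi> (future b) \<bullet> ?x) \<eta>) = measure \<mu> (?f -` cball (\<pi> (future b) \<bullet> ?x) \<eta> \<inter> space \<mu>)"
        by (rule measure_distr[OF f]) simp
      also have "?f -` cball (\<pi> (future b) \<bullet> ?x) \<eta> \<inter> space \<mu> = strip (join (a, b)) \<eta>"
        by (auto simp: strip_def future_join normal_coord_join inner_diff_left dist_real_def abs_minus_commute)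
      finally show ?thesis using k[OF that] by simp
    qed
    then show ?case unfolding Bad_def mem_Collect_eq by (meson not_less)
  qed
qed

lemma Bad_anti: "decseq Bad"
proof (rule decseq_SucI)
  show "Bad (Suc k) \<subseteq> Bad k" for k
  proof
    fix a assume "a \<in> Bad (Suc k)"
    then obtain \<eta> where \<eta>: "\<eta> > 0" "(real (Suc k) + 1) * \<eta> < measure \<mu> (strip a \<eta>)" by (auto simp: Bad_def)
    then have "(real k + 1) * \<eta> < measure \<mu> (strip a \<eta>)" by (simp add: algebra_simps)
    then show "a \<in> Bad k" using \<eta>(1) by (auto simp: Bad_def)
  qed
qed

text \<open>With past and future independent, Fubini and \<open>Bad_product\<close> show that almost
  no glued sequence lies in every \<open>Bad k\<close>. Domination by \<open>nu_le_join\<close>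
  carries this to \<open>\<nu>\<close>, and the sets decrease.\<close>

lemma measure_Bad_lim: "(\<lambda>k. measure \<nu> (Bad k)) \<longlonglongrightarrow> 0"
proof -
  interpret P: pair_prob_space \<nu> \<nu> ..
  let ?B = "\<Inter>k. Bad k"
  have B: "?B \<in> sets seq_space" using sets_Bad by (intro sets.countable_INT) auto
  obtain C where C: "C > 0" "\<And>S. S \<in> sets seq_space \<Longrightarrow> measure \<nu> S \<le> C * measure (distr (\<nu> \<Otimes>\<^sub>M \<nu>) seq_space join) S"
    using nu_le_join by blast
  have jB: "join -` ?B \<inter> space (\<nu> \<Otimes>\<^sub>M \<nu>) \<in> sets (\<nu> \<Otimes>\<^sub>M \<nu>)"
    by (rule measurable_sets[OF measurable_join B])
  have "AE z in \<nu> \<Otimes>\<^sub>M \<nu>. join z \<notin> ?B"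
  proof (rule P.AE_pair_measure)
    have "{z \<in> space (\<nu> \<Otimes>\<^sub>M \<nu>). join z \<notin> ?B} = space (\<nu> \<Otimes>\<^sub>M \<nu>) - (join -` ?B \<inter> space (\<nu> \<Otimes>\<^sub>M \<nu>))" by auto
    then show "{z \<in> space (\<nu> \<Otimes>\<^sub>M \<nu>). join z \<notin> ?B} \<in> sets (\<nu> \<Otimes>\<^sub>M \<nu>)" using jB by (simp only: sets.Diff sets.top)
    show "AE a in \<nu>. AE b in \<nu>. join (a, b) \<notin> ?B"
      using AE_abs_cont
    proof eventually_elim
      case (elim a)
      show ?case using Bad_product[OF elim] by eventually_elim blast
    qed
  qed
  then have "AE z in \<nu> \<Otimes>\<^sub>M \<nu>. z \<notin> join -` ?B \<inter> space (\<nu> \<Otimes>\<^sub>M \<nu>)" by eventually_elim blast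
  then have "measure (\<nu> \<Otimes>\<^sub>M \<nu>) (join -` ?B \<inter> space (\<nu> \<Otimes>\<^sub>M \<nu>)) = 0"
    using jB by (subst (asm) AE_iff_null_sets[symmetric]) (auto simp: null_sets_def measure_def)
  then have "measure (distr (\<nu> \<Otimes>\<^sub>M \<nu>) seq_space join) ?B = 0"
    using measure_distr[OF measurable_join B] by simp
  then have "measure \<nu> ?B = 0" using C(2)[OF B] by (intro antisym) simp_all
  moreover have "(\<lambda>k. measure \<nu> (Bad k)) \<longlonglongrightarrow> measure \<nu> ?B"
    using sets_Bad Bad_anti by (intro nu.finite_Lim_measure_decseq) (auto simp: nu_sets)
  ultimately show ?thesis by simp
qed

lemma funpow_sh: "(sh ^^ n) a = (\<lambda>k. a (k + int n))"
  by (induction n) (simp_all add: sh_def add_ac)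

lemma AE_good_block:
  assumes "0 < e" "e < 1"
  shows "AE a in \<nu>. \<exists>k. \<forall>N\<ge>1. \<exists>n<N. real N - real n \<le> e * real N + 1 \<and> (\<lambda>j. a (j + int n)) \<notin> Bad k"
  using AE_good_times[OF nu_prob measurable_sh nu_inv _ measure_Bad_lim assms] sets_Bad
  by (simp add: funpow_sh nu_sets)

text \<open>
  A ball around \<open>\<pi> a\<close> that meets only one cylinder piece pulls back under the map of
  that piece into a strip, whose normal is the image of the old one under the transposed matrix.
\<close>
lemma good_time_bound:
  "\<exists>K>0. \<exists>c>0. \<forall>a n k r. (\<lambda>j. a (j + int n)) \<notin> Bad k \<longrightarrow> 0 < r \<longrightarrow> r \<le> c * bt (pre (future a) n) \<longrightarrow>
     measure \<mu> {b. dist (\<pi> b) (\<pi> (future a)) \<le> r} \<le> K * (real k + 1) * bt (pre (future a) n) powr (s - 1) * r"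
proof -
  obtain c where c: "c > 0" "\<And>a b n. b \<notin> cylinder (pre a n) \<Longrightarrow> c * bt (pre a n) \<le> dist (\<pi> b) (\<pi> a)"
    using coding_separation by blast
  obtain C where C: "C > 0" "\<And>w S. S \<in> sets seq_space \<Longrightarrow>
      measure \<mu> (cylinder w \<inter> {b. (\<lambda>k. b (k + length w)) \<in> S}) \<le> C * mc w * measure \<mu> S"
    using quasi_bernoulli_shift by blast
  obtain G where G: "G > 0" "\<And>w. mc w \<le> G * Phi w" using gibbs[OF s_ge_1] by blast
  define K where "K = C * G * (1 + kap)"
  have "measure \<mu> {b. dist (\<pi> b) (\<pi> (future a)) \<le> r} \<le> K * (real k + 1) * bt (pre (future a) n) powr (s - 1) * r"
    if good: "(\<lambda>j. a (j + int n)) \<notin> Bad k" and r: "0 < r" "r \<le> c / 2 * bt (pre (future a) n)" for a n k r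
  proof -
    let ?fa = "future a"
    define w where "w = pre ?fa n"
    let ?a' = "\<lambda>j. a (j + int n)"
    let ?f = "\<lambda>b k. b (k + length w)"
    have lw: "length w = n" by (simp add: w_def)
    \<comment> \<open>Along the normal, \<open>T w\<close> stretches by \<open>rowsum w t\<close>,
      which is at least \<open>nn w / (1 + kap)\<close>; so the ball of radius \<open>r\<close>
      pulls back into a strip of half-width \<open>\<eta>\<close>.\<close>
    define \<eta> where "\<eta> = (1 + kap) * r / nn w"
    have \<eta>: "\<eta> > 0" using r(1) kap_ge1 nn_pos[of w] by (simp add: \<eta>_def)
    have fa': "future ?a' = (\<lambda>k. ?fa (k + n))" by (simp add: future_def[abs_def] algebra_simps)
    \<comment> \<open>The ball is tested against the normal of \<open>a\<close> itself, because its
      image under \<open>tau w\<close> is the normal of the shifted sequence, which is the one that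
      \<open>Bad k\<close> controls.\<close>
    define t where "t = normal_coord a"
    have t: "t \<in> {0..1}" unfolding t_def by (rule normal_coord_mem)
    have t': "normal_coord ?a' = tau w t" unfolding t_def w_def by (rule normal_coord_shift)
    have sub: "{b. dist (\<pi> b) (\<pi> ?fa) \<le> r} \<subseteq> cylinder w \<inter> {b. ?f b \<in> strip ?a' \<eta>}"
    proof
      fix b assume b: "b \<in> {b. dist (\<pi> b) (\<pi> ?fa) \<le> r}"
      \<comment> \<open>Halving \<open>c\<close> makes this strict, so that no point outside the
        cylinder can be as close as \<open>r\<close>.\<close>
      have "r < c * bt w" using r c(1) bt_pos[of w] by (simp add: w_def)
      then have bw: "b \<in> cylinder w" using b c(2)[of b ?fa n] by (force simp: w_def)
      then have pb: "pre b n = w" by (simp add: cylinder_pre lw)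
      let ?v = "\<pi> (?f b) - \<pi> (future ?a')"
      have "\<pi> b - \<pi> ?fa = T w (\<pi> (?f b)) - T w (\<pi> (future ?a'))"
        using coding_shift[of b n] coding_shift[of ?fa n] pb by (simp add: fa' lw w_def)
      also have "\<dots> = W w *v ?v" by (rule word_map_diff)
      finally have eq: "(\<pi> b - \<pi> ?fa) \<bullet> simplex_vec t = rowsum w t * (?v \<bullet> simplex_vec (tau w t))"
        using inner_W_simplex[OF t] by simp
      have "\<bar>(\<pi> b - \<pi> ?fa) \<bullet> simplex_vec t\<bar> \<le> norm (\<pi> b - \<pi> ?fa) * norm (simplex_vec t)"
        by (rule Cauchy_Schwarz_ineq2)
      also have "\<dots> \<le> r * 1" using b r(1) norm_simplex_vec[OF t] by (intro mult_mono) (auto simp: dist_norm)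
      finally have "rowsum w t * \<bar>?v \<bullet> simplex_vec (tau w t)\<bar> \<le> r"
        using rowsum_pos[OF t, of w] by (simp add: eq abs_mult)
      then have "(1 + kap) * (rowsum w t * \<bar>?v \<bullet> simplex_vec (tau w t)\<bar>) \<le> (1 + kap) * r"
        using kap_ge1 by (intro mult_left_mono) auto
      moreover have "nn w * \<bar>?v \<bullet> simplex_vec (tau w t)\<bar> \<le> (1 + kap) * rowsum w t * \<bar>?v \<bullet> simplex_vec (tau w t)\<bar>"
        by (intro mult_right_mono rowsum_ge t) auto
      ultimately have "nn w * \<bar>?v \<bullet> simplex_vec (tau w t)\<bar> \<le> (1 + kap) * r" by (simp only: mult.assoc)
      then have "\<bar>?v \<bullet> simplex_vec (tau w t)\<bar> \<le> \<eta>" using nn_pos[of w] by (simp add: \<eta>_def field_simps)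
      then show "b \<in> cylinder w \<inter> {b. ?f b \<in> strip ?a' \<eta>}" using bw by (simp add: strip_def t')
    qed
    have f: "?f \<in> seq_space \<rightarrow>\<^sub>M seq_space" by (rule measurable_seqI) (rule measurable_seq_component)
    have "{b. ?f b \<in> strip ?a' \<eta>} \<in> sets seq_space"
      using measurable_sets[OF f sets_strip[of ?a' \<eta>]] by (simp add: vimage_def)
    then have "measure \<mu> {b. dist (\<pi> b) (\<pi> ?fa) \<le> r} \<le> measure \<mu> (cylinder w \<inter> {b. ?f b \<in> strip ?a' \<eta>})"
      using sub by (intro mu.finite_measure_mono) (auto simp: mu_sets sets_cylinder)
    also have "\<dots> \<le> C * mc w * measure \<mu> (strip ?a' \<eta>)" by (rule C(2)[OF sets_strip])
    also have "\<dots> \<le> C * (G * Phi w) * ((real k + 1) * \<eta>)"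
    proof (intro mult_mono mult_left_mono G(2))
      show "measure \<mu> (strip ?a' \<eta>) \<le> (real k + 1) * \<eta>"
        using good \<eta> unfolding Bad_def mem_Collect_eq by (meson not_less)
    qed (use C(1) G(1) Phi_pos[of w] in \<open>auto intro: less_imp_le\<close>)
    \<comment> \<open>The factor \<open>nn w\<close> of \<open>Phi w\<close> cancels against the one
      in \<open>\<eta>\<close>.\<close>
    also have "\<dots> = K * (real k + 1) * bt w powr (s - 1) * r"
      using nn_pos[of w] by (simp add: K_def Phi_def \<eta>_def)
    finally show ?thesis by (simp add: w_def)
  qed
  moreover have "K > 0" "c / 2 > 0" using C(1) G(1) kap_ge1 c(1) by (auto simp: K_def)
  ultimately show ?thesis by blast
qed

section \<open>From good times to all radii\<close>

abbreviation "M \<equiv> distr \<mu> borel \<pi>"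

lemma pi_mu: "\<pi> \<in> \<mu> \<rightarrow>\<^sub>M borel"
  by (simp add: meas_mu measurable_coding)

lemma M_cball: "measure M (cball x r) = measure \<mu> {b. dist (\<pi> b) x \<le> r}"
  by (subst measure_distr[OF pi_mu]) (auto simp: vimage_def dist_commute intro!: arg_cong[where f = "measure \<mu>"])

text \<open>A radius \<open>r\<close> is reached at some time \<open>N\<close>, and a good time
  \<open>n\<close> lags behind it by at most about \<open>e * N\<close>. Using the bound at time
  \<open>n\<close> costs a factor exponential in \<open>e * N\<close>, that is a small negative
  power of \<open>r\<close>, and \<open>e\<close> is chosen so that this loss stays below
  \<open>s - t\<close>.\<close>

lemma AE_lower_dim:
  assumes t: "t < s"
  shows "AE a in \<nu>. \<exists>R>0. \<pi> (future a) \<in> upper_regular M t R"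
proof -
  obtain K c where K: "K > 0" and c: "c > 0" and bound: "\<And>a n k r. (\<lambda>j. a (j + int n)) \<notin> Bad k \<Longrightarrow> 0 < r \<Longrightarrow>
      r \<le> c * bt (pre (future a) n) \<Longrightarrow>
      measure \<mu> {b. dist (\<pi> b) (\<pi> (future a)) \<le> r} \<le> K * (real k + 1) * bt (pre (future a) n) powr (s - 1) * r"
    using good_time_bound by blast
  have crp: "cr > 0" using nn_le[of "[undefined]"] nn_pos[of "[undefined]"] by simp
  \<comment> \<open>Kept below 1 so that its logarithm is negative even if \<open>b0\<close> is
    large.\<close>
  define \<beta> where "\<beta> = min b0 (1/2)"
  have \<beta>: "0 < \<beta>" "\<beta> < 1" "\<beta> \<le> b0" using b0(1) by (auto simp: \<beta>_def)
  \<comment> \<open>Writes \<open>\<beta>\<close> as a power of \<open>cr\<close>, because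
    \<open>cr ^ N\<close> is bounded below by a multiple of \<open>r\<close>.\<close>
  define q where "q = ln \<beta> / ln cr"
  have lncr: "ln cr < 0" using crp cr(2) by simp
  have q: "q > 0" using \<beta>(1,2) lncr by (simp add: q_def divide_neg_neg)
  have \<beta>q: "\<beta> = cr powr q" using lncr crp \<beta> by (simp add: q_def powr_def)
  \<comment> \<open>Chosen so that the lost exponent \<open>u = q * e * (s - 1)\<close> is at most
    \<open>(s - t) / 2\<close>.\<close>
  define e where "e = min (1/2) ((s - t) / (2 * (q * s)))"
  have qs: "q * s > 0" using q s_ge_1 by simp
  have e: "0 < e" "e < 1" using t qs by (auto simp: e_def)
  define u where "u = q * e * (s - 1)"
  have u0: "u \<ge> 0" using q e s_ge_1 by (simp add: u_def)
  have "u \<le> (q * s) * e" using q e s_ge_1 by (simp add: u_def algebra_simps)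
  also have "\<dots> \<le> (q * s) * ((s - t) / (2 * (q * s)))" using qs by (intro mult_left_mono) (auto simp: e_def)
  also have "\<dots> = (s - t) / 2"
  proof -
    have "y * ((s - t) / (2 * y)) = (s - t) / 2" if "y > 0" for y :: real using that by (simp add: field_simps)
    from this[OF qs] show ?thesis .
  qed
  finally have u: "u \<le> (s - t) / 2" .
  show ?thesis
    using AE_good_block[OF e]
  proof eventually_elim
    case (elim a)
    then obtain k where k: "\<And>N. N \<ge> 1 \<Longrightarrow> \<exists>n<N. real N - real n \<le> e * real N + 1 \<and> (\<lambda>j. a (j + int n)) \<notin> Bad k"
      by blast
    let ?x = "\<pi> (future a)"
    define \<gamma> where "\<gamma> n = bt (pre (future a) n)" for n
    have \<gamma>p: "\<gamma> n > 0" for n by (simp add: \<gamma>_def bt_pos)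
    define C2 where "C2 = K * (real k + 1) * ((\<beta> powr (- (e + 1)) / c) powr (s - 1) * (1 / (4 * c)) powr (- u))"
    have C2: "C2 > 0" using K c \<beta> by (simp add: C2_def)
    \<comment> \<open>The bound by \<open>c * \<gamma> 0\<close> makes \<open>r\<close> admissible
      at time 0, and the last one makes \<open>C2 * r powr (s - u - t)\<close> at most 1.\<close>
    define R where "R = min 1 (min (c * \<gamma> 0) ((1 / C2) powr (1 / (s - u - t))))"
    have sut: "s - u - t > 0" using u t by (simp add: field_simps)
    have R: "R > 0" using c \<gamma>p[of 0] C2 by (simp add: R_def)
    have main: "measure \<mu> {b. dist (\<pi> b) ?x \<le> r} \<le> r powr t" if r: "0 < r" "r < R" for r
    proof -
      have "(\<lambda>n. cr ^ n * (4 * c)) \<longlonglongrightarrow> 0" by (rule cr_pow_0)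
      then have "eventually (\<lambda>n. cr ^ n * (4 * c) < r) sequentially" using r(1) by (intro order_tendstoD(2))
      then obtain N0 where N0: "\<And>n. n \<ge> N0 \<Longrightarrow> cr ^ n * (4 * c) < r" by (auto simp: eventually_sequentially)
      have small: "c * \<gamma> n \<le> cr ^ n * (4 * c)" for n
        using bt_le[of "pre (future a) n"] c by (simp add: \<gamma>_def mult.commute)
      have ex: "\<exists>n. c * \<gamma> (Suc n) < r" using small[of "Suc N0"] N0[of "Suc N0"] by (intro exI[of _ N0]) simp
      \<comment> \<open>The first failure of \<open>r \<le> c * \<gamma> n\<close> comes at
        \<open>Suc N\<close>, so \<open>good_time_bound\<close> may be used at every good
        \<open>n < Suc N\<close>; this is why the block is taken with length
        \<open>Suc N\<close>.\<close>
      define N where "N = (LEAST n. c * \<gamma> (Suc n) < r)"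
      have N: "c * \<gamma> (Suc N) < r" unfolding N_def by (rule LeastI_ex[OF ex])
      have big: "r \<le> c * \<gamma> n" if "n \<le> N" for n
      proof (cases n)
        case 0 then show ?thesis using r by (simp add: R_def)
      next
        case (Suc m)
        then have "m < N" using that by simp
        then show ?thesis using not_less_Least[of m "\<lambda>n. c * \<gamma> (Suc n) < r"] Suc by (simp add: N_def)
      qed
      obtain n where n: "n < Suc N" "real (Suc N) - real n \<le> e * real (Suc N) + 1" "(\<lambda>j. a (j + int n)) \<notin> Bad k"
        using k[of "Suc N"] by auto
      have b1: "measure \<mu> {b. dist (\<pi> b) ?x \<le> r} \<le> K * (real k + 1) * \<gamma> n powr (s - 1) * r"
        using bound[OF n(3) r(1)] big[of n] n(1) by (simp add: \<gamma>_def)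
      have "\<beta> powr (e * real N + (e + 1)) \<le> \<beta> powr (real (Suc N - n))"
        using n(1,2) \<beta> by (intro powr_mono_both' powr_mono') (auto simp: algebra_simps of_nat_diff)
      also have "\<dots> = \<beta> ^ (Suc N - n)" using \<beta>(1) by (simp add: powr_realpow)
      also have "\<dots> \<le> b0 ^ (Suc N - n)" using \<beta> by (intro power_mono) auto
      finally have "\<beta> powr (e * real N + (e + 1)) * \<gamma> n \<le> b0 ^ (Suc N - n) * \<gamma> n"
        using \<gamma>p[of n] by (intro mult_right_mono) auto
      also have "\<dots> \<le> \<gamma> (Suc N)"
      proof -
        have "pre (future a) (Suc N) = pre (future a) n @ pre (\<lambda>k. future a (k + n)) (Suc N - n)"
          using pre_add[of "future a" n "Suc N - n"] n(1) by simp
        then show ?thesis using bt_append_ge_pow[of "pre (\<lambda>k. future a (k + n)) (Suc N - n)" "pre (future a) n"]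
          by (simp only: \<gamma>_def length_map length_upt diff_zero)
      qed
      also have "\<dots> \<le> r / c" using N c by (simp add: field_simps)
      finally have g0: "\<beta> powr (e * real N + (e + 1)) * \<gamma> n \<le> r / c" .
      have "y \<le> inverse X * z" if "X * y \<le> z" "X > 0" for X y z :: real
        using that by (simp add: field_simps)
      from this[OF g0] have g1: "\<gamma> n \<le> \<beta> powr (- (e * real N + (e + 1))) * (r / c)"
        using \<beta>(1) unfolding powr_minus by simp
      have "\<gamma> n powr (s - 1) \<le> (\<beta> powr (- (e * real N + (e + 1))) * (r / c)) powr (s - 1)"
        using g1 \<gamma>p[of n] s_ge_1 by (intro powr_mono2) auto
      also have "\<dots> = (\<beta> powr (- (e + 1)) / c * r) powr (s - 1) * \<beta> powr (- (e * real N * (s - 1)))"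
      proof -
        have "\<beta> powr (- (e * real N + (e + 1))) * (r / c) = (\<beta> powr (- (e + 1)) / c * r) * \<beta> powr (- (e * real N))"
          by (simp add: powr_add[symmetric] algebra_simps)
        moreover have "- (e * real N) * (s - 1) = - (e * real N * (s - 1))" by simp
        ultimately show ?thesis by (simp only: powr_mult powr_powr)
      qed
      also have "\<beta> powr (- (e * real N * (s - 1))) = (cr ^ N) powr (- u)"
        using crp by (simp add: \<beta>q powr_powr u_def powr_realpow[symmetric] algebra_simps)
      also have "(cr ^ N) powr (- u) \<le> (r * (1 / (4 * c))) powr (- u)"
      proof (rule powr_mono2')
        have "r \<le> cr ^ N * (4 * c)" using big[of N] small[of N] by simp
        then show "r * (1 / (4 * c)) \<le> cr ^ N" using c by (simp add: field_simps)
      qed (use u0 r c in auto)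
      finally have g2: "\<gamma> n powr (s - 1) \<le> (\<beta> powr (- (e + 1)) / c * r) powr (s - 1) * (r * (1 / (4 * c))) powr (- u)"
        by (simp add: mult_left_mono)
      have "measure \<mu> {b. dist (\<pi> b) ?x \<le> r}
          \<le> K * (real k + 1) * ((\<beta> powr (- (e + 1)) / c * r) powr (s - 1) * (r * (1 / (4 * c))) powr (- u)) * r"
        by (rule order_trans[OF b1]) (use g2 K r(1) in \<open>auto intro!: mult_right_mono mult_left_mono\<close>)
      also have "\<dots> = C2 * (r powr (s - 1) * r powr (- u) * r powr 1)"
        unfolding powr_mult C2_def using r(1) by (simp only: powr_one mult_ac)
      also have "r powr (s - 1) * r powr (- u) * r powr 1 = r powr (t + (s - u - t))"
        by (simp only: powr_add[symmetric]) (simp add: algebra_simps)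
      also have "C2 * r powr (t + (s - u - t)) = r powr t * (C2 * r powr (s - u - t))"
        by (simp only: powr_add mult_ac)
      also have "\<dots> \<le> r powr t * 1"
      proof (intro mult_left_mono)
        have "r powr (s - u - t) \<le> ((1 / C2) powr (1 / (s - u - t))) powr (s - u - t)"
          using r sut by (intro powr_mono2) (auto simp: R_def)
        also have "\<dots> = 1 / C2" using sut C2 by (simp add: powr_powr)
        finally show "C2 * r powr (s - u - t) \<le> 1" using C2 by (simp add: field_simps)
      qed auto
      finally show ?thesis by simp
    qed
    show ?case
      by (rule exI[of _ R]) (use R main in \<open>auto simp: upper_regular_def M_cball\<close>)
  qed
qed

text \<open>Passing from sequences to points needs a measurable event, so arbitrary radii are
  replaced by the countably many \<open>1 / real (Suc n)\<close>.\<close>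

lemma AE_M_upper_regular:
  assumes t: "t < s"
  shows "AE x in M. \<exists>R>0. x \<in> upper_regular M t R"
proof -
  have fin: "finite_measure M" using mu.prob_space_distr[OF pi_mu] by (rule prob_space.finite_measure)
  have eq: "(\<exists>R>0. x \<in> upper_regular M t R) \<longleftrightarrow> (\<exists>n. x \<in> upper_regular M t (1 / real (Suc n)))" for x
  proof
    assume "\<exists>R>0. x \<in> upper_regular M t R"
    then obtain R where R: "R > 0" "x \<in> upper_regular M t R" by blast
    obtain n where "1 / real (Suc n) < R" using reals_Archimedean[OF R(1)] by (auto simp: inverse_eq_divide)
    then show "\<exists>n. x \<in> upper_regular M t (1 / real (Suc n))" using R(2)
      by (intro exI[of _ n]) (auto simp: upper_regular_def)
  next
    assume "\<exists>n. x \<in> upper_regular M t (1 / real (Suc n))"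
    then obtain n where n: "x \<in> upper_regular M t (1 / real (Suc n))" ..
    have "1 / real (Suc n) > 0" by simp
    then show "\<exists>R>0. x \<in> upper_regular M t R" using n by blast
  qed
  have "{x. \<exists>n. x \<in> upper_regular M t (1 / real (Suc n))} = (\<Union>n. upper_regular M t (1 / real (Suc n)))" by blast
  also have "\<dots> \<in> sets borel"
    by (rule sets.countable_UN) (use upper_regular_borel[OF fin] in auto)
  finally have m: "{x\<in>space borel. \<exists>R>0. x \<in> upper_regular M t R} \<in> sets borel" by (simp add: eq)
  have pf: "(\<lambda>a. \<pi> (future a)) \<in> \<nu> \<rightarrow>\<^sub>M borel" unfolding meas_nu by measurable
  have "M = distr (distr \<nu> seq_space future) borel \<pi>" by (simp add: distr_future)
  also have "\<dots> = distr \<nu> borel (\<lambda>a. \<pi> (future a))"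
    by (subst distr_distr) (auto simp: meas_nu measurable_future measurable_coding o_def)
  finally have M: "M = distr \<nu> borel (\<lambda>a. \<pi> (future a))" .
  show ?thesis
    by (subst (1) M, subst AE_distr_iff[OF pf m]) (rule AE_lower_dim[OF t])
qed

lemma dimensions_eq: "exact_dimensional M \<and> hausdorff_dim E = s \<and> has_box_dim E s"
proof -
  obtain K R where KR: "K > 0" "R > 0" "\<And>\<delta>. 0 < \<delta> \<Longrightarrow> \<delta> < R \<Longrightarrow>
      \<exists>\<C>. finite \<C> \<and> real (card \<C>) \<le> K * \<delta> powr (- s) \<and> delta_cover \<delta> E \<C>"
    using cover_large[OF s_ge_1] by blast
  interpret mass_distribution M E s K R
  proof (intro mass_distribution.intro mass_distribution_axioms.intro)
    show "prob_space M" by (rule mu.prob_space_distr[OF pi_mu])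
    show "AE x in M. x \<in> E"
      by (subst AE_distr_iff[OF pi_mu]) (use E_compact coding_in_E in \<open>auto simp: compact_imp_closed\<close>)
    show "s > 0" using s_ge_1 by linarith
  qed (use E_compact KR AE_M_upper_regular in auto)
  show ?thesis using exact_dimensional hausdorff_dim_eq has_box_dim by blast
qed

end

theorem theorem1:
  fixes A :: "'m::finite \<Rightarrow> real^2^2"
    and d :: "'m \<Rightarrow> real^2"
    and E :: "(real^2) set"
    and \<mu> :: "(nat \<Rightarrow> 'm) measure"
    and \<nu> :: "(int \<Rightarrow> 'm) measure"
  assumes "\<And>i. invertible (A i)"
    and "\<And>i j k. A i $ j $ k > 0"
    and "\<And>i. onorm ((*v) (A i)) < 1"
    and "is_attractor A d E"
    and "disjoint_family (\<lambda>i. ifs_map A d i ` E)"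
    and "is_kaenmaki_measure A \<mu>"
    and "is_two_sided_extension \<mu> \<nu>"
    and "AE \<theta> in furstenberg_measure A \<nu>. projection_abs_cont (distr \<mu> borel (coding A d)) \<theta>"
  shows "exact_dimensional (distr \<mu> borel (coding A d)) \<and>
         hausdorff_dim E = affinity_dim A \<and>
         has_box_dim E (affinity_dim A)"
proof -
  interpret furstenberg_ifs A d E \<mu> \<nu>
    by unfold_locales (use assms in auto)
  show ?thesis by (rule dimensions_eq)
qed

end
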